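(* There exists a deterministic algorithm that, on an input $G$ in the class $\mathcal{S}$ given as a black-box, outputs an element $z\in G$ and a set $M$ of elements of $G$ such that $(\langle M\rangle,\langle z\rangle)$ is a standard decomposition of $G$. The time complexity of this algorithm is $O(|G|^{1/2+o(1)})$.
   Context: All groups are finite. A finite group $G$ is in the class $\mathcal{S}$ if there exist a normal abelian subgroup $A$ of $G$ and an element $y\in G$ of order coprime with $|A|$ such that $G=\langle A,y\rangle$. For a finite group $G$ and a positive integer $m$, $\mathcal{D}^m_G$ denotes the (possibly empty) set of pairs $(A,B)$ such that: (i) $A$ is a normal abelian subgroup of $G$ of order coprime with $m$; (ii) $B$ is a cyclic subgroup of $G$ of order $m$; (iii) $G=AB$. For $G$ in $\mathcal{S}$, $\gamma(G)$ is the smallest positive integer $m$ such that $G$ is an extension of an abelian group $A$ by the cyclic group $\mathbb{Z}_m$ with $\gcd(|A|,m)=1$; equivalently, the smallest positive integer $m$ with $\mathcal{D}^m_G\neq\varnothing$. A standard decomposition of $G$ is an element of $\mathcal{D}^{\gamma(G)}_G$. Black-box groups: elements of the group are represented by strings of the same length, each element being encoded by a unique string. An oracle, given strings representing $g$ and $g'$, outputs the string representing $gg'$; another oracle, given the string representing $g$, outputs the string representing $g^{-1}$. A group $G$ is input as a black-box if a set of strings representing generators $\{g_1,\ldots,g_s\}$ of $G$ with $s=O(\log|G|)$ is given as input and queries to the multiplication and inversion oracles can be done at cost 1. *)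

theory Defs
  imports
    "HOL-Algebra.Algebra"
    "HOL-Library.Landau_Symbols"
    "HOL-Library.Log_Nat"
begin

section \<open>The class \<open>\<S>\<close> and standard decompositions\<close>

definition in_class_S :: "('a, 'b) monoid_scheme \<Rightarrow> bool" where
  "in_class_S G \<longleftrightarrow> group G \<and> finite (carrier G) \<and>
     (\<exists>A y. A \<lhd> G \<and> comm_group (G\<lparr>carrier := A\<rparr>) \<and> y \<in> carrier G \<and>
            coprime (group.ord G y) (card A) \<and> carrier G = generate G (A \<union> {y}))"

definition decompositions :: "('a, 'b) monoid_scheme \<Rightarrow> nat \<Rightarrow> ('a set \<times> 'a set) set" where
  "decompositions G m = {(A, B).
     A \<lhd> G \<and> comm_group (G\<lparr>carrier := A\<rparr>) \<and> coprime (card A) m \<and>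
     subgroup B G \<and> cyclic_group (G\<lparr>carrier := B\<rparr>) \<and> card B = m \<and>
     carrier G = A <#>\<^bsub>G\<^esub> B}"

text \<open>Up to isomorphism, an extension of an abelian group by \<open>\<int>\<^sub>m\<close> is a group with an abelian
  normal subgroup \<open>A\<close> and quotient \<open>\<int>\<^sub>m\<close>.\<close>

definition coprime_cyclic_extension :: "('a, 'b) monoid_scheme \<Rightarrow> nat \<Rightarrow> bool" where
  "coprime_cyclic_extension G m \<longleftrightarrow>
     (\<exists>A. A \<lhd> G \<and> comm_group (G\<lparr>carrier := A\<rparr>) \<and>
          (G Mod A) \<cong> integer_mod_group m \<and> coprime (card A) m)"

definition gamma :: "('a, 'b) monoid_scheme \<Rightarrow> nat" where
  "gamma G = (LEAST m. 0 < m \<and> coprime_cyclic_extension G m)"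

definition standard_decompositions :: "('a, 'b) monoid_scheme \<Rightarrow> ('a set \<times> 'a set) set" where
  "standard_decompositions G = decompositions G (gamma G)"


section \<open>Black-box groups\<close>

text \<open>An element is identified with the bit string encoding it, so that a black-box group is a
  group whose carrier consists of bit strings of one common length. Since the strings are the
  elements, \<open>x \<otimes>\<^bsub>G\<^esub> y\<close> and \<open>inv\<^bsub>G\<^esub> x\<close> are the answers of the two oracles; the values of these
  functions outside the carrier are unconstrained. At least one generator is given, since otherwise
  no string would be available for the trivial group.\<close>

type_synonym bitstring = "bool list"

definition black_box_input :: "bitstring monoid \<Rightarrow> bitstring list \<Rightarrow> bool" where
  "black_box_input G gs \<longleftrightarrow> group G \<and> finite (carrier G) \<and>
     (\<exists>l. \<forall>x \<in> carrier G. length x = l) \<and>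
     gs \<noteq> [] \<and> set gs \<subseteq> carrier G \<and> generate G (set gs) = carrier G"


section \<open>Deterministic algorithms with group oracles\<close>

text \<open>Algorithms are programs for a random access machine, written in a structured imperative
  language. The memory consists of arrays of natural numbers and of arrays of bit strings, named
  by variable names; a scalar variable is an array of which only entry \<open>0\<close> is used.

  Arithmetic is charged by the logarithmic cost criterion: evaluating a node of an arithmetic
  expression costs the bit length of its value, and the value of an array index is charged in this
  way as well. Bit strings are handled as atomic words: reading or writing one, comparing two of
  them lexicographically, and calling either of the two oracles \<open>EMult\<close>, \<open>EInv\<close> costs 1. A program
  can obtain strings encoding group elements only from its input and from the oracles.\<close>

type_synonym vname = string

datatype aexp =
    Const nat
  | NumAt vname aexp
  | Add aexp aexp
  | Sub aexp aexp
  | Mul aexp aexp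
  | Div aexp aexp

datatype eexp =
    EltAt vname aexp
  | EMult eexp eexp
  | EInv eexp

datatype bexp =
    ALess aexp aexp
  | ELess eexp eexp
  | BNot bexp
  | BAnd bexp bexp

datatype com =
    Skip
  | NumAssign vname aexp aexp
  | EltAssign vname aexp eexp
  | Seq com com
  | If bexp com com
  | While bexp com

record state =
  num :: "vname \<Rightarrow> nat \<Rightarrow> nat"
  elt :: "vname \<Rightarrow> nat \<Rightarrow> bitstring"

definition bits :: "nat \<Rightarrow> nat" where
  "bits n = max 1 (floorlog 2 n)"

primrec aval :: "state \<Rightarrow> aexp \<Rightarrow> nat" where
  "aval s (Const n) = n"
| "aval s (NumAt x a) = num s x (aval s a)"
| "aval s (Add a b) = aval s a + aval s b"
| "aval s (Sub a b) = aval s a - aval s b"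
| "aval s (Mul a b) = aval s a * aval s b"
| "aval s (Div a b) = aval s a div aval s b"

primrec acost :: "state \<Rightarrow> aexp \<Rightarrow> nat" where
  "acost s (Const n) = bits n"
| "acost s (NumAt x a) = acost s a + bits (num s x (aval s a))"
| "acost s (Add a b) = acost s a + acost s b + bits (aval s a + aval s b)"
| "acost s (Sub a b) = acost s a + acost s b + bits (aval s a - aval s b)"
| "acost s (Mul a b) = acost s a + acost s b + bits (aval s a * aval s b)"
| "acost s (Div a b) = acost s a + acost s b + bits (aval s a div aval s b)"

primrec eval_elt :: "bitstring monoid \<Rightarrow> state \<Rightarrow> eexp \<Rightarrow> bitstring" where
  "eval_elt G s (EltAt x a) = elt s x (aval s a)"
| "eval_elt G s (EMult e f) = eval_elt G s e \<otimes>\<^bsub>G\<^esub> eval_elt G s f"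
| "eval_elt G s (EInv e) = inv\<^bsub>G\<^esub> (eval_elt G s e)"

primrec ecost :: "state \<Rightarrow> eexp \<Rightarrow> nat" where
  "ecost s (EltAt x a) = acost s a + 1"
| "ecost s (EMult e f) = ecost s e + ecost s f + 1"
| "ecost s (EInv e) = ecost s e + 1"

primrec bval :: "bitstring monoid \<Rightarrow> state \<Rightarrow> bexp \<Rightarrow> bool" where
  "bval G s (ALess a b) \<longleftrightarrow> aval s a < aval s b"
| "bval G s (ELess e f) \<longleftrightarrow> ord_class.lexordp (eval_elt G s e) (eval_elt G s f)"
| "bval G s (BNot b) \<longleftrightarrow> \<not> bval G s b"
| "bval G s (BAnd b c) \<longleftrightarrow> bval G s b \<and> bval G s c"

primrec bcost :: "state \<Rightarrow> bexp \<Rightarrow> nat" where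
  "bcost s (ALess a b) = acost s a + acost s b + 1"
| "bcost s (ELess e f) = ecost s e + ecost s f + 1"
| "bcost s (BNot b) = bcost s b + 1"
| "bcost s (BAnd b c) = bcost s b + bcost s c + 1"

definition num_upd :: "vname \<Rightarrow> nat \<Rightarrow> nat \<Rightarrow> state \<Rightarrow> state" where
  "num_upd x i n s = s\<lparr>num := (num s)(x := (num s x)(i := n))\<rparr>"

definition elt_upd :: "vname \<Rightarrow> nat \<Rightarrow> bitstring \<Rightarrow> state \<Rightarrow> state" where
  "elt_upd x i w s = s\<lparr>elt := (elt s)(x := (elt s x)(i := w))\<rparr>"

text \<open>\<open>exec G c s t s'\<close>: with oracles for \<open>G\<close>, program \<open>c\<close> started in state \<open>s\<close> halts in state
  \<open>s'\<close> after time exactly \<open>t\<close>.\<close>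

inductive exec :: "bitstring monoid \<Rightarrow> com \<Rightarrow> state \<Rightarrow> nat \<Rightarrow> state \<Rightarrow> bool" for G where
  Skip: "exec G Skip s 1 s"
| NumAssign: "exec G (NumAssign x i a) s (acost s i + acost s a + 1)
                (num_upd x (aval s i) (aval s a) s)"
| EltAssign: "exec G (EltAssign x i e) s (acost s i + ecost s e + 1)
                (elt_upd x (aval s i) (eval_elt G s e) s)"
| Seq: "exec G c1 s1 t1 s2 \<Longrightarrow> exec G c2 s2 t2 s3 \<Longrightarrow> exec G (Seq c1 c2) s1 (t1 + t2) s3"
| IfTrue: "bval G s b \<Longrightarrow> exec G c1 s t s' \<Longrightarrow> exec G (If b c1 c2) s (bcost s b + t + 1) s'"
| IfFalse: "\<not> bval G s b \<Longrightarrow> exec G c2 s t s' \<Longrightarrow> exec G (If b c1 c2) s (bcost s b + t + 1) s'"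
| WhileFalse: "\<not> bval G s b \<Longrightarrow> exec G (While b c) s (bcost s b + 1) s"
| WhileTrue: "bval G s1 b \<Longrightarrow> exec G c s1 t1 s2 \<Longrightarrow> exec G (While b c) s2 t2 s3 \<Longrightarrow>
                exec G (While b c) s1 (bcost s1 b + t1 + t2 + 1) s3"

inductive_cases SkipE: "exec G Skip s t s'"
inductive_cases NumAssignE: "exec G (NumAssign x i a) s t s'"
inductive_cases EltAssignE: "exec G (EltAssign x i e) s t s'"
inductive_cases SeqE: "exec G (Seq c1 c2) s t s'"
inductive_cases IfE: "exec G (If b c1 c2) s t s'"
inductive_cases WhileE: "exec G (While b c) s t s'"

lemma exec_deterministic:
  "exec G c s t s' \<Longrightarrow> exec G c s u s'' \<Longrightarrow> u = t \<and> s'' = s'"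
proof (induction arbitrary: u s'' rule: exec.induct)
  case Skip
  then show ?case by (rule SkipE) simp
next
  case NumAssign
  then show ?case by (rule NumAssignE) simp
next
  case EltAssign
  then show ?case by (rule EltAssignE) simp
next
  case (Seq c1 s1 t1 s2 c2 t2 s3)
  from Seq.prems obtain u1 u2 r where "u = u1 + u2" "exec G c1 s1 u1 r" "exec G c2 r u2 s''"
    by (rule SeqE)
  with Seq.IH(1)[of u1 r] Seq.IH(2)[of u2 s''] show ?case by simp
next
  case (IfTrue s b c1 t s' c2)
  from IfTrue.prems show ?case
    by (rule IfE) (use IfTrue.hyps in \<open>simp_all add: IfTrue.IH\<close>)
next
  case (IfFalse s b c2 t s' c1)
  from IfFalse.prems show ?case
    by (rule IfE) (use IfFalse.hyps in \<open>simp_all add: IfFalse.IH\<close>)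
next
  case (WhileFalse s b c)
  from WhileFalse.prems show ?case by (rule WhileE) (use WhileFalse.hyps in simp_all)
next
  case (WhileTrue s1 b c t1 s2 t2 s3)
  from WhileTrue.prems obtain u1 u2 r where
    "u = bcost s1 b + u1 + u2 + 1" "exec G c s1 u1 r" "exec G (While b c) r u2 s''"
    by (rule WhileE) (use WhileTrue.hyps(1) in simp_all)
  with WhileTrue.IH(1)[of u1 r] WhileTrue.IH(2)[of u2 s''] show ?case by simp
qed

text \<open>Input convention: \<open>''s''\<close> contains the number of given generators and the array \<open>''g''\<close> the
  generators themselves; the rest of the memory is blank.
  Output convention: the element \<open>z\<close> is in \<open>''z''\<close>, and \<open>M\<close> consists of the first \<open>k\<close> entries of
  the array \<open>''M''\<close> of strings, where \<open>k\<close> is the content of the numerical variable \<open>''M''\<close>.\<close>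

definition initial_state :: "bitstring list \<Rightarrow> state" where
  "initial_state gs = \<lparr>
     num = (\<lambda>x i. if x = ''s'' \<and> i = 0 then length gs else 0),
     elt = (\<lambda>x i. if x = ''g'' \<and> i < length gs then gs ! i else [])\<rparr>"

definition output_z :: "state \<Rightarrow> bitstring" where
  "output_z s = elt s ''z'' 0"

definition output_M :: "state \<Rightarrow> bitstring set" where
  "output_M s = elt s ''M'' ` {..<num s ''M'' 0}"

end

theory Submission
  imports Defs "HOL-Real_Asymp.Real_Asymp"
begin

text \<open>Let \<open>n\<close> be a multiple of the exponent of \<open>G\<close>; the square of the product of multiples of the
  orders of the generators and of their commutators will do, and each of these is found by baby steps
  and giant steps. For a prime \<open>p\<close> let \<open>r\<close> be the largest divisor of \<open>n\<close> that is prime to \<open>p\<close>. A Sylow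
  \<open>p\<close>-subgroup of \<open>G\<close> is not normal iff, for some generators \<open>a\<close> and \<open>b\<close>, the element \<open>x = a^r\<close> does not
  commute with \<open>b x b^-1\<close>: if \<open>p\<close> does not divide the order of an abelian normal subgroup \<open>A\<close> with
  cyclic quotient, then \<open>x\<close> and \<open>b x b^-1\<close> differ by an element of
  \<open>A\<close>, so if they commute they are equal. Write \<open>n = k l\<close>, where \<open>l\<close> collects these primes \<open>p\<close>. The
  normal Sylow subgroups make up the largest possible \<open>A\<close>, which is the set of all \<open>x\<close> with \<open>x^k = 1\<close>.
  For each \<open>p\<close> dividing \<open>l\<close> choose the \<open>a^r\<close> of largest order; if \<open>w\<close> is their product, then
  \<open>z = w^k\<close> generates a complement of \<open>A\<close>. Finally, \<open>A\<close> is generated by the powers \<open>a^l\<close> and the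
  \<open>z\<close>-conjugates of the commutators. The number of conjugates of one commutator is at most
  \<open>min |A| |z|\<close>, hence at most \<open>|G|^(1/2)\<close>.\<close>

section \<open>Step counting and a calculus of total correctness\<close>

text \<open>Neither |G| nor any element order is known in advance, and a table of group elements can
  only be searched by comparing strings. The table of baby steps is therefore sorted, and its width
  doubles until a collision occurs. Doubling happens only while the squared width is below |G|, so
  the multiples found are at most 4|G| and can be factored by trial division up to about |G|^(1/2).
  The multiple \<open>n\<close> itself is far larger and is never factored. This is enough, because
  the test at p involves a nontrivial power a^r of p-power order, so that p divides the multiple
  found for the generator a. A largest A exists because k depends only on G, the generators and
  \<open>n\<close>: every admissible A' turns out to be killed by k and is then contained in the A
  that is computed. Since |A| times the index is |G|, the largest A has the smallest index, which is
  \<open>gamma\<close>. The time analysis separates the number of steps from the size of the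
  numbers: all numbers stay below 2^L with L polylogarithmic in |G|, so bit costs, sorting and the
  loops over the generators only contribute to the factor |G|^(o(1)).\<close>

primrec aweight :: "aexp \<Rightarrow> nat" where
  "aweight (Const n) = n + 1"
| "aweight (NumAt x a) = aweight a + 1"
| "aweight (Add a b) = aweight a + aweight b + 1"
| "aweight (Sub a b) = aweight a + aweight b + 1"
| "aweight (Mul a b) = aweight a + aweight b + 1"
| "aweight (Div a b) = aweight a + aweight b + 1"

primrec eweight :: "eexp \<Rightarrow> nat" where
  "eweight (EltAt x a) = aweight a ^ 2 + 1"
| "eweight (EMult e f) = eweight e + eweight f + 1"
| "eweight (EInv e) = eweight e + 1"

primrec bweight :: "bexp \<Rightarrow> nat" where
  "bweight (ALess a b) = aweight a ^ 2 + aweight b ^ 2 + 1"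
| "bweight (ELess e f) = eweight e + eweight f + 1"
| "bweight (BNot b) = bweight b + 1"
| "bweight (BAnd b c) = bweight b + bweight c + 1"

primrec cweight :: "com \<Rightarrow> nat" where
  "cweight Skip = 1"
| "cweight (NumAssign x i a) = aweight i ^ 2 + aweight a ^ 2 + 1"
| "cweight (EltAssign x i e) = aweight i ^ 2 + eweight e + 1"
| "cweight (Seq c d) = cweight c + cweight d"
| "cweight (If b c d) = bweight b + cweight c + cweight d + 1"
| "cweight (While b c) = bweight b + cweight c + 1"

section \<open>Logarithmic cost of expressions over a memory of bounded numbers\<close>

definition num_bounded :: "nat \<Rightarrow> state \<Rightarrow> bool" where
  "num_bounded L s \<longleftrightarrow> (\<forall>x i. num s x i < 2 ^ L)"

lemma bits_le: "n < 2 ^ k \<Longrightarrow> 1 \<le> k \<Longrightarrow> bits n \<le> k"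
  by (simp add: bits_def floorlog_leI)

lemma add_less_power2:
  assumes "(x::nat) < 2 ^ a" "y < 2 ^ b"
  shows "x + y < 2 ^ (a + b + 1)"
proof -
  have "x < 2 ^ (a + b)" "y < 2 ^ (a + b)"
    using assms by (auto intro: less_le_trans[OF _ power_increasing])
  then show ?thesis by simp
qed

lemma mult_less_power2:
  assumes "(x::nat) < 2 ^ a" "y < 2 ^ b"
  shows "x * y < 2 ^ (a + b)"
  by (metis assms mult_strict_mono' power_add zero_le)

text \<open>Each operation yields at most the sum of the bit lengths of its operands plus one bit,
  so the bit length of a value grows at most linearly with the number of nodes. A constant
  \<open>n\<close> is given weight \<open>n + 1\<close>, which is crude but independent of the
  state.\<close>

lemma aval_less:
  assumes "num_bounded L s" "1 \<le> L"
  shows "aval s a < 2 ^ (aweight a * L)"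
proof (induction a)
  case (Const n)
  have "n * 1 \<le> n * L" by (rule mult_le_mono2) fact
  then have "n \<le> aweight (Const n) * L" unfolding aweight.simps add_mult_distrib by linarith
  have "n < 2 ^ n" by (rule less_exp)
  also have "(2::nat) ^ n \<le> 2 ^ (aweight (Const n) * L)"
    by (rule power_increasing) (fact, simp)
  finally show ?case by simp
next
  case (NumAt x a)
  have "num s x (aval s a) < 2 ^ L" using assms by (simp add: num_bounded_def)
  also have "(2::nat) ^ L \<le> 2 ^ (aweight (NumAt x a) * L)" by (rule power_increasing) auto
  finally show ?case by simp
next
  case (Add a b)
  have "aval s a + aval s b < 2 ^ (aweight a * L + aweight b * L + 1)"
    by (rule add_less_power2) (fact Add)+
  also have "(2::nat) ^ (aweight a * L + aweight b * L + 1) \<le> 2 ^ (aweight (Add a b) * L)"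
    by (rule power_increasing) (use \<open>1 \<le> L\<close> in \<open>auto simp: algebra_simps\<close>)
  finally show ?case by simp
next
  case (Sub a b)
  have "aval s a - aval s b < 2 ^ (aweight a * L)" using Sub(1) by (simp add: less_imp_diff_less)
  also have "(2::nat) ^ (aweight a * L) \<le> 2 ^ (aweight (Sub a b) * L)"
    by (rule power_increasing) (auto simp: algebra_simps)
  finally show ?case by simp
next
  case (Mul a b)
  have "aval s a * aval s b < 2 ^ (aweight a * L + aweight b * L)"
    by (rule mult_less_power2) (fact Mul)+
  also have "(2::nat) ^ (aweight a * L + aweight b * L) \<le> 2 ^ (aweight (Mul a b) * L)"
    by (rule power_increasing) (auto simp: algebra_simps)
  finally show ?case by simp
next
  case (Div a b)
  have "aval s a div aval s b < 2 ^ (aweight a * L)"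
    using Div(1) by (meson div_le_dividend le_less_trans)
  also have "(2::nat) ^ (aweight a * L) \<le> 2 ^ (aweight (Div a b) * L)"
    by (rule power_increasing) (auto simp: algebra_simps)
  finally show ?case by simp
qed

text \<open>An expression has at most \<open>aweight a\<close> nodes, and by
  \<open>aval_less\<close> each of them costs at most \<open>aweight a * L\<close>; hence the
  square.\<close>

lemma acost_le:
  assumes "num_bounded L s" "1 \<le> L"
  shows "acost s a \<le> aweight a ^ 2 * L"
proof (induction a)
  case (Const n)
  have "bits n \<le> (n + 1) * L"
    using aval_less[OF assms, of "Const n"] assms by (intro bits_le) auto
  also have "\<dots> \<le> aweight (Const n) ^ 2 * L" by (simp add: power2_eq_square)
  finally show ?case by simp
next
  case (NumAt x a)
  have "bits (num s x (aval s a)) \<le> L" using assms by (intro bits_le) (auto simp: num_bounded_def)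
  with NumAt show ?case by (simp add: power2_eq_square algebra_simps)
next
  case (Add a b)
  have "bits (aval s (Add a b)) \<le> aweight (Add a b) * L"
    using aval_less[OF assms, of "Add a b"] assms by (intro bits_le) auto
  with Add show ?case by (simp add: power2_eq_square algebra_simps)
next
  case (Sub a b)
  have "bits (aval s (Sub a b)) \<le> aweight (Sub a b) * L"
    using aval_less[OF assms, of "Sub a b"] assms by (intro bits_le) auto
  with Sub show ?case by (simp add: power2_eq_square algebra_simps)
next
  case (Mul a b)
  have "bits (aval s (Mul a b)) \<le> aweight (Mul a b) * L"
    using aval_less[OF assms, of "Mul a b"] assms by (intro bits_le) auto
  with Mul show ?case by (simp add: power2_eq_square algebra_simps)
next
  case (Div a b)
  have "bits (aval s (Div a b)) \<le> aweight (Div a b) * L"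
    using aval_less[OF assms, of "Div a b"] assms by (intro bits_le) auto
  with Div show ?case by (simp add: power2_eq_square algebra_simps)
qed

lemma ecost_le:
  assumes "num_bounded L s" "1 \<le> L"
  shows "ecost s e \<le> eweight e * L"
proof (induction e)
  case (EltAt x a)
  then show ?case using acost_le[OF assms, of a] assms(2) by (simp add: algebra_simps)
qed (use assms(2) in \<open>auto simp: algebra_simps\<close>)

lemma bcost_le:
  assumes "num_bounded L s" "1 \<le> L"
  shows "bcost s b \<le> bweight b * L"
proof (induction b)
  case (ALess a b)
  then show ?case using acost_le[OF assms, of a] acost_le[OF assms, of b] assms(2)
    by (simp add: algebra_simps)
next
  case (ELess e f)
  then show ?case using ecost_le[OF assms, of e] ecost_le[OF assms, of f] assms(2)
    by (simp add: algebra_simps)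
qed (use assms(2) in \<open>auto simp: algebra_simps\<close>)

text \<open>\<open>run G L c s n s'\<close> counts only the executed commands and tests, but demands that every number
  written has less than \<open>L\<close> bits. This is what bounds the logarithmic cost of the steps.\<close>

inductive run :: "bitstring monoid \<Rightarrow> nat \<Rightarrow> com \<Rightarrow> state \<Rightarrow> nat \<Rightarrow> state \<Rightarrow> bool" for G L where
  Skip: "run G L Skip s 1 s"
| NumAssign: "aval s a < 2 ^ L \<Longrightarrow>
    run G L (NumAssign x i a) s 1 (num_upd x (aval s i) (aval s a) s)"
| EltAssign: "run G L (EltAssign x i e) s 1 (elt_upd x (aval s i) (eval_elt G s e) s)"
| Seq: "run G L c1 s1 n1 s2 \<Longrightarrow> run G L c2 s2 n2 s3 \<Longrightarrow> run G L (Seq c1 c2) s1 (n1 + n2) s3"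
| IfTrue: "bval G s b \<Longrightarrow> run G L c1 s n s' \<Longrightarrow> run G L (If b c1 c2) s (n + 1) s'"
| IfFalse: "\<not> bval G s b \<Longrightarrow> run G L c2 s n s' \<Longrightarrow> run G L (If b c1 c2) s (n + 1) s'"
| WhileFalse: "\<not> bval G s b \<Longrightarrow> run G L (While b c) s 1 s"
| WhileTrue: "bval G s1 b \<Longrightarrow> run G L c s1 n1 s2 \<Longrightarrow> run G L (While b c) s2 n2 s3 \<Longrightarrow>
    run G L (While b c) s1 (n1 + n2 + 1) s3"

inductive_cases run_SkipE: "run G L Skip s n s'"
inductive_cases run_NumAssignE: "run G L (NumAssign x i a) s n s'"
inductive_cases run_EltAssignE: "run G L (EltAssign x i e) s n s'"
inductive_cases run_SeqE: "run G L (Seq c1 c2) s n s'"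
inductive_cases run_IfE: "run G L (If b c1 c2) s n s'"

text \<open>Every counted step is a command or a test of the fixed program, and its evaluation costs
  at most \<open>cweight c * L\<close> as long as the memory holds numbers below
  \<open>2 ^ L\<close>. Runs preserve this bound on the memory, since \<open>run\<close> checks
  every number that is written.\<close>

lemma run_imp_exec:
  assumes "run G L c s n s'" "num_bounded L s" "1 \<le> L"
  shows "num_bounded L s' \<and> (\<exists>t. exec G c s t s' \<and> t \<le> n * (cweight c * L))"
  using assms
proof (induction rule: run.induct)
  case (Skip s)
  then show ?case by (auto intro!: exI[of _ 1] exec.Skip)
next
  case (NumAssign s a x i)
  have "acost s i + acost s a + 1 \<le> 1 * (cweight (NumAssign x i a) * L)"
    using acost_le[OF NumAssign(2,3), of i] acost_le[OF NumAssign(2,3), of a] NumAssign(3)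
    by (simp add: algebra_simps)
  moreover have "num_bounded L (num_upd x (aval s i) (aval s a) s)"
    using NumAssign by (auto simp: num_bounded_def num_upd_def)
  ultimately show ?case using exec.NumAssign by blast
next
  case (EltAssign x i e s)
  have "acost s i + ecost s e + 1 \<le> 1 * (cweight (EltAssign x i e) * L)"
    using acost_le[OF EltAssign, of i] ecost_le[OF EltAssign, of e] EltAssign(2)
    by (simp add: algebra_simps)
  moreover have "num_bounded L (elt_upd x (aval s i) (eval_elt G s e) s)"
    using EltAssign by (auto simp: num_bounded_def elt_upd_def)
  ultimately show ?case using exec.EltAssign by blast
next
  case (Seq c1 s1 n1 s2 c2 n2 s3)
  from Seq.IH(1)[OF Seq.prems] obtain t1 where
    1: "num_bounded L s2" "exec G c1 s1 t1 s2" "t1 \<le> n1 * (cweight c1 * L)" by blast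
  from Seq.IH(2)[OF 1(1) Seq.prems(2)] obtain t2 where
    2: "num_bounded L s3" "exec G c2 s2 t2 s3" "t2 \<le> n2 * (cweight c2 * L)" by blast
  have "t1 + t2 \<le> n1 * (cweight (Seq c1 c2) * L) + n2 * (cweight (Seq c1 c2) * L)"
    using 1(3) 2(3) by (intro add_mono) (auto simp: algebra_simps)
  then show ?case using exec.Seq[OF 1(2) 2(2)] 2(1) by (auto simp: algebra_simps)
next
  case (IfTrue s b c1 n s' c2)
  from IfTrue.IH[OF IfTrue.prems] obtain t where
    1: "num_bounded L s'" "exec G c1 s t s'" "t \<le> n * (cweight c1 * L)" by blast
  have "bcost s b + t + 1 \<le> (n + 1) * (cweight (If b c1 c2) * L)"
    using bcost_le[OF IfTrue.prems, of b] 1(3) IfTrue.prems(2) by (simp add: algebra_simps)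
  then show ?case using exec.IfTrue[OF IfTrue.hyps(1) 1(2)] 1(1) by blast
next
  case (IfFalse s b c2 n s' c1)
  from IfFalse.IH[OF IfFalse.prems] obtain t where
    1: "num_bounded L s'" "exec G c2 s t s'" "t \<le> n * (cweight c2 * L)" by blast
  have "bcost s b + t + 1 \<le> (n + 1) * (cweight (If b c1 c2) * L)"
    using bcost_le[OF IfFalse.prems, of b] 1(3) IfFalse.prems(2) by (simp add: algebra_simps)
  then show ?case using exec.IfFalse[OF IfFalse.hyps(1) 1(2)] 1(1) by blast
next
  case (WhileFalse s b c)
  have "bcost s b + 1 \<le> 1 * (cweight (While b c) * L)"
    using bcost_le[OF WhileFalse.prems, of b] WhileFalse.prems(2) by (simp add: algebra_simps)
  then show ?case using exec.WhileFalse[OF WhileFalse.hyps(1)] WhileFalse.prems by blast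
next
  case (WhileTrue s1 b c n1 s2 n2 s3)
  from WhileTrue.IH(1)[OF WhileTrue.prems] obtain t1 where
    1: "num_bounded L s2" "exec G c s1 t1 s2" "t1 \<le> n1 * (cweight c * L)" by blast
  from WhileTrue.IH(2)[OF 1(1) WhileTrue.prems(2)] obtain t2 where
    2: "num_bounded L s3" "exec G (While b c) s2 t2 s3" "t2 \<le> n2 * (cweight (While b c) * L)"
    by blast
  have "t1 \<le> n1 * (cweight (While b c) * L)" using 1(3)
    by (rule order_trans) (intro mult_le_mono2 mult_le_mono1, simp add: trans_le_add1)
  moreover have "bcost s1 b + 1 \<le> cweight (While b c) * L"
    using bcost_le[OF WhileTrue.prems, of b] WhileTrue.prems(2) by (simp add: algebra_simps)
  ultimately have "bcost s1 b + t1 + t2 + 1 \<le> (n1 + n2 + 1) * (cweight (While b c) * L)"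
    using 2(3) unfolding add_mult_distrib by linarith
  then show ?case using exec.WhileTrue[OF WhileTrue.hyps(1) 1(2) 2(2)] 2(1) by blast
qed

section \<open>Frame conditions from the variables that a command assigns\<close>

primrec num_mod :: "com \<Rightarrow> vname set" where
  "num_mod Skip = {}"
| "num_mod (NumAssign x i a) = {x}"
| "num_mod (EltAssign x i e) = {}"
| "num_mod (Seq c d) = num_mod c \<union> num_mod d"
| "num_mod (If b c d) = num_mod c \<union> num_mod d"
| "num_mod (While b c) = num_mod c"

primrec elt_mod :: "com \<Rightarrow> vname set" where
  "elt_mod Skip = {}"
| "elt_mod (NumAssign x i a) = {}"
| "elt_mod (EltAssign x i e) = {x}"
| "elt_mod (Seq c d) = elt_mod c \<union> elt_mod d"
| "elt_mod (If b c d) = elt_mod c \<union> elt_mod d"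
| "elt_mod (While b c) = elt_mod c"

definition frame :: "com \<Rightarrow> state \<Rightarrow> state \<Rightarrow> bool" where
  "frame c s s' \<longleftrightarrow> (\<forall>x. x \<notin> num_mod c \<longrightarrow> num s' x = num s x) \<and>
     (\<forall>x. x \<notin> elt_mod c \<longrightarrow> elt s' x = elt s x)"

lemma frame_refl [simp]: "frame c s s"
  by (simp add: frame_def)

lemma frame_trans: "frame c s s' \<Longrightarrow> frame c s' s'' \<Longrightarrow> frame c s s''"
  by (auto simp: frame_def)

lemma run_frame: "run G L c s n s' \<Longrightarrow> frame c s s'"
  by (induction rule: run.induct) (auto simp: frame_def num_upd_def elt_upd_def)

text \<open>The postcondition sees the number of steps together with the final state, so that
  correctness and running time are proved in one pass. Asking for some terminating run loses
  nothing, because execution is deterministic.\<close>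

definition wp :: "bitstring monoid \<Rightarrow> nat \<Rightarrow> com \<Rightarrow> state \<Rightarrow> (nat \<Rightarrow> state \<Rightarrow> bool) \<Rightarrow> bool" where
  "wp G L c s Q \<longleftrightarrow> (\<exists>n s'. run G L c s n s' \<and> Q n s')"

lemma wp_Skip: "wp G L Skip s Q \<longleftrightarrow> Q 1 s"
proof
  assume "wp G L Skip s Q"
  then show "Q 1 s" unfolding wp_def by (elim exE conjE run_SkipE) simp
qed (use run.Skip wp_def in blast)

lemma wp_NumAssign:
  "wp G L (NumAssign x i a) s Q \<longleftrightarrow> aval s a < 2 ^ L \<and> Q 1 (num_upd x (aval s i) (aval s a) s)"
proof
  assume "wp G L (NumAssign x i a) s Q"
  then show "aval s a < 2 ^ L \<and> Q 1 (num_upd x (aval s i) (aval s a) s)"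
    unfolding wp_def by (elim exE conjE run_NumAssignE) simp
qed (use run.NumAssign wp_def in blast)

lemma wp_EltAssign:
  "wp G L (EltAssign x i e) s Q \<longleftrightarrow> Q 1 (elt_upd x (aval s i) (eval_elt G s e) s)"
proof
  assume "wp G L (EltAssign x i e) s Q"
  then show "Q 1 (elt_upd x (aval s i) (eval_elt G s e) s)"
    unfolding wp_def by (elim exE conjE run_EltAssignE) simp
qed (use run.EltAssign wp_def in blast)

lemma wp_Seq:
  "wp G L (Seq c d) s Q \<longleftrightarrow> wp G L c s (\<lambda>n s'. wp G L d s' (\<lambda>n'. Q (n + n')))"
proof
  assume "wp G L (Seq c d) s Q"
  then show "wp G L c s (\<lambda>n s'. wp G L d s' (\<lambda>n'. Q (n + n')))"
    unfolding wp_def by (elim exE conjE run_SeqE) blast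
next
  assume "wp G L c s (\<lambda>n s'. wp G L d s' (\<lambda>n'. Q (n + n')))"
  then show "wp G L (Seq c d) s Q"
    unfolding wp_def by (elim exE conjE) (blast intro: run.Seq)
qed

lemma wp_If:
  "wp G L (If b c d) s Q \<longleftrightarrow>
     (if bval G s b then wp G L c s (\<lambda>n. Q (n + 1)) else wp G L d s (\<lambda>n. Q (n + 1)))"
proof
  assume "wp G L (If b c d) s Q"
  then show "if bval G s b then wp G L c s (\<lambda>n. Q (n + 1)) else wp G L d s (\<lambda>n. Q (n + 1))"
    unfolding wp_def by (elim exE conjE run_IfE) auto
next
  assume "if bval G s b then wp G L c s (\<lambda>n. Q (n + 1)) else wp G L d s (\<lambda>n. Q (n + 1))"
  then show "wp G L (If b c d) s Q"
    unfolding wp_def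
    by (cases "bval G s b") (use run.IfTrue run.IfFalse in \<open>simp_all only: if_True if_False, blast+\<close>)
qed

lemma wp_mono:
  assumes "wp G L c s R" "\<And>n s'. R n s' \<Longrightarrow> frame c s s' \<Longrightarrow> Q n s'"
  shows "wp G L c s Q"
  using assms run_frame unfolding wp_def by blast

text \<open>The measure \<open>f\<close> starts at no more than \<open>F\<close> and drops in each
  round, which costs at most \<open>k\<close> steps and one test; the last test adds 1. The frame
  condition is handed to the body and to the postcondition, so an invariant only has to speak of
  variables that the loop changes.\<close>

lemma wp_While:
  assumes "I s" "f s \<le> F"
    and body: "\<And>s'. I s' \<Longrightarrow> frame c s s' \<Longrightarrow> bval G s' b \<Longrightarrow>
      wp G L c s' (\<lambda>n s''. n \<le> k \<and> I s'' \<and> f s'' < (f s' :: nat))"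
    and post: "\<And>n s'. I s' \<Longrightarrow> frame c s s' \<Longrightarrow> \<not> bval G s' b \<Longrightarrow> n \<le> F * (k + 1) + 1 \<Longrightarrow> Q n s'"
  shows "wp G L (While b c) s Q"
proof -
  have "\<exists>n s''. run G L (While b c) s' n s'' \<and> n \<le> f s' * (k + 1) + 1 \<and> I s'' \<and>
      frame c s s'' \<and> \<not> bval G s'' b" if "I s'" "frame c s s'" for s'
    using that
  proof (induction "f s'" arbitrary: s' rule: less_induct)
    case less
    show ?case
    proof (cases "bval G s' b")
      case True
      from body[OF less.prems True] obtain n1 s1 where
        1: "run G L c s' n1 s1" "n1 \<le> k" "I s1" "f s1 < f s'" unfolding wp_def by blast
      have "frame c s s1" using frame_trans[OF less.prems(2) run_frame[OF 1(1)]] .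
      from less.hyps[OF 1(4,3) this] obtain n2 s2 where
        2: "run G L (While b c) s1 n2 s2" "n2 \<le> f s1 * (k + 1) + 1" "I s2" "frame c s s2"
          "\<not> bval G s2 b" by blast
      have "n1 + n2 + 1 \<le> (f s1 + 1) * (k + 1) + 1" using 1(2) 2(2) by simp
      also have "\<dots> \<le> f s' * (k + 1) + 1"
        using 1(4) by (intro add_mono mult_mono) auto
      finally show ?thesis using run.WhileTrue[OF True 1(1) 2(1)] 2 by blast
    next
      case False
      then show ?thesis using run.WhileFalse[OF False, of L c] less.prems by fastforce
    qed
  qed
  from this[OF assms(1)] obtain n s' where *: "run G L (While b c) s n s'"
    "n \<le> f s * (k + 1) + 1" "I s'" "frame c s s'" "\<not> bval G s' b" by auto
  have "f s * (k + 1) \<le> F * (k + 1)" using assms(2) by (rule mult_right_mono) simp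
  then have "n \<le> F * (k + 1) + 1" using *(2) by linarith
  then show ?thesis using * post unfolding wp_def by blast
qed

lemma num_num_upd [simp]:
  "num (num_upd x i n s) y = (if y = x then (num s x)(i := n) else num s y)"
  by (simp add: num_upd_def)

lemma elt_num_upd [simp]: "elt (num_upd x i n s) = elt s"
  by (simp add: num_upd_def)

lemma elt_elt_upd [simp]:
  "elt (elt_upd x i w s) y = (if y = x then (elt s x)(i := w) else elt s y)"
  by (simp add: elt_upd_def)

lemma num_elt_upd [simp]: "num (elt_upd x i w s) = num s"
  by (simp add: elt_upd_def)

lemma lexordp_trichotomy:
  fixes x y :: "'a :: linorder list"
  shows "\<not> ord_class.lexordp x y \<Longrightarrow> \<not> ord_class.lexordp y x \<Longrightarrow> x = y"
  using lexordp_linear by blast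

section \<open>Concrete syntax and derived tests\<close>

abbreviation Num :: "vname \<Rightarrow> aexp" where "Num x \<equiv> NumAt x (Const 0)"
abbreviation Elt :: "vname \<Rightarrow> eexp" where "Elt x \<equiv> EltAt x (Const 0)"
abbreviation num_assign (infix "::=" 64) where "x ::= a \<equiv> NumAssign x (Const 0) a"
abbreviation elt_assign (infix "::~" 64) where "x ::~ e \<equiv> EltAssign x (Const 0) e"
abbreviation seq_com (infixr ";;" 60) where "c ;; d \<equiv> Seq c d"

definition EEq :: "eexp \<Rightarrow> eexp \<Rightarrow> bexp" where
  "EEq e f = BAnd (BNot (ELess e f)) (BNot (ELess f e))"

text \<open>Rounding down never makes \<open>(b div a) * a\<close> exceed \<open>b\<close>, so not
  being smaller means equality. For \<open>a = 0\<close> the test reads \<open>b = 0\<close>, in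
  agreement with \<open>dvd\<close>.\<close>

definition ADvd :: "aexp \<Rightarrow> aexp \<Rightarrow> bexp" where
  "ADvd a b = BNot (ALess (Mul (Div b a) a) b)"

lemma bval_EEq [simp]: "bval G s (EEq e f) \<longleftrightarrow> eval_elt G s e = eval_elt G s f"
  by (auto simp: EEq_def lexordp_irreflexive' dest: lexordp_trichotomy)

lemma bval_ADvd [simp]: "bval G s (ADvd a b) \<longleftrightarrow> aval s a dvd aval s b"
proof -
  have "aval s b div aval s a * aval s a \<le> aval s b" by simp
  then have "bval G s (ADvd a b) \<longleftrightarrow> aval s b div aval s a * aval s a = aval s b"
    unfolding ADvd_def bval.simps aval.simps by linarith
  also have "\<dots> \<longleftrightarrow> aval s a dvd aval s b"
    by (metis dvd_div_mult_self dvd_triv_right)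
  finally show ?thesis .
qed

text \<open>Rewriting with these rules computes the precondition of loop-free code. Variable names
  are literal strings, whose equality is decided by the list and character rules.\<close>

lemmas wp_simps = wp_Skip wp_Seq wp_If wp_NumAssign wp_EltAssign aval.simps eval_elt.simps
  bval.simps bval_EEq bval_ADvd elt_elt_upd elt_num_upd num_num_upd num_elt_upd
  fun_upd_apply if_True if_False list.inject list.distinct char.inject simp_thms

abbreviation lex_le :: "bitstring \<Rightarrow> bitstring \<Rightarrow> bool" where
  "lex_le x y \<equiv> \<not> ord_class.lexordp y x"

lemma lex_le_trans: "lex_le x y \<Longrightarrow> lex_le y z \<Longrightarrow> lex_le x z"
  by (metis lexordp_trans lexordp_trichotomy)

lemma lex_le_linear: "\<not> lex_le x y \<Longrightarrow> lex_le y x"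
  using lexordp_antisym by blast

section \<open>Powers and sorting\<close>

text \<open>Square and multiply. No string for the identity is supplied, so it is produced from the
  first generator and its inverse.\<close>

definition pow_com :: com where
  "pow_com =
     ''pr'' ::~ EMult (Elt ''g'') (EInv (Elt ''g'')) ;;
     While (ALess (Const 0) (Num ''pe''))
       (If (ADvd (Const 2) (Num ''pe'')) Skip (''pr'' ::~ EMult (Elt ''pr'') (Elt ''pb'')) ;;
        ''pb'' ::~ EMult (Elt ''pb'') (Elt ''pb'') ;;
        ''pe'' ::= Div (Num ''pe'') (Const 2))"

lemma div2_less_power: "(e::nat) < 2 ^ L \<Longrightarrow> e div 2 < 2 ^ L"
  by (meson div_le_dividend le_less_trans)

text \<open>The product of \<open>pr\<close> with the \<open>pe\<close>-th power of
  \<open>pb\<close> stays constant, while the bit length of \<open>pe\<close> drops in every round;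
  this bounds the number of rounds by \<open>L\<close>.\<close>

lemma wp_pow:
  assumes "group G" "elt s ''g'' 0 \<in> carrier G" "elt s ''pb'' 0 \<in> carrier G"
    "num s ''pe'' 0 < 2 ^ L"
    and Q: "\<And>n s'. n \<le> 5 * L + 2 \<Longrightarrow>
      elt s' ''pr'' 0 = elt s ''pb'' 0 [^]\<^bsub>G\<^esub> num s ''pe'' 0 \<Longrightarrow>
      \<forall>x. x \<notin> {''pe''} \<longrightarrow> num s' x = num s x \<Longrightarrow>
      \<forall>x. x \<notin> {''pr'', ''pb''} \<longrightarrow> elt s' x = elt s x \<Longrightarrow> Q n s'"
  shows "wp G L pow_com s Q"
proof -
  interpret group G by fact
  let ?b = "elt s ''pb'' 0" and ?e = "num s ''pe'' 0"
  show ?thesis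
    unfolding pow_com_def
    apply (simp only: wp_simps)
    apply (rule wp_While[where F = L and k = 4 and f = "\<lambda>s'. floorlog 2 (num s' ''pe'' 0)" and
      I = "\<lambda>s'. elt s' ''pr'' 0 \<in> carrier G \<and> elt s' ''pb'' 0 \<in> carrier G \<and> num s' ''pe'' 0 < 2 ^ L \<and>
        elt s' ''pr'' 0 \<otimes>\<^bsub>G\<^esub> elt s' ''pb'' 0 [^]\<^bsub>G\<^esub> num s' ''pe'' 0 = ?b [^]\<^bsub>G\<^esub> ?e"])
    subgoal using assms by simp
    subgoal using assms by (simp add: floorlog_leI)
    subgoal premises p for s'
    proof -
      let ?n = "num s' ''pe'' 0" and ?c = "elt s' ''pb'' 0" and ?r = "elt s' ''pr'' 0"
      have l: "floorlog 2 (?n div 2) < floorlog 2 ?n"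
        using p(3) compute_floorlog[of 2 ?n] by simp
      have sq: "(?c \<otimes>\<^bsub>G\<^esub> ?c) [^]\<^bsub>G\<^esub> (?n div 2) = ?c [^]\<^bsub>G\<^esub> (2 * (?n div 2))"
        using p(1) nat_pow_pow[of ?c 2 "?n div 2"] by (simp add: numeral_2_eq_2)
      show ?thesis
      proof (cases "even ?n")
        case True
        then show ?thesis using p l sq by (simp add: wp_simps div2_less_power)
      next
        case False
        then have "?n = Suc (2 * (?n div 2))" by presburger
        then have "?c \<otimes>\<^bsub>G\<^esub> ?c [^]\<^bsub>G\<^esub> (2 * (?n div 2)) = ?c [^]\<^bsub>G\<^esub> ?n"
          using p(1) nat_pow_Suc2[of ?c "2 * (?n div 2)"] by metis
        then have "?r \<otimes>\<^bsub>G\<^esub> ?c \<otimes>\<^bsub>G\<^esub> (?c \<otimes>\<^bsub>G\<^esub> ?c) [^]\<^bsub>G\<^esub> (?n div 2) = ?b [^]\<^bsub>G\<^esub> ?e"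
          unfolding sq using p(1) m_assoc[of ?r ?c "?c [^]\<^bsub>G\<^esub> (2 * (?n div 2))"] by simp
        moreover have "?n div 2 < 2 ^ L" using p(1) by (simp add: div2_less_power)
        moreover have "?r \<in> carrier G" "?c \<in> carrier G" using p(1) by blast+
        ultimately show ?thesis using False l
          by (simp add: wp_simps)
      qed
    qed
    subgoal premises p for n s'
      apply (rule Q)
      subgoal using p by simp
      subgoal using p(1,3) by (elim conjE) simp
      subgoal using p(2) by (simp add: frame_def)
      subgoal using p(2) by (simp add: frame_def)
      done
    done
qed

section \<open>Bottom-up merge sort\<close>

definition block_sorted :: "nat \<Rightarrow> (nat \<Rightarrow> bitstring) \<Rightarrow> nat \<Rightarrow> bool" where
  "block_sorted w f n \<longleftrightarrow> (\<forall>i j. i < j \<longrightarrow> j < n \<longrightarrow> i div w = j div w \<longrightarrow> lex_le (f i) (f j))"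

text \<open>A single loop merges all pairs of adjacent blocks: as soon as the output position
  \<open>o\<close> reaches the end \<open>e\<close> of the current pair, the pointers move on to the
  next pair. One pass thus takes exactly \<open>n\<close> rounds.\<close>

definition merge_com :: com where
  "merge_com =
     ''o'' ::= Const 0 ;; ''i'' ::= Const 0 ;; ''m'' ::= Num ''w'' ;; ''j'' ::= Num ''w'' ;;
     ''e'' ::= Add (Num ''w'') (Num ''w'') ;;
     While (ALess (Num ''o'') (Num ''n''))
       (If (BAnd (ALess (Num ''i'') (Num ''m''))
              (BNot (BAnd (ALess (Num ''j'') (Num ''e''))
                 (ELess (EltAt ''b'' (Num ''j'')) (EltAt ''b'' (Num ''i''))))))
          (EltAssign ''c'' (Num ''o'') (EltAt ''b'' (Num ''i'')) ;; ''i'' ::= Add (Num ''i'') (Const 1))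
          (EltAssign ''c'' (Num ''o'') (EltAt ''b'' (Num ''j'')) ;; ''j'' ::= Add (Num ''j'') (Const 1)) ;;
        ''o'' ::= Add (Num ''o'') (Const 1) ;;
        If (ALess (Num ''o'') (Num ''e'')) Skip
          (''i'' ::= Num ''e'' ;; ''m'' ::= Add (Num ''e'') (Num ''w'') ;; ''j'' ::= Num ''m'' ;;
           ''e'' ::= Add (Num ''m'') (Num ''w'')))"

text \<open>Invariant of the merge loop: within the current block \<open>[l, l + 2 w)\<close> the entries \<open>[l, i)\<close> and
  \<open>[l + w, j)\<close> of \<open>f\<close> have been merged into the entries \<open>[l, p)\<close> of \<open>g\<close>.\<close>

definition merge_inv ::
  "nat \<Rightarrow> (nat \<Rightarrow> bitstring) \<Rightarrow> (nat \<Rightarrow> bitstring) \<Rightarrow> nat \<Rightarrow> nat \<Rightarrow> nat \<Rightarrow> nat \<Rightarrow> bool" where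
  "merge_inv w f g l p i j \<longleftrightarrow> (2 * w) dvd l \<and> l \<le> p \<and> p < l + 2 * w \<and> l \<le> i \<and> i \<le> l + w \<and>
     l + w \<le> j \<and> j \<le> l + 2 * w \<and> i + j = p + l + w \<and>
     g ` {..<p} = f ` ({..<i} \<union> {l + w..<j}) \<and> block_sorted (2 * w) g p \<and>
     (\<forall>k\<in>{l..<p}. (i < l + w \<longrightarrow> lex_le (g k) (f i)) \<and> (j < l + 2 * w \<longrightarrow> lex_le (g k) (f j)))"

lemma block_div_eq:
  assumes "(k::nat) dvd l" "0 < k" "l \<le> j" "j < l + k"
  shows "i div k = j div k \<longleftrightarrow> l \<le> i \<and> i < l + k"
proof -
  obtain q where q: "l = k * q" using assms(1) by blast
  have j: "j div k = q" using assms by (auto simp: q div_nat_eqI mult.commute)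
  show ?thesis
  proof
    assume "i div k = j div k"
    then have "i div k = q" using j by simp
    then show "l \<le> i \<and> i < l + k" using assms(2) dividend_less_times_div[of k i]
      by (auto simp: q algebra_simps)
  next
    assume "l \<le> i \<and> i < l + k"
    then have "i div k = q" using assms by (auto simp: q div_nat_eqI mult.commute)
    then show "i div k = j div k" using j by simp
  qed
qed

lemma block_sorted_extend:
  assumes "block_sorted k g p" "k dvd l" "0 < k" "l \<le> p" "p < l + k"
    "\<And>i. i \<in> {l..<p} \<Longrightarrow> lex_le (g i) x"
  shows "block_sorted k (g(p := x)) (Suc p)"
  unfolding block_sorted_def
proof (intro allI impI)
  fix i j assume h: "i < j" "j < Suc p" "i div k = j div k"
  show "lex_le ((g(p := x)) i) ((g(p := x)) j)"
  proof (cases "j = p")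
    case True
    then have "i \<in> {l..<p}" using h block_div_eq[OF assms(2-5), of i] by simp
    then show ?thesis using assms(6) True by simp
  next
    case False
    then show ?thesis using h assms(1) by (simp add: block_sorted_def)
  qed
qed

lemma block_sortedD:
  assumes "block_sorted w f n" "w dvd l" "l \<le> i" "i \<le> j" "j < l + w" "j < n" "0 < w"
  shows "lex_le (f i) (f j)"
proof (cases "i = j")
  case False
  then have "i div w = j div w" using block_div_eq[of w l j i] assms by simp
  then show ?thesis using assms False by (simp add: block_sorted_def)
qed (simp add: lexordp_irreflexive')

text \<open>After one more entry has been output, either the current pair of blocks is unfinished,
  or both halves are used up. In the latter case the entries read are precisely those below the new
  position, and the invariant restarts at the next pair with nothing merged there.\<close>

lemma merge_step_aux:
  assumes "(2 * w) dvd l" "l \<le> p" "p < l + 2 * w" "l \<le> i" "i \<le> l + w"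
    "l + w \<le> j" "j \<le> l + 2 * w" "i + j = Suc p + l + w"
    "g ` {..<Suc p} = f ` ({..<i} \<union> {l + w..<j})" "block_sorted (2 * w) g (Suc p)"
    "\<forall>k\<in>{l..<Suc p}. (i < l + w \<longrightarrow> lex_le (g k) (f i)) \<and> (j < l + 2 * w \<longrightarrow> lex_le (g k) (f j))"
  shows "(Suc p < l + 2 * w \<longrightarrow> merge_inv w f g l (Suc p) i j) \<and>
    (\<not> Suc p < l + 2 * w \<longrightarrow> merge_inv w f g (l + 2 * w) (Suc p) (l + 2 * w) (l + 3 * w))"
proof (intro conjI impI)
  assume "Suc p < l + 2 * w"
  then show "merge_inv w f g l (Suc p) i j" using assms by (simp add: merge_inv_def)
next
  assume "\<not> Suc p < l + 2 * w"
  then have p: "Suc p = l + 2 * w" using assms by simp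
  then have "i = l + w" "j = l + 2 * w" "0 < w" using assms by auto
  then have "{..<i} \<union> {l + w..<j} = {..<Suc p}" using p by auto
  then have "g ` {..<Suc p} = f ` {..<Suc p}" using assms(9) by simp
  moreover have "{..<l + 2 * w} \<union> {l + 2 * w + w..<l + 3 * w} = {..<l + 2 * w}" by auto
  ultimately show "merge_inv w f g (l + 2 * w) (Suc p) (l + 2 * w) (l + 3 * w)"
    using assms(1,10) \<open>0 < w\<close> unfolding merge_inv_def p by simp
qed

text \<open>Everything merged so far in the current pair lies below both heads \<open>f i\<close>
  and \<open>f j\<close>. The smaller head may therefore be appended, and it stays below the next
  heads because each half is sorted. The three claims are: the left head wins, the right half is
  exhausted, the right head is taken.\<close>

lemma merge_stepI:
  assumes inv: "merge_inv w f g l p i j" and sorted: "block_sorted w f n" and n: "l + 2 * w \<le> n"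
    and w: "0 < w"
  shows "i < l + w \<Longrightarrow> j < l + 2 * w \<Longrightarrow> lex_le (f i) (f j) \<Longrightarrow>
      g' = g(p := f i) \<Longrightarrow> (Suc p < l + 2 * w \<longrightarrow> merge_inv w f g' l (Suc p) (Suc i) j) \<and>
      (\<not> Suc p < l + 2 * w \<longrightarrow> merge_inv w f g' (l + 2 * w) (Suc p) (l + 2 * w) (l + 3 * w))" (is "PROP ?A")
    and "i < l + w \<Longrightarrow> \<not> j < l + 2 * w \<Longrightarrow>
      g' = g(p := f i) \<Longrightarrow> (Suc p < l + 2 * w \<longrightarrow> merge_inv w f g' l (Suc p) (Suc i) j) \<and>
      (\<not> Suc p < l + 2 * w \<longrightarrow> merge_inv w f g' (l + 2 * w) (Suc p) (l + 2 * w) (l + 3 * w))" (is "PROP ?B")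
    and "i < l + w \<longrightarrow> j < l + 2 * w \<and> \<not> lex_le (f i) (f j) \<Longrightarrow>
      g' = g(p := f j) \<Longrightarrow> (Suc p < l + 2 * w \<longrightarrow> merge_inv w f g' l (Suc p) i (Suc j)) \<and>
      (\<not> Suc p < l + 2 * w \<longrightarrow> merge_inv w f g' (l + 2 * w) (Suc p) (l + 2 * w) (l + 3 * w))" (is "PROP ?C")
proof -
  have I: "(2 * w) dvd l" "l \<le> p" "p < l + 2 * w" "l \<le> i" "i \<le> l + w" "l + w \<le> j" "j \<le> l + 2 * w"
    "i + j = p + l + w" "g ` {..<p} = f ` ({..<i} \<union> {l + w..<j})" "block_sorted (2 * w) g p"
    and le: "\<And>k. k \<in> {l..<p} \<Longrightarrow> i < l + w \<Longrightarrow> lex_le (g k) (f i)"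
      "\<And>k. k \<in> {l..<p} \<Longrightarrow> j < l + 2 * w \<Longrightarrow> lex_le (g k) (f j)"
    using inv by (auto simp: merge_inv_def)
  have wl: "w dvd l" "w dvd l + w" using I(1) by (auto intro: dvd_mult_right)
  have sl: "Suc i < l + w \<Longrightarrow> lex_le (f i) (f (Suc i))"
    by (rule block_sortedD[OF sorted wl(1)]) (use I n w in auto)
  have sr: "Suc j < l + 2 * w \<Longrightarrow> lex_le (f j) (f (Suc j))"
    by (rule block_sortedD[OF sorted wl(2)]) (use I n w in auto)
  have img: "(g(p := x)) ` {..<Suc p} = insert x (g ` {..<p})" for x
    by (auto simp: lessThan_Suc image_iff)
  have 1: "(Suc p < l + 2 * w \<longrightarrow> merge_inv w f g' l (Suc p) (Suc i) j) \<and>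
      (\<not> Suc p < l + 2 * w \<longrightarrow> merge_inv w f g' (l + 2 * w) (Suc p) (l + 2 * w) (l + 3 * w))"
    if h: "i < l + w" "j < l + 2 * w \<longrightarrow> lex_le (f i) (f j)" "g' = g(p := f i)"
  proof (rule merge_step_aux)
    have "insert (f i) (f ` ({..<i} \<union> {l + w..<j})) = f ` ({..<Suc i} \<union> {l + w..<j})"
      by (auto simp: lessThan_Suc)
    then show "g' ` {..<Suc p} = f ` ({..<Suc i} \<union> {l + w..<j})"
      unfolding h(3) img I(9) .
    show "block_sorted (2 * w) g' (Suc p)" unfolding h(3)
      using w I(2,3) by (intro block_sorted_extend[OF I(10,1)] le(1) h(1)) simp_all
    show "\<forall>k\<in>{l..<Suc p}. (Suc i < l + w \<longrightarrow> lex_le (g' k) (f (Suc i))) \<and>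
        (j < l + 2 * w \<longrightarrow> lex_le (g' k) (f j))"
    proof
      fix k assume "k \<in> {l..<Suc p}"
      then have "lex_le (g' k) (f i)" using le(1)[of k] h
        by (cases "k = p") (auto simp: lexordp_irreflexive')
      then show "(Suc i < l + w \<longrightarrow> lex_le (g' k) (f (Suc i))) \<and>
        (j < l + 2 * w \<longrightarrow> lex_le (g' k) (f j))"
        using sl h(2) lex_le_trans by blast
    qed
  qed (use I h in auto)
  show "PROP ?A" using 1 by blast
  show "PROP ?B" using 1 by blast
  show "PROP ?C"
  proof (rule merge_step_aux)
    assume h: "i < l + w \<longrightarrow> j < l + 2 * w \<and> \<not> lex_le (f i) (f j)" "g' = g(p := f j)"
    have j: "j < l + 2 * w" using h(1) I by (cases "i < l + w") auto
    have ji: "i < l + w \<longrightarrow> lex_le (f j) (f i)" using h(1) lex_le_linear by blast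
    have "insert (f j) (f ` ({..<i} \<union> {l + w..<j})) = f ` ({..<i} \<union> {l + w..<Suc j})"
      using I(6) by (auto simp: atLeastLessThanSuc)
    then show "g' ` {..<Suc p} = f ` ({..<i} \<union> {l + w..<Suc j})"
      unfolding h(2) img I(9) .
    show "block_sorted (2 * w) g' (Suc p)" unfolding h(2)
      using w I(2,3) by (intro block_sorted_extend[OF I(10,1)] le(2) j) simp_all
    show "\<forall>k\<in>{l..<Suc p}. (i < l + w \<longrightarrow> lex_le (g' k) (f i)) \<and>
        (Suc j < l + 2 * w \<longrightarrow> lex_le (g' k) (f (Suc j)))"
    proof
      fix k assume "k \<in> {l..<Suc p}"
      then have "lex_le (g' k) (f j)" using le(2)[of k] h j
        by (cases "k = p") (auto simp: lexordp_irreflexive')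
      then show "(i < l + w \<longrightarrow> lex_le (g' k) (f i)) \<and>
        (Suc j < l + 2 * w \<longrightarrow> lex_le (g' k) (f (Suc j)))"
        using sr ji lex_le_trans by blast
    qed
    show "Suc j \<le> l + 2 * w" using j by simp
  qed (use I in auto)
qed

text \<open>The array length is a multiple of the width of a pair, so a pair that begins inside the
  array also ends inside it.\<close>

lemma dvd_less_add_le: "(d::nat) dvd l \<Longrightarrow> d dvd n \<Longrightarrow> l < n \<Longrightarrow> l + d \<le> n"
  by (metis dvd_add_right_iff dvd_imp_le le_add_diff_inverse less_imp_le_nat
      nat_add_left_cancel_le zero_less_diff)

lemma wp_merge:
  assumes pre: "num s ''w'' 0 = w" "num s ''n'' 0 = n" "0 < w" "(2 * w) dvd n" "0 < n" "4 * n < 2 ^ L"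
    "block_sorted w (elt s ''b'') n"
    and Q: "\<And>k s'. k \<le> 10 * n + 6 \<Longrightarrow> elt s' ''c'' ` {..<n} = elt s ''b'' ` {..<n} \<Longrightarrow>
      block_sorted (2 * w) (elt s' ''c'') n \<Longrightarrow>
      \<forall>x. x \<notin> {''o'', ''i'', ''m'', ''j'', ''e''} \<longrightarrow> num s' x = num s x \<Longrightarrow>
      \<forall>x. x \<notin> {''c''} \<longrightarrow> elt s' x = elt s x \<Longrightarrow> Q k s'"
  shows "wp G L merge_com s Q"
proof -
  let ?f = "elt s ''b''"
  have wn: "2 * w \<le> n" using pre by (simp add: dvd_imp_le)
  show ?thesis
    unfolding merge_com_def
    apply (simp only: wp_simps)
    apply (intro conjI)
    subgoal by simp
    subgoal using pre wn by simp
    subgoal using pre wn by simp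
    subgoal
    proof (rule wp_While[where F = n and k = 9 and f = "\<lambda>s'. n - num s' ''o'' 0" and
      I = "\<lambda>s'. \<exists>l. num s' ''m'' 0 = l + w \<and> num s' ''e'' 0 = l + 2 * w \<and> l \<le> n \<and>
        num s' ''o'' 0 \<le> n \<and>
        merge_inv w ?f (elt s' ''c'') l (num s' ''o'' 0) (num s' ''i'' 0) (num s' ''j'' 0)"],
      goal_cases)
      case 1
      then show ?case using pre
        by (intro exI[of _ 0]) (simp add: merge_inv_def block_sorted_def)
    next
      case 2
      then show ?case by simp
    next
      case (3 s')
      then obtain l where l: "num s' ''m'' 0 = l + w" "num s' ''e'' 0 = l + 2 * w" "l \<le> n"
        "num s' ''o'' 0 \<le> n"
        and inv: "merge_inv w ?f (elt s' ''c'') l (num s' ''o'' 0) (num s' ''i'' 0) (num s' ''j'' 0)"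
        by blast
      have fr: "num s' ''w'' 0 = w" "num s' ''n'' 0 = n" "elt s' ''b'' = ?f"
        using 3(2) pre by (auto simp: frame_def)
      have o: "num s' ''o'' 0 < n" using 3(3) fr by simp
      have "(2 * w) dvd l" "l \<le> num s' ''o'' 0" using inv by (auto simp: merge_inv_def)
      then have ln: "l + 2 * w \<le> n" using dvd_less_add_le[of "2 * w" l n] o pre(4) by simp
      have ij: "num s' ''i'' 0 \<le> n" "num s' ''j'' 0 \<le> n"
        using inv ln by (auto simp: merge_inv_def)
      note step = merge_stepI[OF inv pre(7) ln pre(3)]
      show ?case
      proof (cases "num s' ''i'' 0 < l + w \<and>
          \<not> (num s' ''j'' 0 < l + 2 * w \<and> \<not> lex_le (?f (num s' ''i'' 0)) (?f (num s' ''j'' 0)))")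
        case True
        have "(Suc (num s' ''o'' 0) < l + 2 * w \<longrightarrow> merge_inv w ?f ((elt s' ''c'')(num s' ''o'' 0 := ?f (num s' ''i'' 0))) l (Suc (num s' ''o'' 0)) (Suc (num s' ''i'' 0)) (num s' ''j'' 0)) \<and>
          (\<not> Suc (num s' ''o'' 0) < l + 2 * w \<longrightarrow> merge_inv w ?f ((elt s' ''c'')(num s' ''o'' 0 := ?f (num s' ''i'' 0))) (l + 2 * w) (Suc (num s' ''o'' 0)) (l + 2 * w) (l + 3 * w))"
          using True step(1,2) by blast
        then show ?thesis using True l fr o ln ij pre(6) wn
          by (cases "Suc (num s' ''o'' 0) < l + 2 * w")
            (auto simp: wp_simps algebra_simps intro: exI[of _ l] exI[of _ "l + 2 * w"])
      next
        case False
        then have "(Suc (num s' ''o'' 0) < l + 2 * w \<longrightarrow> merge_inv w ?f ((elt s' ''c'')(num s' ''o'' 0 := ?f (num s' ''j'' 0))) l (Suc (num s' ''o'' 0)) (num s' ''i'' 0) (Suc (num s' ''j'' 0))) \<and>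
          (\<not> Suc (num s' ''o'' 0) < l + 2 * w \<longrightarrow> merge_inv w ?f ((elt s' ''c'')(num s' ''o'' 0 := ?f (num s' ''j'' 0))) (l + 2 * w) (Suc (num s' ''o'' 0)) (l + 2 * w) (l + 3 * w))"
          using step(3) by blast
        then show ?thesis using False l fr o ln ij pre(6) wn
          by (cases "Suc (num s' ''o'' 0) < l + 2 * w")
            (auto simp: wp_simps algebra_simps intro: exI[of _ l] exI[of _ "l + 2 * w"])
      qed
    next
      case (4 k s')
      then obtain l where l: "l \<le> n" "num s' ''o'' 0 \<le> n"
        and inv: "merge_inv w ?f (elt s' ''c'') l (num s' ''o'' 0) (num s' ''i'' 0) (num s' ''j'' 0)"
        by blast
      have "num s' ''n'' 0 = n" using 4(2) pre by (simp add: frame_def)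
      then have o: "num s' ''o'' 0 = n" using 4(3) l(2) by simp
      have "\<not> l < n" using inv dvd_less_add_le[of "2 * w" l n] o pre(4) by (auto simp: merge_inv_def)
      then have "l = n" using l(1) by simp
      then have "num s' ''i'' 0 = n" "num s' ''j'' 0 = n + w"
        using inv o by (auto simp: merge_inv_def)
      then have res: "elt s' ''c'' ` {..<n} = ?f ` {..<n}" "block_sorted (2 * w) (elt s' ''c'') n"
        using inv o \<open>l = n\<close> by (auto simp: merge_inv_def)
      show ?case
        by (rule Q) (use 4(4) res 4(2) in \<open>simp_all add: frame_def\<close>)
    qed
    done
qed

definition sort_com :: com where
  "sort_com =
     ''w'' ::= Const 1 ;;
     While (ALess (Num ''w'') (Num ''n''))
       (merge_com ;;
        ''o'' ::= Const 0 ;;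
        While (ALess (Num ''o'') (Num ''n''))
          (EltAssign ''b'' (Num ''o'') (EltAt ''c'' (Num ''o'')) ;;
           ''o'' ::= Add (Num ''o'') (Const 1)) ;;
        ''w'' ::= Add (Num ''w'') (Num ''w''))"

lemma wp_copy:
  assumes "num s ''n'' 0 = n" "num s ''o'' 0 = 0" "n < 2 ^ L"
    and Q: "\<And>k s'. k \<le> 3 * n + 1 \<Longrightarrow> (\<forall>i<n. elt s' ''b'' i = elt s ''c'' i) \<Longrightarrow>
      \<forall>x. x \<notin> {''o''} \<longrightarrow> num s' x = num s x \<Longrightarrow>
      \<forall>x. x \<notin> {''b''} \<longrightarrow> elt s' x = elt s x \<Longrightarrow> Q k s'"
  shows "wp G L (While (ALess (Num ''o'') (Num ''n''))
          (EltAssign ''b'' (Num ''o'') (EltAt ''c'' (Num ''o'')) ;;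
           ''o'' ::= Add (Num ''o'') (Const 1))) s Q"
proof (rule wp_While[where F = n and k = 2 and f = "\<lambda>s'. n - num s' ''o'' 0" and
      I = "\<lambda>s'. num s' ''o'' 0 \<le> n \<and> (\<forall>i<num s' ''o'' 0. elt s' ''b'' i = elt s ''c'' i)"],
      goal_cases)
  case (3 s')
  then have "num s' ''n'' 0 = n" "elt s' ''c'' = elt s ''c''" using assms by (auto simp: frame_def)
  then show ?case using 3 assms by (auto simp: wp_simps less_Suc_eq)
next
  case (4 k s')
  then have "num s' ''n'' 0 = n" using assms by (auto simp: frame_def)
  then have *: "num s' ''o'' 0 = n" using 4 by simp
  show ?case
    by (rule Q) (use 4(1,2,4) * in \<open>simp_all add: frame_def\<close>)
qed (use assms in auto)

lemma block_sorted_cong: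
  "(\<And>i. i < n \<Longrightarrow> f i = g i) \<Longrightarrow> block_sorted w f n \<longleftrightarrow> block_sorted w g n"
  by (auto simp: block_sorted_def)

text \<open>Blocks of width 1 are trivially sorted, and a block of width \<open>n\<close> is the
  whole array; as \<open>n\<close> is a power of two, blocks always pair up. Only the set of entries
  is tracked and not their multiplicities, because the table serves for membership tests
  alone.\<close>

lemma wp_sort:
  assumes pre: "num s ''n'' 0 = n" "n = 2 ^ k" "4 * n < 2 ^ L"
    and Q: "\<And>m s'. m \<le> (k + 1) * (13 * n + 10) + 2 \<Longrightarrow>
      elt s' ''b'' ` {..<n} = elt s ''b'' ` {..<n} \<Longrightarrow>
      (\<forall>i j. i < j \<longrightarrow> j < n \<longrightarrow> lex_le (elt s' ''b'' i) (elt s' ''b'' j)) \<Longrightarrow>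
      \<forall>x. x \<notin> {''w'', ''o'', ''i'', ''m'', ''j'', ''e''} \<longrightarrow> num s' x = num s x \<Longrightarrow>
      \<forall>x. x \<notin> {''b'', ''c''} \<longrightarrow> elt s' x = elt s x \<Longrightarrow> Q m s'"
  shows "wp G L sort_com s Q"
  unfolding sort_com_def
  apply (simp only: wp_simps)
  apply (intro conjI)
  subgoal using pre(3) pre(2) by (cases L) auto
  subgoal
  \<comment> \<open>One pass costs \<open>10 * n + 6\<close> steps for merging,
    \<open>3 * n + 1\<close> for copying back and 2 for assignments.\<close>
  proof (rule wp_While[where F = "k + 1" and k = "13 * n + 9" and
        f = "\<lambda>s'. floorlog 2 (n div num s' ''w'' 0)" and
      I = "\<lambda>s'. (\<exists>a\<le>k. num s' ''w'' 0 = 2 ^ a) \<and> elt s' ''b'' ` {..<n} = elt s ''b'' ` {..<n} \<and>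
        block_sorted (num s' ''w'' 0) (elt s' ''b'') n"], goal_cases)
    case 1
    then show ?case by (auto simp: block_sorted_def intro: exI[of _ 0])
  next
    case 2
    then show ?case using pre(2) floorlog_power[of 1 2 k] by (simp add: floorlog_def)
  next
    case (3 s')
    then obtain a where a: "a \<le> k" "num s' ''w'' 0 = 2 ^ a"
      and im: "elt s' ''b'' ` {..<n} = elt s ''b'' ` {..<n}"
      and so: "block_sorted (num s' ''w'' 0) (elt s' ''b'') n" by blast
    have fr: "num s' ''n'' 0 = n" using 3(2) pre by (auto simp: frame_def merge_com_def)
    have "a < k" using 3(3) a fr pre(2) by (simp add: power_strict_increasing_iff)
    then have dv: "2 * 2 ^ a dvd n" using pre(2) by (metis Suc_leI le_imp_power_dvd power_Suc)
    have le: "2 * 2 ^ a \<le> n" using dv pre(2) by (simp add: dvd_imp_le)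
    have nd: "n div (2 * 2 ^ a) = n div 2 ^ a div 2"
      by (metis div_mult2_eq mult.commute)
    have "0 < n div 2 ^ a" using le by (simp add: div_greater_zero_iff)
    then have lt: "floorlog 2 (n div (2 * 2 ^ a)) < floorlog 2 (n div 2 ^ a)"
      unfolding nd using compute_floorlog[of 2 "n div 2 ^ a"] by simp
    show ?case
      apply (simp only: wp_Seq)
      apply (rule wp_merge[OF a(2) fr])
      subgoal by simp
      subgoal using dv by simp
      subgoal using pre(2) by simp
      subgoal using pre(3) by simp
      subgoal using so a by simp
      subgoal premises m for j s1
        apply (simp only: wp_simps)
        apply (intro conjI)
        subgoal by simp
        subgoal
          apply (rule wp_copy[where n = n])
          subgoal using m(4) fr by simp
          subgoal by simp
          subgoal using pre(3) by simp
          subgoal premises c for j' s2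
          proof -
            have w: "num s2 ''w'' 0 = 2 ^ a" using c(3) m(4) a by simp
            have b: "elt s2 ''b'' i = elt s1 ''c'' i" if "i < n" for i using c(2) that by simp
            have "elt s2 ''b'' ` {..<n} = elt s1 ''c'' ` {..<n}" using b by auto
            then have im2: "elt s2 ''b'' ` {..<n} = elt s ''b'' ` {..<n}" using m(2) im by simp
            have so2: "block_sorted (2 * 2 ^ a) (elt s2 ''b'') n"
              using block_sorted_cong[of n "elt s2 ''b''" "elt s1 ''c''"] b m(3) by simp
            show ?thesis
              using w im2 so2 lt le pre(3) m(1) c(1) \<open>a < k\<close> a(2)
              by (auto simp: wp_simps mult_2[symmetric] intro!: exI[of _ "Suc a"])
          qed
          done
        done
      done
  next
    case (4 m s')
    have fr: "num s' ''n'' 0 = n" using 4(2) pre by (auto simp: frame_def merge_com_def)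
    obtain a where a: "a \<le> k" "num s' ''w'' 0 = 2 ^ a"
      and so: "block_sorted (num s' ''w'' 0) (elt s' ''b'') n" using 4(1) by blast
    have "num s' ''w'' 0 = n" using a fr 4(3) pre(2) power_increasing[of a k "2::nat"] by simp
    then have sorted: "\<forall>i j. i < j \<longrightarrow> j < n \<longrightarrow> lex_le (elt s' ''b'' i) (elt s' ''b'' j)"
      using so by (simp add: block_sorted_def)
    show ?case
      by (rule Q) (use 4 sorted in \<open>simp_all add: frame_def merge_com_def algebra_simps\<close>)
  qed
  done

section \<open>Baby steps and giant steps\<close>

definition find_com :: com where
  "find_com =
     ''l'' ::= Const 0 ;; ''h'' ::= Num ''n'' ;;
     While (ALess (Const 1) (Num ''h''))
       (''h'' ::= Div (Num ''h'') (Const 2) ;;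
        If (ELess (Elt ''ot'') (EltAt ''b'' (Add (Num ''l'') (Num ''h'')))) Skip
          (''l'' ::= Add (Num ''l'') (Num ''h'')))"

text \<open>The window from \<open>l\<close> of length \<open>h\<close> keeps containing an
  occurrence of the target if there is one at all. The length is a power of two, so halving is exact
  and the window ends with one entry. Whether this entry really is the target is left to the caller
  to test.\<close>

lemma wp_find:
  assumes pre: "num s ''n'' 0 = n" "n = 2 ^ k" "n < 2 ^ L"
    and sorted: "\<forall>i j. i < j \<longrightarrow> j < n \<longrightarrow> lex_le (elt s ''b'' i) (elt s ''b'' j)"
    and Q: "\<And>m s'. m \<le> 4 * k + 7 \<Longrightarrow> num s' ''l'' 0 < n \<Longrightarrow>
      ((\<exists>i<n. elt s ''b'' i = elt s ''ot'' 0) \<longrightarrow> elt s ''b'' (num s' ''l'' 0) = elt s ''ot'' 0) \<Longrightarrow>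
      \<forall>x. x \<notin> {''l'', ''h''} \<longrightarrow> num s' x = num s x \<Longrightarrow> elt s' = elt s \<Longrightarrow> Q m s'"
  shows "wp G L find_com s Q"
proof -
  let ?b = "elt s ''b''" and ?t = "elt s ''ot'' 0"
  show ?thesis
    unfolding find_com_def
    apply (simp only: wp_simps)
    apply (intro conjI)
    subgoal by simp
    subgoal using pre by simp
    subgoal
    proof (rule wp_While[where F = "k + 1" and k = 3 and f = "\<lambda>s'. floorlog 2 (num s' ''h'' 0)" and
      I = "\<lambda>s'. (\<exists>a\<le>k. num s' ''h'' 0 = 2 ^ a) \<and> num s' ''l'' 0 + num s' ''h'' 0 \<le> n \<and>
        ((\<exists>i<n. ?b i = ?t) \<longrightarrow> (\<exists>i\<ge>num s' ''l'' 0. i < num s' ''l'' 0 + num s' ''h'' 0 \<and> ?b i = ?t))"],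
      goal_cases)
      case 1
      then show ?case using pre by (auto intro: exI[of _ k])
    next
      case 2
      then show ?case using pre floorlog_power[of 1 2 k] by (simp add: floorlog_def)
    next
      case (3 s')
      have fr: "elt s' = elt s" using 3(2) by (auto simp: frame_def)
      obtain a where a: "a \<le> k" "num s' ''h'' 0 = 2 ^ a" using 3(1) by blast
      obtain a' where a': "a = Suc a'" using 3(3) a by (cases a) auto
      let ?l = "num s' ''l'' 0" and ?h = "2 ^ a' :: nat"
      have le: "?l + 2 * ?h \<le> n" using 3(1) a a' by simp
      have fl: "floorlog 2 ?h < floorlog 2 (2 * ?h)" using compute_floorlog[of 2 "2 * ?h"] by simp
      have b: "?h < 2 ^ L" "?l + ?h < 2 ^ L" using le pre(3) by linarith+
      have pw: "\<exists>b\<le>k. ?h = 2 ^ b" using a(1) a' by (intro exI[of _ a']) simp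
      have h2: "num s' ''h'' 0 = 2 * ?h" using a a' by simp
      show ?case
      proof (cases "lex_le (?b (?l + ?h)) ?t")
        case True
        have "\<exists>i\<ge>?l + ?h. i < ?l + ?h + ?h \<and> ?b i = ?t" if "\<exists>i<n. ?b i = ?t"
        proof -
          have "\<exists>i\<ge>?l. i < ?l + num s' ''h'' 0 \<and> ?b i = ?t" using 3(1) that by blast
          then obtain i where i: "?l \<le> i" "i < ?l + 2 * ?h" "?b i = ?t" using a(2) a' by auto
          show ?thesis
          proof (cases "?l + ?h \<le> i")
            \<comment> \<open>An occurrence left of the middle is at most the middle entry by
              sortedness, and the test says that the middle entry is at most the target; so the
              middle entry is itself an occurrence.\<close>
            case False
            then have "lex_le ?t (?b (?l + ?h))" using sorted[rule_format, of i "?l + ?h"] i le by simp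
            then have "?b (?l + ?h) = ?t" using True lexordp_trichotomy by blast
            then show ?thesis by (intro exI[of _ "?l + ?h"]) simp
          qed (use i in \<open>auto intro: exI[of _ i]\<close>)
        qed
        then have "(\<exists>i<n. ?b i = ?t) \<longrightarrow> (\<exists>i\<ge>?l + ?h. i < ?l + ?h + ?h \<and> ?b i = ?t)" by blast
        then show ?thesis using True fr h2 le fl b pw by (simp add: wp_simps)
      next
        case False
        have "\<exists>i\<ge>?l. i < ?l + ?h \<and> ?b i = ?t" if "\<exists>i<n. ?b i = ?t"
        proof -
          have "\<exists>i\<ge>?l. i < ?l + num s' ''h'' 0 \<and> ?b i = ?t" using 3(1) that by blast
          then obtain i where i: "?l \<le> i" "i < ?l + 2 * ?h" "?b i = ?t" using a(2) a' by auto
          have "i < ?l + ?h"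
          proof (rule ccontr)
            assume "\<not> i < ?l + ?h"
            then have "lex_le (?b (?l + ?h)) ?t"
              using sorted[rule_format, of "?l + ?h" i] i le by (cases "i = ?l + ?h") (auto simp: lexordp_irreflexive')
            then show False using False by simp
          qed
          then show ?thesis using i by blast
        qed
        then have "(\<exists>i<n. ?b i = ?t) \<longrightarrow> (\<exists>i\<ge>?l. i < ?l + ?h \<and> ?b i = ?t)" by blast
        then show ?thesis using False fr h2 le fl b pw by (simp add: wp_simps)
      qed
    next
      case (4 m s')
      obtain a where a: "a \<le> k" "num s' ''h'' 0 = 2 ^ a" using 4(1) by blast
      have "a = 0" by (rule ccontr) (use 4(3) a one_less_power[of "2::nat" a] in simp)
      then have "num s' ''h'' 0 = 1" using a by simp
      then have *: "num s' ''l'' 0 < n"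
        "(\<exists>i<n. ?b i = ?t) \<longrightarrow> ?b (num s' ''l'' 0) = ?t"
        using 4(1) by (auto simp: less_Suc_eq_le dest: le_antisym)
      show ?case
        by (rule Q) (use * 4(2,4) in \<open>simp_all add: frame_def fun_eq_iff\<close>)
    qed
    done
qed

section \<open>Collision search for one step width\<close>

definition baby_com :: com where
  "baby_com =
     ''oa'' ::~ EMult (Elt ''g'') (EInv (Elt ''g'')) ;; ''i'' ::= Const 0 ;;
     While (ALess (Num ''i'') (Num ''n''))
       (EltAssign ''b'' (Num ''i'') (Elt ''oa'') ;;
        ''oa'' ::~ EMult (Elt ''oa'') (Elt ''ox'') ;;
        ''i'' ::= Add (Num ''i'') (Const 1))"

lemma wp_baby:
  assumes "group G" "elt s ''g'' 0 \<in> carrier G" "elt s ''ox'' 0 = x" "x \<in> carrier G"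
    "num s ''n'' 0 = n" "n < 2 ^ L"
    and Q: "\<And>m s'. m \<le> 4 * n + 3 \<Longrightarrow> (\<forall>i<n. elt s' ''b'' i = x [^]\<^bsub>G\<^esub> i) \<Longrightarrow>
      elt s' ''oa'' 0 = x [^]\<^bsub>G\<^esub> n \<Longrightarrow>
      \<forall>x. x \<notin> {''i''} \<longrightarrow> num s' x = num s x \<Longrightarrow>
      \<forall>x. x \<notin> {''b'', ''oa''} \<longrightarrow> elt s' x = elt s x \<Longrightarrow> Q m s'"
  shows "wp G L baby_com s Q"
proof -
  interpret group G by fact
  show ?thesis
    unfolding baby_com_def
    apply (simp only: wp_simps)
    apply (intro conjI)
    subgoal by simp
    subgoal
    proof (rule wp_While[where F = n and k = 3 and f = "\<lambda>s'. n - num s' ''i'' 0" and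
      I = "\<lambda>s'. num s' ''i'' 0 \<le> n \<and> (\<forall>i<num s' ''i'' 0. elt s' ''b'' i = x [^]\<^bsub>G\<^esub> i) \<and>
        elt s' ''oa'' 0 = x [^]\<^bsub>G\<^esub> num s' ''i'' 0"], goal_cases)
      case 1
      then show ?case using assms by simp
    next
      case (3 s')
      then have "num s' ''n'' 0 = n" "elt s' ''ox'' 0 = x" using assms by (auto simp: frame_def)
      then show ?case using 3(1,3) assms by (auto simp: wp_simps less_Suc_eq)
    next
      case (4 k s')
      then have "num s' ''n'' 0 = n" using assms by (auto simp: frame_def)
      then have *: "num s' ''i'' 0 = n" using 4 by simp
      show ?case
        by (rule Q) (use 4(1,2,4) * in \<open>simp_all add: frame_def\<close>)
    qed simp
    done
qed

text \<open>Sorting has discarded the exponents of the table entries. A hit therefore yields only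
  the giant step \<open>j\<close>; the matching baby step is recovered afterwards by walking through
  the powers of x once more.\<close>

definition giant_com :: com where
  "giant_com =
     While (BAnd (ALess (Num ''oj'') (Add (Num ''n'') (Const 1))) (ALess (Num ''of'') (Const 1)))
       (find_com ;;
        If (EEq (EltAt ''b'' (Num ''l'')) (Elt ''ot'')) (''of'' ::= Const 1)
          (''oj'' ::= Add (Num ''oj'') (Const 1) ;; ''ot'' ::~ EMult (Elt ''ot'') (Elt ''oy'')))"

lemma wp_giant:
  assumes "group G" "x \<in> carrier G"
    and pre: "num s ''n'' 0 = n" "n = 2 ^ k" "n + 1 < 2 ^ L" "num s ''oj'' 0 = 1" "num s ''of'' 0 = 0"
      "elt s ''ot'' 0 = x [^]\<^bsub>G\<^esub> n" "elt s ''oy'' 0 = x [^]\<^bsub>G\<^esub> n"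
    and sorted: "\<forall>i j. i < j \<longrightarrow> j < n \<longrightarrow> lex_le (elt s ''b'' i) (elt s ''b'' j)"
    and set: "elt s ''b'' ` {..<n} = (\<lambda>i. x [^]\<^bsub>G\<^esub> i) ` {..<n}"
    and Q: "\<And>m s'. m \<le> (4 * k + 11) * n + 1 \<Longrightarrow>
      (num s' ''of'' 0 = 0 \<and> (\<forall>j\<in>{1..n}. \<forall>i<n. x [^]\<^bsub>G\<^esub> (j * n) \<noteq> x [^]\<^bsub>G\<^esub> i)) \<or>
      (num s' ''of'' 0 = 1 \<and> num s' ''oj'' 0 \<in> {1..n} \<and>
        elt s' ''ot'' 0 = x [^]\<^bsub>G\<^esub> (num s' ''oj'' 0 * n) \<and>
        (\<exists>i<n. x [^]\<^bsub>G\<^esub> (num s' ''oj'' 0 * n) = x [^]\<^bsub>G\<^esub> i)) \<Longrightarrow>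
      \<forall>x. x \<notin> {''l'', ''h'', ''of'', ''oj''} \<longrightarrow> num s' x = num s x \<Longrightarrow>
      \<forall>x. x \<notin> {''ot''} \<longrightarrow> elt s' x = elt s x \<Longrightarrow> Q m s'"
  shows "wp G L giant_com s Q"
proof -
  interpret group G by fact
  have mem: "(\<exists>i<n. elt s ''b'' i = y) \<longleftrightarrow> (\<exists>i<n. x [^]\<^bsub>G\<^esub> i = y)" for y
  proof -
    have "y \<in> elt s ''b'' ` {..<n} \<longleftrightarrow> y \<in> (\<lambda>i. x [^]\<^bsub>G\<^esub> i) ` {..<n}" using set by simp
    then show ?thesis by (simp only: image_iff Bex_def lessThan_iff eq_commute[of y])
  qed
  show ?thesis
    unfolding giant_com_def
  proof (rule wp_While[where F = n and k = "4 * k + 10" and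
      f = "\<lambda>s'. if num s' ''of'' 0 = 0 then n + 1 - num s' ''oj'' 0 else 0" and
      I = "\<lambda>s'. 1 \<le> num s' ''oj'' 0 \<and> num s' ''oj'' 0 \<le> n + 1 \<and>
        elt s' ''ot'' 0 = x [^]\<^bsub>G\<^esub> (num s' ''oj'' 0 * n) \<and>
        (\<forall>j\<in>{1..<num s' ''oj'' 0}. \<forall>i<n. x [^]\<^bsub>G\<^esub> (j * n) \<noteq> x [^]\<^bsub>G\<^esub> i) \<and>
        (num s' ''of'' 0 = 0 \<or> num s' ''of'' 0 = 1 \<and> num s' ''oj'' 0 \<le> n \<and>
          (\<exists>i<n. x [^]\<^bsub>G\<^esub> (num s' ''oj'' 0 * n) = x [^]\<^bsub>G\<^esub> i))"], goal_cases)
    case 1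
    then show ?case using pre by simp
  next
    case 2
    then show ?case using pre by simp
  next
    case (3 s')
    have fr: "num s' ''n'' 0 = n" "elt s' ''b'' = elt s ''b''" "elt s' ''oy'' 0 = x [^]\<^bsub>G\<^esub> n"
      using 3(2) pre by (auto simp: frame_def find_com_def)
    have h: "num s' ''of'' 0 = 0" "num s' ''oj'' 0 \<le> n" using 3(3) fr by auto
    show ?case
      apply (simp only: wp_Seq)
      apply (rule wp_find[OF fr(1) pre(2)])
      subgoal using pre(3) by simp
      subgoal using sorted fr(2) by simp
      subgoal premises p for m s1
      proof -
        have s1: "num s1 ''of'' 0 = 0" "num s1 ''oj'' 0 = num s' ''oj'' 0" using p(4) h by auto
        have b1: "elt s1 ''b'' = elt s ''b''" "elt s1 ''ot'' 0 = x [^]\<^bsub>G\<^esub> (num s' ''oj'' 0 * n)"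
          "elt s1 ''oy'' 0 = x [^]\<^bsub>G\<^esub> n"
          using p(5) fr 3(1) by auto
        show ?thesis
        proof (cases "elt s ''b'' (num s1 ''l'' 0) = x [^]\<^bsub>G\<^esub> (num s' ''oj'' 0 * n)")
          case True
          then have "\<exists>i<n. x [^]\<^bsub>G\<^esub> i = x [^]\<^bsub>G\<^esub> (num s' ''oj'' 0 * n)" using mem p(2) by blast
          then have "\<exists>i<n. x [^]\<^bsub>G\<^esub> (num s' ''oj'' 0 * n) = x [^]\<^bsub>G\<^esub> i" by metis
          then show ?thesis using True 3(1) h s1 b1 p(1) pre(3)
            by (simp add: wp_simps)
        next
          case False
          then have "\<not> (\<exists>i<n. elt s ''b'' i = x [^]\<^bsub>G\<^esub> (num s' ''oj'' 0 * n))"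
            using p(3) b1 fr p(5) by auto
          then have "\<forall>i<n. x [^]\<^bsub>G\<^esub> (num s' ''oj'' 0 * n) \<noteq> x [^]\<^bsub>G\<^esub> i" using mem by metis
          then have "\<forall>j\<in>{1..<Suc (num s' ''oj'' 0)}. \<forall>i<n. x [^]\<^bsub>G\<^esub> (j * n) \<noteq> x [^]\<^bsub>G\<^esub> i"
            using 3(1) by (auto simp: less_Suc_eq)
          moreover have "x [^]\<^bsub>G\<^esub> (num s' ''oj'' 0 * n) \<otimes>\<^bsub>G\<^esub> x [^]\<^bsub>G\<^esub> n = x [^]\<^bsub>G\<^esub> (n + num s' ''oj'' 0 * n)"
            using assms(2) by (simp add: nat_pow_mult add.commute)
          ultimately show ?thesis using False 3(1) h s1 b1 p(1) pre(3)
            by (simp add: wp_simps)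
        qed
      qed
      done
  next
    case (4 m s')
    have fr: "num s' ''n'' 0 = n" using 4(2) pre by (auto simp: frame_def find_com_def)
    show ?case
    proof (rule Q)
      show "(num s' ''of'' 0 = 0 \<and> (\<forall>j\<in>{1..n}. \<forall>i<n. x [^]\<^bsub>G\<^esub> (j * n) \<noteq> x [^]\<^bsub>G\<^esub> i)) \<or>
      (num s' ''of'' 0 = 1 \<and> num s' ''oj'' 0 \<in> {1..n} \<and>
        elt s' ''ot'' 0 = x [^]\<^bsub>G\<^esub> (num s' ''oj'' 0 * n) \<and>
        (\<exists>i<n. x [^]\<^bsub>G\<^esub> (num s' ''oj'' 0 * n) = x [^]\<^bsub>G\<^esub> i))"
      proof (cases "num s' ''of'' 0 = 0")
        case True
        then have "num s' ''oj'' 0 = n + 1" using 4(1,3) fr by simp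
        then have "\<forall>j\<in>{1..n}. \<forall>i<n. x [^]\<^bsub>G\<^esub> (j * n) \<noteq> x [^]\<^bsub>G\<^esub> i" using 4(1) by auto
        then show ?thesis using True by blast
      next
        case False
        then show ?thesis using 4(1) by auto
      qed
    qed (use 4(2,4) in \<open>simp_all add: frame_def find_com_def algebra_simps\<close>)
  qed
qed

definition round_com :: com where
  "round_com =
     baby_com ;; ''oy'' ::~ Elt ''oa'' ;; ''ot'' ::~ Elt ''oa'' ;; ''oj'' ::= Const 1 ;;
     sort_com ;; giant_com ;;
     If (ALess (Num ''of'') (Const 1)) (''n'' ::= Add (Num ''n'') (Num ''n'')) Skip"

text \<open>Let j n be the order of x rounded up to a multiple of n. Then x^(j n) is the baby step
  with exponent j n - ord x, and j is at most n as soon as ord x is at most n^2. A search without a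
  hit therefore forces n^2 < ord x, and ord x is at most |G|.\<close>

lemma no_collision_imp_ord_greater:
  assumes "group G" "finite (carrier G)" "x \<in> carrier G" "0 < n"
    and no: "\<forall>j\<in>{1..n}. \<forall>i<n. x [^]\<^bsub>G\<^esub> (j * n) \<noteq> x [^]\<^bsub>G\<^esub> i"
  shows "n * n < card (carrier G)"
proof (rule ccontr)
  interpret group G by fact
  let ?o = "ord x"
  have o: "0 < ?o" using assms ord_ge_1 by fastforce
  assume "\<not> n * n < card (carrier G)"
  then have on: "?o \<le> n * n"
    using ord_le_group_order[OF assms(2,3)] by (simp add: order_def)
  \<comment> \<open>The quotient of \<open>?o\<close> by \<open>n\<close>, rounded up.\<close>
  define j where "j = (?o + (n - 1)) div n"
  have j: "?o \<le> j * n" "j * n < ?o + n"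
  proof -
    have "j * n \<le> ?o + (n - 1)" unfolding j_def by (rule div_times_less_eq_dividend)
    then show "j * n < ?o + n" using assms(4) by linarith
    have "?o + (n - 1) < n + j * n" unfolding j_def by (rule dividend_less_div_times) (fact assms(4))
    then show "?o \<le> j * n" using assms(4) by linarith
  qed
  have "j \<le> n"
  proof (rule ccontr)
    assume "\<not> j \<le> n"
    then have "Suc n * n \<le> j * n" by (intro mult_right_mono) auto
    then show False using j on by simp
  qed
  moreover have "1 \<le> j" using j o by (cases j) auto
  moreover have "x [^]\<^bsub>G\<^esub> (j * n) = x [^]\<^bsub>G\<^esub> (j * n - ?o)"
    using nat_pow_mult[OF assms(3), of ?o "j * n - ?o"] j assms(3) by simp
  moreover have "j * n - ?o < n" using j by simp
  ultimately show False using no by auto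
qed

text \<open>A failed round certifies n^2 < |G|, so the doubled width satisfies (2 n)^2 < 4 |G|. This
  is where the factor 4 in the bounds on widths and on order multiples originates.\<close>

lemma wp_round:
  assumes "group G" "finite (carrier G)" "elt s ''g'' 0 \<in> carrier G" "elt s ''ox'' 0 = x" "x \<in> carrier G"
    and pre: "num s ''n'' 0 = n" "n = 2 ^ k" "n * n \<le> 4 * card (carrier G)"
      "16 * card (carrier G) < 2 ^ L" "num s ''of'' 0 = 0" "n \<le> R"
    and Q: "\<And>m s'. m \<le> (L + 1) * (28 * R + 23) \<Longrightarrow>
      (num s' ''of'' 0 = 0 \<and> num s' ''n'' 0 = 2 * n \<and> n * n < card (carrier G)) \<or>
      (num s' ''of'' 0 = 1 \<and> num s' ''n'' 0 = n \<and> num s' ''oj'' 0 \<in> {1..n} \<and>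
        elt s' ''ot'' 0 = x [^]\<^bsub>G\<^esub> (num s' ''oj'' 0 * n) \<and>
        (\<exists>i<n. x [^]\<^bsub>G\<^esub> (num s' ''oj'' 0 * n) = x [^]\<^bsub>G\<^esub> i)) \<Longrightarrow> Q m s'"
  shows "wp G L round_com s Q"
proof -
  interpret group G by fact
  have n0: "0 < n" using pre(2) by simp
  have "n \<le> n * n" using n0 by simp
  then have n4: "n \<le> 4 * card (carrier G)" using pre(3) by linarith
  have nL: "4 * n < 2 ^ L" "2 * n < 2 ^ L" "n + 1 < 2 ^ L" "n < 2 ^ L" "1 < (2::nat) ^ L"
    using n4 n0 pre(4) by linarith+
  have "(2::nat) ^ k < 2 ^ L" using nL pre(2) by simp
  then have kL: "k < L" by simp
  have cost1: "(k + 1) * (13 * n + 10) \<le> (L + 1) * (13 * R + 10)"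
    using kL pre(6) by (intro mult_mono add_mono) auto
  have cost2: "(4 * k + 11) * n \<le> (4 * L + 11) * R"
    using kL pre(6) by (intro mult_mono add_mono) auto
  show ?thesis
    unfolding round_com_def
    apply (simp only: wp_Seq)
    apply (rule wp_baby[OF assms(1,3,4,5) pre(1) nL(4)])
    subgoal premises b for m1 s1
      apply (simp only: wp_simps)
      apply (rule conjI)
      subgoal using nL by simp
      apply (rule wp_sort[where n = n and k = k])
      subgoal using b(4) pre(1) by simp
      subgoal by (rule pre(2))
      subgoal by (rule nL)
      subgoal premises q for m2 s2
        apply (rule wp_giant[OF assms(1,5), where n = n and k = k])
        subgoal using q(4) b(4) pre(1) by simp
        subgoal by (rule pre(2))
        subgoal by (rule nL)
        subgoal using q(4) by simp
        subgoal using q(4) b(4) pre(5) by simp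
        subgoal using q(5) b(3) by simp
        subgoal using q(5) b(3) by simp
        subgoal using q(3) .
        subgoal using q(2) b(2) by simp
        subgoal premises g for m3 s3
        proof -
          have n3: "num s3 ''n'' 0 = n" using g(3) q(4) b(4) pre(1) by simp
          \<comment> \<open>Of the coefficient 28, the table accounts for 4, sorting for 13 and the
            lookups for 11; the terms with a factor \<open>L\<close> leave room to spare.\<close>
          have "4 * n + 3 + (L + 1) * (13 * R + 10) + (4 * L + 11) * R + 9 \<le> (L + 1) * (28 * R + 23)"
            using pre(6) by (simp add: algebra_simps)
          then have cost: "m1 + m2 + m3 + 5 \<le> (L + 1) * (28 * R + 23)"
            using b(1) q(1) g(1) cost1 cost2 by linarith
          show ?thesis
          proof (cases "num s3 ''of'' 0 = 0")
            case True
            then have "\<forall>j\<in>{1..n}. \<forall>i<n. x [^]\<^bsub>G\<^esub> (j * n) \<noteq> x [^]\<^bsub>G\<^esub> i" using g(2) by simp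
            then have "n * n < card (carrier G)"
              using no_collision_imp_ord_greater[OF assms(1,2,5) n0] by blast
            then show ?thesis using True n3 nL cost
              by (simp add: wp_simps Q)
          next
            case False
            then show ?thesis using g(2) n3 cost
              by (simp add: wp_simps Q)
          qed
        qed
        done
      done
    done
qed

text \<open>A collision \<open>x^(j n) = x^i\<close> yields the multiple \<open>j n - i\<close> of the order of \<open>x\<close>; the order itself is
  not needed.\<close>

definition order_com :: com where
  "order_com =
     ''n'' ::= Const 1 ;; ''of'' ::= Const 0 ;;
     While (ALess (Num ''of'') (Const 1)) round_com ;;
     ''oe'' ::= Mul (Num ''oj'') (Num ''n'') ;;
     ''oa'' ::~ EMult (Elt ''g'') (EInv (Elt ''g'')) ;;
     While (BNot (EEq (Elt ''oa'') (Elt ''ot'')))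
       (''oa'' ::~ EMult (Elt ''oa'') (Elt ''ox'') ;; ''oe'' ::= Sub (Num ''oe'') (Const 1))"

text \<open>The width stays below \<open>2 ^ L\<close>, so there are at most \<open>L\<close>
  rounds, each costing a multiple of \<open>(L + 1) * R\<close>. The closing walk from 1 up to x^(j
  n) takes fewer rounds than the width, hence it is covered by \<open>R\<close>.\<close>

lemma wp_order:
  assumes "group G" "finite (carrier G)" "elt s ''g'' 0 \<in> carrier G" "elt s ''ox'' 0 \<in> carrier G"
    and pre: "16 * card (carrier G) < 2 ^ L" "\<And>n. n * n \<le> 4 * card (carrier G) \<Longrightarrow> n \<le> R"
    and Q: "\<And>m s'. m \<le> (L + 1) * (L + 1) * (31 * R + 31) \<Longrightarrow>
      0 < num s' ''oe'' 0 \<Longrightarrow> num s' ''oe'' 0 \<le> 4 * card (carrier G) \<Longrightarrow>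
      elt s ''ox'' 0 [^]\<^bsub>G\<^esub> num s' ''oe'' 0 = \<one>\<^bsub>G\<^esub> \<Longrightarrow>
      \<forall>x. x \<notin> {''n'', ''of'', ''i'', ''oj'', ''l'', ''h'', ''oe'', ''w'', ''o'', ''m'', ''j'', ''e''} \<longrightarrow>
        num s' x = num s x \<Longrightarrow>
      \<forall>x. x \<notin> {''oa'', ''oy'', ''ot'', ''b'', ''c''} \<longrightarrow> elt s' x = elt s x \<Longrightarrow> Q m s'"
  shows "wp G L order_com s Q"
proof -
  interpret group G by fact
  define x where "x = elt s ''ox'' 0"
  have x: "x \<in> carrier G" using assms by (simp add: x_def)
  let ?N = "card (carrier G)"
  have N: "1 \<le> ?N" using assms(2) by (metis One_nat_def Suc_leI card_gt_0_iff empty_iff one_closed)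
  note wcoms = round_com_def giant_com_def baby_com_def sort_com_def merge_com_def find_com_def
  show ?thesis
    unfolding order_com_def
    apply (simp only: wp_simps)
    apply (intro conjI)
    subgoal using pre(1) N by simp
    subgoal by simp
    subgoal
    \<comment> \<open>The width starts at 1, which has one bit, and each failed round adds a bit;
      success sends the measure to 0.\<close>
    proof (rule wp_While[where F = L and k = "(L + 1) * (28 * R + 23)" and
        f = "\<lambda>s'. if num s' ''of'' 0 = 0 then L + 1 - floorlog 2 (num s' ''n'' 0) else 0" and
        I = "\<lambda>s'. (\<exists>k. num s' ''n'' 0 = 2 ^ k) \<and> num s' ''n'' 0 * num s' ''n'' 0 \<le> 4 * ?N \<and>
          (num s' ''of'' 0 = 0 \<or> num s' ''of'' 0 = 1 \<and> num s' ''oj'' 0 \<in> {1..num s' ''n'' 0} \<and>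
            elt s' ''ot'' 0 = x [^]\<^bsub>G\<^esub> (num s' ''oj'' 0 * num s' ''n'' 0) \<and>
            (\<exists>i<num s' ''n'' 0. x [^]\<^bsub>G\<^esub> (num s' ''oj'' 0 * num s' ''n'' 0) = x [^]\<^bsub>G\<^esub> i))"],
        goal_cases)
      case 1
      then show ?case using N by (auto intro: exI[of _ 0])
    next
      case 2
      then show ?case using compute_floorlog[of 2 1] by simp
    next
      case (3 s')
      obtain k where k: "num s' ''n'' 0 = 2 ^ k" using 3(1) by blast
      have nn: "num s' ''n'' 0 * num s' ''n'' 0 \<le> 4 * ?N" using 3(1) by blast
      have gx: "elt s' ''g'' 0 \<in> carrier G" "elt s' ''ox'' 0 = x"
        using 3(2) assms by (simp_all add: frame_def wcoms x_def)
      have of: "num s' ''of'' 0 = 0" using 3(3) by simp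
      show ?case
      proof (rule wp_round[OF assms(1,2) gx x refl k nn pre(1) of pre(2)[OF nn]], goal_cases)
        case (1 m s1)
        then show ?case
        proof (elim disjE conjE)
          assume a: "num s1 ''of'' 0 = 0" "num s1 ''n'' 0 = 2 * num s' ''n'' 0"
            "num s' ''n'' 0 * num s' ''n'' 0 < ?N"
          have b: "\<exists>k. num s1 ''n'' 0 = 2 ^ k" using a(2) k by (intro exI[of _ "Suc k"]) simp
          have c: "num s1 ''n'' 0 * num s1 ''n'' 0 \<le> 4 * ?N" using a(2,3) by simp
          have "2 * num s' ''n'' 0 \<le> num s1 ''n'' 0 * num s1 ''n'' 0" using a(2) k by simp
          then have "2 * num s' ''n'' 0 < 2 ^ L" using c pre(1) by linarith
          then have "floorlog 2 (2 * num s' ''n'' 0) \<le> L" by (intro floorlog_leI) auto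
          moreover have "floorlog 2 (num s' ''n'' 0) < floorlog 2 (2 * num s' ''n'' 0)"
            using compute_floorlog[of 2 "2 * num s' ''n'' 0"] k by simp
          ultimately show ?thesis using a b c 1(1) of by simp
        next
          assume a: "num s1 ''of'' 0 = 1" "num s1 ''n'' 0 = num s' ''n'' 0"
            "num s1 ''oj'' 0 \<in> {1..num s' ''n'' 0}"
            "elt s1 ''ot'' 0 = x [^]\<^bsub>G\<^esub> (num s1 ''oj'' 0 * num s' ''n'' 0)"
            "\<exists>i<num s' ''n'' 0. x [^]\<^bsub>G\<^esub> (num s1 ''oj'' 0 * num s' ''n'' 0) = x [^]\<^bsub>G\<^esub> i"
          have "floorlog 2 (num s' ''n'' 0) \<le> L"
          proof (rule floorlog_leI)
            have "num s' ''n'' 0 \<le> num s' ''n'' 0 * num s' ''n'' 0" using k by simp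
            then show "num s' ''n'' 0 < 2 ^ L" using nn pre(1) by linarith
          qed auto
          then show ?thesis using a nn k 1(1) of by simp
        qed
      qed
    next
      case (4 m s')
      let ?n = "num s' ''n'' 0" and ?j = "num s' ''oj'' 0"
      have h: "?n * ?n \<le> 4 * ?N" "1 \<le> ?j" "?j \<le> ?n" "elt s' ''ot'' 0 = x [^]\<^bsub>G\<^esub> (?j * ?n)"
        using 4(1,3) by auto
      obtain i where i: "i < ?n" "x [^]\<^bsub>G\<^esub> (?j * ?n) = x [^]\<^bsub>G\<^esub> i" using 4(1,3) by auto
      have gx: "elt s' ''g'' 0 \<in> carrier G" "elt s' ''ox'' 0 = x"
        using 4(2) assms by (simp_all add: frame_def wcoms x_def)
      have jn: "?j * ?n \<le> 4 * ?N" "?j * ?n < 2 ^ L" "i < ?j * ?n"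
      proof -
        have "?j * ?n \<le> ?n * ?n" using h(3) by (rule mult_right_mono) simp
        then show "?j * ?n \<le> 4 * ?N" using h(1) by linarith
        then show "?j * ?n < 2 ^ L" using pre(1) by linarith
        have "1 * ?n \<le> ?j * ?n" using h(2) by (rule mult_right_mono) simp
        then show "i < ?j * ?n" using i(1) by linarith
      qed
      have nR: "?n \<le> R" using pre(2)[OF h(1)] .
      show ?case
        apply (rule conjI)
        subgoal using jn by simp
        subgoal
        \<comment> \<open>The exponent reached is \<open>r\<close>. The walk stops no later than at
          \<open>i\<close>, and \<open>i\<close> is below j n, so the remaining difference
          \<open>oe\<close> is positive.\<close>
        proof (rule wp_While[where F = ?n and k = 2 and
            f = "\<lambda>s''. i + num s'' ''oe'' 0 - ?j * ?n" and
            I = "\<lambda>s''. \<exists>r\<le>i. elt s'' ''oa'' 0 = x [^]\<^bsub>G\<^esub> r \<and> num s'' ''oe'' 0 + r = ?j * ?n"],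
            goal_cases)
          case 1
          then show ?case using gx(1) by (intro exI[of _ 0]) simp
        next
          case 2
          then show ?case using i(1) by simp
        next
          case (3 s'')
          have fr: "elt s'' ''ot'' 0 = x [^]\<^bsub>G\<^esub> i" "elt s'' ''ox'' 0 = x"
            using 3(2) h(4) i(2) gx by (simp_all add: frame_def)
          obtain r where r: "r \<le> i" "elt s'' ''oa'' 0 = x [^]\<^bsub>G\<^esub> r" "num s'' ''oe'' 0 + r = ?j * ?n"
            using 3(1) by blast
          have "r \<noteq> i" using 3(3) fr(1) r(2) by auto
          then have "r < i" using r(1) by simp
          then show ?case using fr r jn
            by (auto simp: wp_simps intro!: exI[of _ "Suc r"])
        next
          case (4 m' s'')
          have fr: "elt s'' ''ot'' 0 = x [^]\<^bsub>G\<^esub> (?j * ?n)" using 4(2) h(4) by (simp add: frame_def)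
          obtain r where r: "r \<le> i" "elt s'' ''oa'' 0 = x [^]\<^bsub>G\<^esub> r" "num s'' ''oe'' 0 + r = ?j * ?n"
            using 4(1) by blast
          have "x [^]\<^bsub>G\<^esub> (?j * ?n) = x [^]\<^bsub>G\<^esub> r" using 4(3) fr r(2) by simp
          then have "x [^]\<^bsub>G\<^esub> r \<otimes>\<^bsub>G\<^esub> x [^]\<^bsub>G\<^esub> num s'' ''oe'' 0 = x [^]\<^bsub>G\<^esub> r \<otimes>\<^bsub>G\<^esub> \<one>\<^bsub>G\<^esub>"
            using nat_pow_mult[OF x, of r "num s'' ''oe'' 0"] r(3) x by (simp add: add.commute)
          then have one: "x [^]\<^bsub>G\<^esub> num s'' ''oe'' 0 = \<one>\<^bsub>G\<^esub>" using x by (simp only: l_cancel nat_pow_closed one_closed)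
          have cost: "1 + (1 + (m + (1 + (1 + m')))) \<le> (L + 1) * (L + 1) * (31 * R + 31)"
          proof -
            have "m' \<le> 3 * R + 1" using 4(4) nR by simp
            then have "1 + (1 + (m + (1 + (1 + m')))) \<le>
                L * ((L + 1) * (28 * R + 23) + 1) + 1 + (3 * R + 1) + 4"
              using \<open>m \<le> L * ((L + 1) * (28 * R + 23) + 1) + 1\<close> by linarith
            also have "\<dots> \<le> (L + 1) * (L + 1) * (31 * R + 31)" by (simp add: algebra_simps)
            finally show ?thesis .
          qed
          show ?case
          proof (rule Q[OF cost])
            show "0 < num s'' ''oe'' 0" using r jn by linarith
            show "num s'' ''oe'' 0 \<le> 4 * card (carrier G)" using r jn by linarith
            show "elt s ''ox'' 0 [^]\<^bsub>G\<^esub> num s'' ''oe'' 0 = \<one>\<^bsub>G\<^esub>" using one by (simp add: x_def)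
            show "\<forall>x. x \<notin> {''n'', ''of'', ''i'', ''oj'', ''l'', ''h'', ''oe'', ''w'', ''o'', ''m'', ''j'', ''e''} \<longrightarrow>
                num s'' x = num s x"
              using 4(2) \<open>frame round_com _ s'\<close> by (simp add: frame_def wcoms)
            show "\<forall>x. x \<notin> {''oa'', ''oy'', ''ot'', ''b'', ''c''} \<longrightarrow> elt s'' x = elt s x"
              using 4(2) \<open>frame round_com _ s'\<close> by (simp add: frame_def wcoms)
          qed
        qed
        done
    qed
    done
qed

hide_const (open) Divisibility.prime

section \<open>Group theory\<close>

lemma coprime_if_no_common_prime:
  assumes "\<And>q. prime q \<Longrightarrow> q dvd d \<Longrightarrow> \<not> q dvd (k::nat)"
  shows "coprime k d"
proof (rule ccontr)
  assume "\<not> coprime k d"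
  then have "gcd k d \<noteq> 1" by (simp add: coprime_iff_gcd_eq_1)
  then obtain p where "prime p" "p dvd gcd k d" using prime_factor_nat by blast
  then show False using assms by auto
qed

lemma (in group) subgroup_nat_pow_closed:
  assumes "subgroup H G" "x \<in> H"
  shows "x [^] (n::nat) \<in> H"
  using assms by (induction n) (simp_all add: subgroup.one_closed subgroup.m_closed)

lemma (in group) subgroup_pow_gcd:
  assumes "subgroup H G" "x \<in> carrier G" "x [^] i \<in> H" "x [^] j \<in> H"
  shows "x [^] gcd i (j::nat) \<in> H"
proof (cases "i = 0")
  case False
  interpret H: subgroup H G by fact
  obtain u v where uv: "i * u = j * v + gcd i j" using bezout_nat[OF False] by blast
  have iu: "x [^] (i * u) \<in> H" "x [^] (j * v) \<in> H"
    using assms subgroup_nat_pow_closed[OF assms(1)] by (simp_all flip: nat_pow_pow)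
  have "x [^] (i * u) = x [^] (j * v) \<otimes> x [^] gcd i j"
    using uv assms(2) by (simp add: nat_pow_mult)
  then have "x [^] gcd i j = inv (x [^] (j * v)) \<otimes> x [^] (i * u)"
    using assms(2) by (simp add: inv_solve_left)
  then show ?thesis using iu by simp
qed (use assms in simp)

text \<open>The least positive exponent d with x^d in H divides every exponent with this property.
  By the local hypothesis d shares no prime with m', so d dividing m m' means that d divides m. This
  is the device that assembles information gathered prime by prime.\<close>

lemma (in group) pow_mem_cofactor:
  assumes "subgroup H G" "x \<in> carrier G" "0 < m * m'" "x [^] (m * m') \<in> H"
    and "\<And>p. prime p \<Longrightarrow> p dvd m' \<Longrightarrow> \<exists>k. x [^] k \<in> H \<and> \<not> p dvd k"
  shows "x [^] (m::nat) \<in> H"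
proof -
  define d where "d = (LEAST d::nat. 0 < d \<and> x [^] d \<in> H)"
  have d: "0 < d \<and> x [^] d \<in> H"
    unfolding d_def using LeastI[of "\<lambda>d. 0 < d \<and> x [^] d \<in> H" "m * m'"] assms(3,4) by simp
  have dvd: "d dvd k" if "x [^] k \<in> H" for k
  proof -
    have "x [^] gcd d k \<in> H" using subgroup_pow_gcd[OF assms(1,2)] d that by blast
    moreover have "0 < gcd d k" using d by simp
    ultimately have "d \<le> gcd d k" unfolding d_def by (intro Least_le) simp
    moreover have "gcd d k \<le> d" using d by (simp add: gcd_le1_nat)
    ultimately have "gcd d k = d" by simp
    then show ?thesis by (metis gcd_dvd2)
  qed
  have "coprime d m'" by (rule coprime_if_no_common_prime) (use assms(5) dvd dvd_trans in blast)
  then have "d dvd m" using dvd[OF assms(4)] by (simp add: coprime_dvd_mult_left_iff)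
  then obtain e where "m = d * e" by blast
  then have "x [^] m = (x [^] d) [^] e" using assms(2) by (simp add: nat_pow_pow)
  also have "\<dots> \<in> H" using subgroup_nat_pow_closed[OF assms(1)] d by blast
  finally show ?thesis .
qed

text \<open>Bezout. For trivial H it says that an element killed by two coprime exponents is the
  identity, which is how most comparisons of orders below are carried out.\<close>

lemma (in group) coprime_pow_mem:
  assumes "subgroup H G" "x \<in> carrier G" "x [^] i \<in> H" "x [^] j \<in> H" "coprime i (j::nat)"
  shows "x \<in> H"
  using subgroup_pow_gcd[OF assms(1-4)] assms(2,5) by simp

lemma (in group) generate_commute:
  assumes "c \<in> carrier G" "T \<subseteq> carrier G" "\<And>t. t \<in> T \<Longrightarrow> t \<otimes> c = c \<otimes> t" "x \<in> generate G T"
  shows "x \<otimes> c = c \<otimes> x"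
  using assms(4)
proof induction
  case (inv h)
  then have h: "h \<in> carrier G" "h \<otimes> c = c \<otimes> h" using assms by auto
  have "inv h \<otimes> c = inv h \<otimes> (c \<otimes> h) \<otimes> inv h" using h assms(1) by (simp add: m_assoc)
  also have "\<dots> = inv h \<otimes> (h \<otimes> c) \<otimes> inv h" by (simp add: h(2))
  also have "\<dots> = c \<otimes> inv h" using h(1) assms(1) by (simp add: m_assoc[symmetric])
  finally show ?case .
next
  case (eng h1 h2)
  have "h1 \<in> carrier G" "h2 \<in> carrier G" using eng generate_in_carrier[OF assms(2)] by auto
  then show ?case using eng(3,4) assms(1) by (metis m_assoc)
qed (use assms in auto)

section \<open>Cosets and abelian quotients\<close>

lemma (in group) rcos_eq_iff:
  assumes "N \<lhd> G" "x \<in> carrier G" "y \<in> carrier G"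
  shows "N #> x = N #> y \<longleftrightarrow> x \<otimes> inv y \<in> N"
proof -
  interpret N: normal N G by fact
  have "x \<otimes> inv y \<in> N \<longleftrightarrow> x \<in> N #> y"
    using N.rcos_module[OF is_group assms(3,2)] by simp
  then show ?thesis
    using repr_independence[of x N y] N.subgroup_axioms assms rcos_self[of x N] by auto
qed

lemma (in group) hom_rcos:
  assumes "N \<lhd> G"
  shows "group_hom G (G Mod N) ((#>) N)"
proof -
  interpret N: normal N G by fact
  show ?thesis
    by (intro group_hom.intro group_hom_axioms.intro is_group N.factorgroup_is_group N.r_coset_hom_Mod)
qed

lemma (in group) generate_FactGroup:
  assumes "N \<lhd> G" "z \<in> carrier G" "generate G (N \<union> {z}) = carrier G"
  shows "generate (G Mod N) {N #> z} = carrier (G Mod N)"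
proof -
  interpret N: normal N G by fact
  interpret h: group_hom G "G Mod N" "(#>) N" by (rule hom_rcos) fact
  let ?Q = "G Mod N" and ?z = "N #> z"
  have hz: "?z \<in> carrier ?Q" using assms(2) by simp
  have "carrier ?Q = generate ?Q ((#>) N ` (N \<union> {z}))"
    using h.generate_img[of "N \<union> {z}"] assms N.subset by (simp add: carrier_FactGroup)
  also have "\<dots> \<subseteq> generate ?Q {?z}"
  proof (rule h.H.generate_subgroup_incl)
    show "(#>) N ` (N \<union> {z}) \<subseteq> generate ?Q {?z}"
      using coset_join2[OF _ N.is_subgroup] N.subset generate.one[of ?Q]
      by (auto intro: generate.incl)
    show "subgroup (generate ?Q {?z}) ?Q" using hz by (intro h.H.generate_is_subgroup) simp
  qed
  finally show ?thesis using h.H.generate_incl[of "{?z}"] hz by blast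
qed

lemma (in group) comm_FactGroupD:
  assumes "N \<lhd> G" "comm_group (G Mod N)" "x \<in> carrier G" "y \<in> carrier G"
  shows "x \<otimes> y \<otimes> inv x \<otimes> inv y \<in> N"
proof -
  interpret h: group_hom G "G Mod N" "(#>) N" by (rule hom_rcos) fact
  interpret Q: comm_group "G Mod N" by fact
  have "N #> (x \<otimes> y) = N #> (y \<otimes> x)"
    using assms(3,4) Q.m_comm[of "N #> x" "N #> y"] by (simp del: mult_FactGroup)
  then have "(x \<otimes> y) \<otimes> inv (y \<otimes> x) \<in> N" using rcos_eq_iff assms by (simp del: h.hom_mult)
  then show ?thesis using assms(3,4) by (simp add: inv_mult_group m_assoc)
qed

text \<open>Commutativity spreads from the generators in two stages: first every coset commutes with
  the cosets of generators, then with all cosets.\<close>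

lemma (in group) comm_FactGroup_generate:
  assumes "N \<lhd> G" "S \<subseteq> carrier G" "generate G S = carrier G"
    and comm: "\<And>a b. a \<in> S \<Longrightarrow> b \<in> S \<Longrightarrow> a \<otimes> b \<otimes> inv a \<otimes> inv b \<in> N"
  shows "comm_group (G Mod N)"
proof -
  interpret h: group_hom G "G Mod N" "(#>) N" by (rule hom_rcos) fact
  let ?Q = "G Mod N" and ?h = "(#>) N"
  have img: "generate ?Q (?h ` S) = carrier ?Q"
    using h.generate_img[OF assms(2)] assms(3) by (simp add: carrier_FactGroup)
  have sub: "?h ` S \<subseteq> carrier ?Q" using assms(2) by auto
  have c1: "?h a \<otimes>\<^bsub>?Q\<^esub> ?h b = ?h b \<otimes>\<^bsub>?Q\<^esub> ?h a" if "a \<in> S" "b \<in> S" for a b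
  proof -
    have ab: "a \<in> carrier G" "b \<in> carrier G" using that assms(2) by auto
    have "(a \<otimes> b) \<otimes> inv (b \<otimes> a) \<in> N" using comm[OF that] ab by (simp add: inv_mult_group m_assoc)
    then have "?h (a \<otimes> b) = ?h (b \<otimes> a)" using rcos_eq_iff[OF assms(1)] ab by (simp del: h.hom_mult)
    then show ?thesis using h.hom_mult[of a b] h.hom_mult[of b a] ab by simp
  qed
  have c2: "x \<otimes>\<^bsub>?Q\<^esub> ?h b = ?h b \<otimes>\<^bsub>?Q\<^esub> x" if "x \<in> carrier ?Q" "b \<in> S" for x b
  proof (rule h.H.generate_commute[OF _ sub])
    show "t \<otimes>\<^bsub>?Q\<^esub> ?h b = ?h b \<otimes>\<^bsub>?Q\<^esub> t" if "t \<in> ?h ` S" for t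
      using c1 that \<open>b \<in> S\<close> by blast
  qed (use that sub img in auto)
  show ?thesis
  proof (rule h.H.group_comm_groupI)
    fix x y assume "x \<in> carrier ?Q" "y \<in> carrier ?Q"
    then have xy: "x \<in> carrier ?Q" "y \<in> carrier ?Q" .
    have "y \<otimes>\<^bsub>?Q\<^esub> x = x \<otimes>\<^bsub>?Q\<^esub> y"
    proof (rule h.H.generate_commute[OF xy(1) sub])
      show "t \<otimes>\<^bsub>?Q\<^esub> x = x \<otimes>\<^bsub>?Q\<^esub> t" if "t \<in> ?h ` S" for t
      proof -
        from that obtain b where "b \<in> S" "t = ?h b" by blast
        then show ?thesis using c2[OF xy(1)] by simp
      qed
    qed (use img xy in simp)
    then show "x \<otimes>\<^bsub>?Q\<^esub> y = y \<otimes>\<^bsub>?Q\<^esub> x" by simp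
  qed
qed

text \<open>In the abelian quotient by N the n-th power map is a homomorphism, so n-th powers fall
  into K everywhere once they do so on generators; the error made by passing to the quotient lies in
  N and hence in K.\<close>

lemma (in group) pow_mem_generate:
  assumes "N \<lhd> G" "comm_group (G Mod N)" "N \<subseteq> K" "subgroup K G"
    and "S \<subseteq> carrier G" "generate G S = carrier G"
    and "\<And>a. a \<in> S \<Longrightarrow> a [^] n \<in> K" "x \<in> carrier G"
  shows "x [^] (n::nat) \<in> K"
proof -
  interpret K: subgroup K G by fact
  interpret h: group_hom G "G Mod N" "(#>) N" by (rule hom_rcos) fact
  interpret Q: comm_group "G Mod N" by fact
  have "x \<in> generate G S" using assms by simp
  then show ?thesis
  proof induction
    case (inv h)
    then have "h \<in> carrier G" using assms(5) by auto
    then show ?case using assms(7)[OF inv] by (simp add: nat_pow_inv)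
  next
    case (eng x y)
    have xy: "x \<in> carrier G" "y \<in> carrier G" using eng generate_in_carrier[OF assms(5)] by auto
    have "N #> ((x \<otimes> y) [^] n) = N #> (x [^] n \<otimes> y [^] n)"
      using xy by (simp add: h.hom_nat_pow Q.nat_pow_distrib del: mult_FactGroup)
    then have "(x \<otimes> y) [^] n \<otimes> inv (x [^] n \<otimes> y [^] n) \<in> K"
      using rcos_eq_iff[OF assms(1)] xy assms(3) by (auto simp del: h.hom_mult)
    moreover have "x [^] n \<otimes> y [^] n \<in> K" using eng by simp
    ultimately have "(x \<otimes> y) [^] n \<otimes> inv (x [^] n \<otimes> y [^] n) \<otimes> (x [^] n \<otimes> y [^] n) \<in> K"
      by (rule K.m_closed)
    then show ?case using xy by (simp add: m_assoc)
  qed (use assms in auto)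
qed

text \<open>A finite cyclic group has only one subgroup of each order, so all elements killed by ord
  v lie in the subgroup generated by v. In exponents: with u = c^i and v = c^j, the gcd of ord c and
  j divides i, and a Bezout relation expresses i as a multiple of j modulo ord c.\<close>

lemma (in group) cyclic_pow_ord:
  assumes "cyclic_group G" "finite (carrier G)" "u \<in> carrier G" "v \<in> carrier G" "u [^] ord v = \<one>"
  shows "\<exists>k::nat. u = v [^] k"
proof -
  obtain c where c: "c \<in> carrier G" "carrier G = range (\<lambda>n::int. c [^] n)"
    using assms(1) cyclic_group by blast
  have "generate G {c} = carrier G" using generate_pow[OF c(1)] c(2) by auto
  moreover have oc: "ord c \<noteq> 0" using ord_ge_1[OF assms(2) c(1)] by simp
  ultimately have gen: "carrier G = {c [^] k | k. k \<in> (UNIV::nat set)}"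
    using generate_pow_nat[OF c(1)] by simp
  obtain i j where ij: "u = c [^] (i::nat)" "v = c [^] (j::nat)" using gen assms(3,4) by blast
  show ?thesis
  proof (cases "j = 0")
    case True
    then have "u = \<one>" using ij assms(3,5) by (simp add: nat_pow_eone)
    then show ?thesis by (intro exI[of _ 0]) simp
  next
    case False
    let ?n = "ord c" and ?g = "gcd (ord c) j"
    have "ord v = ?n div ?g" using ord_pow_gen[OF c(1)] False ij by simp
    then have "c [^] (i * (?n div ?g)) = \<one>" using assms(5) ij c(1) by (simp add: nat_pow_pow)
    then have "?n dvd i * (?n div ?g)" using pow_eq_id[OF c(1)] by simp
    then have "(?n div ?g) * ?g dvd (?n div ?g) * i" by (simp add: mult.commute)
    moreover have "0 < ?n div ?g" using oc by (simp add: div_greater_zero_iff gcd_le1_nat)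
    ultimately have "?g dvd i" using nat_mult_dvd_cancel1 by blast
    then obtain q where q: "i = ?g * q" by blast
    obtain a b where ab: "j * a = ?n * b + gcd j ?n" using bezout_nat[OF False] by blast
    have "v [^] (a * q) = c [^] (?n * (b * q) + i)"
      using c(1) ij q ab by (simp add: nat_pow_pow gcd.commute algebra_simps)
        (metis add.commute distrib_right mult.assoc mult.commute)
    also have "\<dots> = u" using c(1) ij by (simp add: nat_pow_mult[symmetric] nat_pow_pow[symmetric])
    finally show ?thesis by blast
  qed
qed

text \<open>Links cyclic quotients with the model \<open>integer_mod_group\<close> in terms of which
  \<open>gamma\<close> is defined.\<close>

lemma (in group) finite_cyclic_iso:
  assumes "cyclic_group G" "finite (carrier G)"
  shows "G \<cong> integer_mod_group (order G)"
proof -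
  obtain c where c: "c \<in> carrier G" "carrier G = range (\<lambda>n::int. c [^] n)"
    using assms(1) cyclic_group by blast
  have gc: "generate G {c} = carrier G" using generate_pow[OF c(1)] c(2) by auto
  let ?n = "order G"
  have n: "ord c = ?n" using generate_pow_card[OF c(1)] gc by (simp add: order_def)
  have n0: "0 < ?n" using assms(2) order_gt_0_iff_finite by simp
  let ?f = "\<lambda>k::int. c [^] k"
  have hom: "?f \<in> hom (integer_mod_group ?n) G"
  proof (rule homI)
    fix x y assume "x \<in> carrier (integer_mod_group ?n)" "y \<in> carrier (integer_mod_group ?n)"
    have "int ?n dvd (x + y) mod int ?n - (x + y)" by (simp add: mod_eq_dvd_iff[symmetric])
    then have "c [^] ((x + y) mod int ?n) = c [^] (x + y)"
      using int_pow_eq[OF c(1)] n by (simp add: dvd_diff_commute)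
    then show "c [^] (x \<otimes>\<^bsub>integer_mod_group ?n\<^esub> y) = c [^] x \<otimes> c [^] y"
      using c(1) by (simp add: int_pow_mult)
  qed (use c in simp)
  have inj: "inj_on ?f (carrier (integer_mod_group ?n))"
  proof (rule inj_onI)
    fix x y assume xy: "x \<in> carrier (integer_mod_group ?n)" "y \<in> carrier (integer_mod_group ?n)"
      "c [^] x = c [^] y"
    then have "x mod int ?n = y mod int ?n"
      using int_pow_eq[OF c(1)] n by (simp add: mod_eq_dvd_iff dvd_diff_commute)
    then show "x = y" using xy n0 by (simp add: carrier_integer_mod_group)
  qed
  have "?f ` carrier (integer_mod_group ?n) = carrier G"
  proof (rule card_subset_eq[OF assms(2)])
    show "?f ` carrier (integer_mod_group ?n) \<subseteq> carrier G" using c(1) by auto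
    show "card (?f ` carrier (integer_mod_group ?n)) = card (carrier G)"
      using card_image[OF inj] n0 by (simp add: carrier_integer_mod_group order_def)
  qed
  then have "?f \<in> iso (integer_mod_group ?n) G" using hom inj by (simp add: iso_def bij_betw_def)
  then show ?thesis using group.iso_sym[OF group_integer_mod_group] is_isoI by blast
qed

lemma cyclic_integer_mod_group:
  assumes "0 < n"
  shows "cyclic_group (integer_mod_group n)"
proof -
  have "carrier (integer_mod_group n) = range (\<lambda>k::int. (1 mod int n) [^]\<^bsub>integer_mod_group n\<^esub> k)"
  proof -
    have "x \<in> range (\<lambda>k. k mod int n) \<longleftrightarrow> x \<in> {0..<int n}" for x
      using assms by (auto simp: image_iff intro: exI[of _ x])
    then have "range (\<lambda>k. k mod int n) = {0..<int n}" by blast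
    then show ?thesis using assms
      by (simp add: int_pow_integer_mod_group carrier_integer_mod_group mod_mult_right_eq)
  qed
  moreover have "1 mod int n \<in> carrier (integer_mod_group n)"
    using assms by (simp add: carrier_integer_mod_group)
  ultimately show ?thesis using group.cyclic_group[OF group_integer_mod_group] by blast
qed

text \<open>The part of \<open>n\<close> prime to p. When \<open>n\<close> kills the group, raising
  an element to this exponent removes its part of order prime to p and changes its p-part only by an
  exponent invertible modulo the order of that part.\<close>

definition cofactor :: "nat \<Rightarrow> nat \<Rightarrow> nat" where
  "cofactor p n = n div p ^ multiplicity p n"

lemma cofactor:
  assumes "prime p" "0 < n"
  shows "n = cofactor p n * p ^ multiplicity p n" "\<not> p dvd cofactor p n"
proof -
  have u: "\<not> is_unit p" using assms(1) by auto
  obtain x where "n = p ^ multiplicity p n * x" "\<not> p dvd x"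
    using multiplicity_decompose'[of n p] assms u by (metis less_numeral_extra(3))
  moreover have "0 < p ^ multiplicity p n" using assms(1) by (simp add: prime_gt_0_nat)
  ultimately show "n = cofactor p n * p ^ multiplicity p n" "\<not> p dvd cofactor p n"
    unfolding cofactor_def by (metis nonzero_mult_div_cancel_left mult.commute less_numeral_extra(3))+
qed

lemma cofactor_eqI:
  assumes "prime p" "\<not> p dvd r"
  shows "cofactor p (r * p ^ v) = r"
proof -
  have "r \<noteq> 0" using assms(2) by (intro notI) simp
  then have "multiplicity p (r * p ^ v) = v"
    using assms by (simp add: prime_elem_multiplicity_mult_distrib not_dvd_imp_multiplicity_0
        prime_imp_prime_elem multiplicity_same_power prime_gt_0_nat)
  then show ?thesis using assms(1) by (simp add: cofactor_def prime_gt_0_nat)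
qed

text \<open>For a generating set \<open>S\<close> of \<open>G\<close> and a multiple \<open>n\<close> of the exponent of \<open>G\<close>, this is a criterion
  for the Sylow \<open>p\<close>-subgroups not to be normal, see \<open>nonnormal_not_dvd\<close> and \<open>central_cofactor\<close> below.\<close>

definition nonnormal :: "('a, 'b) monoid_scheme \<Rightarrow> 'a set \<Rightarrow> nat \<Rightarrow> nat \<Rightarrow> bool" where
  "nonnormal G S n p \<longleftrightarrow> prime p \<and> p dvd n \<and> (\<exists>a\<in>S. \<exists>b\<in>S.
     let x = a [^]\<^bsub>G\<^esub> cofactor p n; y = b \<otimes>\<^bsub>G\<^esub> x \<otimes>\<^bsub>G\<^esub> inv\<^bsub>G\<^esub> b in x \<otimes>\<^bsub>G\<^esub> y \<noteq> y \<otimes>\<^bsub>G\<^esub> x)"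

text \<open>An element of p-power order that is at least as large as the order of the p-part of any
  generator. Powers of p are linearly ordered by divisibility, so this comparison can be stated as
  annihilation by ord b.\<close>

definition leading :: "('a, 'b) monoid_scheme \<Rightarrow> 'a set \<Rightarrow> nat \<Rightarrow> nat \<Rightarrow> 'a \<Rightarrow> bool" where
  "leading G S n p b \<longleftrightarrow> b \<in> carrier G \<and> (\<exists>e. group.ord G b = p ^ e) \<and>
     (\<forall>a\<in>S. (a [^]\<^bsub>G\<^esub> cofactor p n) [^]\<^bsub>G\<^esub> group.ord G b = \<one>\<^bsub>G\<^esub>)"

text \<open>A relation instead of a function: leading elements for different primes need not
  commute, so the product depends on the order in which the primes turn up.\<close>

inductive leading_prod :: "('a, 'b) monoid_scheme \<Rightarrow> 'a set \<Rightarrow> nat \<Rightarrow> nat set \<Rightarrow> 'a \<Rightarrow> bool"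
  for G S n where
  empty: "leading_prod G S n {} \<one>\<^bsub>G\<^esub>"
| insert: "leading_prod G S n P w \<Longrightarrow> prime p \<Longrightarrow> p dvd n \<Longrightarrow> p \<notin> P \<Longrightarrow> leading G S n p b \<Longrightarrow>
    leading_prod G S n (insert p P) (w \<otimes>\<^bsub>G\<^esub> b)"

section \<open>Extensions of an abelian group by a cyclic group of coprime order\<close>

locale coprime_extension = group G for G (structure) +
  fixes A :: "'a set" and m :: nat
  assumes fin: "finite (carrier G)" and normal: "A \<lhd> G"
    and comm: "comm_group (G\<lparr>carrier := A\<rparr>)"
    and cyclic: "cyclic_group (G Mod A)" and index: "order (G Mod A) = m"
    and coprime: "coprime (card A) m"
begin

sublocale normal A G by (rule normal)

lemma A_comm: "x \<in> A \<Longrightarrow> y \<in> A \<Longrightarrow> x \<otimes> y = y \<otimes> x"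
  using comm_groupE(4)[OF comm] by simp

lemma fin_A: "finite A"
  using finite_subset[OF subset fin] .

lemma card_mult_index: "card A * m = card (carrier G)"
  using lagrange[OF is_subgroup] index by (simp add: order_def FactGroup_def mult.commute)

lemma index_pos: "0 < m"
proof -
  have "0 < card (carrier G)" using fin order_gt_0_iff_finite by (simp add: order_def)
  then show ?thesis using card_mult_index by (cases m) auto
qed

lemma Mod_group: "group (G Mod A)"
  by (rule factorgroup_is_group)

lemma Mod_comm: "comm_group (G Mod A)"
  using group.cyclic_imp_abelian_group[OF Mod_group] cyclic by blast

lemma fin_Mod: "finite (carrier (G Mod A))"
  using index index_pos by (metis order_def card_ge_0_finite)

lemma pow_index: "x \<in> carrier G \<Longrightarrow> x [^] m \<in> A"
proof -
  assume x: "x \<in> carrier G"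
  have "(A #> x) [^]\<^bsub>G Mod A\<^esub> m = A"
    using group.pow_order_eq_1[OF Mod_group, of "A #> x"] x index by (auto simp: carrier_FactGroup)
  then have "A #> (x [^] m) = A" using FactGroup_pow[OF x] by simp
  then show ?thesis using coset_join1[of A "x [^] m"] x is_subgroup by simp
qed

lemma pow_card: "x \<in> A \<Longrightarrow> x [^] card A = \<one>"
  using group.pow_order_eq_1[OF subgroup_is_group[OF is_group], of x]
  by (simp add: order_def nat_pow_consistent[symmetric])

lemma commutator_mem:
  "x \<in> carrier G \<Longrightarrow> y \<in> carrier G \<Longrightarrow> x \<otimes> y \<otimes> inv x \<otimes> inv y \<in> A"
  by (rule comm_FactGroupD[OF normal Mod_comm])

text \<open>If p divided |A|, it would not divide the index, so the p-element x would lie in A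
  together with its conjugates; as A is abelian, x and y would commute.\<close>

lemma nonnormal_not_dvd:
  assumes "S \<subseteq> carrier G" "0 < n" "\<And>x. x \<in> carrier G \<Longrightarrow> x [^] n = \<one>" "nonnormal G S n p"
  shows "\<not> p dvd card A"
proof
  assume dvd: "p dvd card A"
  obtain a b where ab: "a \<in> S" "b \<in> S" and p: "prime p"
    and ne: "(a [^] cofactor p n) \<otimes> (b \<otimes> (a [^] cofactor p n) \<otimes> inv b) \<noteq>
      (b \<otimes> (a [^] cofactor p n) \<otimes> inv b) \<otimes> (a [^] cofactor p n)"
    using assms(4) by (auto simp: nonnormal_def Let_def)
  let ?x = "a [^] cofactor p n"
  have car: "a \<in> carrier G" "b \<in> carrier G" using ab assms(1) by auto
  have "?x [^] (p ^ multiplicity p n) = \<one>"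
    using car assms(3)[of a] cofactor(1)[OF p assms(2)] by (simp add: nat_pow_pow)
  then have 1: "?x [^] (p ^ multiplicity p n) \<in> A" by simp
  have "\<not> p dvd m" using dvd coprime p by (metis coprime_common_divisor_nat not_prime_1)
  then have "coprime (p ^ multiplicity p n) m" using p by (simp add: prime_imp_coprime)
  then have "?x \<in> A"
    using coprime_pow_mem[OF is_subgroup _ 1 pow_index] car by simp
  moreover have "b \<otimes> ?x \<otimes> inv b \<in> A" using inv_op_closed2[OF car(2)] calculation by simp
  ultimately show False using A_comm ne by blast
qed

text \<open>The quotient of the conjugate y by x is a product of commuting elements killed by a
  power of p, so it is killed by that power. Being a commutator it also lies in A and is killed by
  |A|, which is prime to p. Hence it is trivial, x commutes with every generator, and x is
  central.\<close>

lemma central_cofactor: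
  assumes S: "S \<subseteq> carrier G" "generate G S = carrier G"
    and n: "0 < n" "\<And>x. x \<in> carrier G \<Longrightarrow> x [^] n = \<one>"
    and p: "prime p" "p dvd n" "\<not> nonnormal G S n p" "\<not> p dvd card A"
    and a: "a \<in> S" and g: "g \<in> carrier G"
  shows "(a [^] cofactor p n) \<otimes> g = g \<otimes> (a [^] cofactor p n)"
proof -
  let ?x = "a [^] cofactor p n" and ?q = "p ^ multiplicity p n"
  have x: "?x \<in> carrier G" using a S by auto
  have xq: "?x [^] ?q = \<one>"
    using a S(1) n(2)[of a] cofactor(1)[OF p(1) n(1)] by (auto simp: nat_pow_pow)
  have "b \<otimes> ?x = ?x \<otimes> b" if "b \<in> S" for b
  proof -
    have b: "b \<in> carrier G" using that S by auto
    let ?y = "b \<otimes> ?x \<otimes> inv b"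
    have xy: "?x \<otimes> ?y = ?y \<otimes> ?x" using p(1-3) a that by (auto simp: nonnormal_def Let_def)
    have y: "?y \<in> carrier G" using b x by simp
    have "?y [^] k = b \<otimes> ?x [^] k \<otimes> inv b" for k :: nat
      using b x by (induction k) (simp_all add: m_assoc, simp add: m_assoc[symmetric])
    then have yq: "?y [^] ?q = \<one>" using b xq by simp
    let ?c = "?y \<otimes> inv ?x"
    have xy': "?y \<otimes> inv ?x = inv ?x \<otimes> ?y"
    proof -
      have "inv ?x \<otimes> ?y = inv ?x \<otimes> (?y \<otimes> ?x) \<otimes> inv ?x" using x y by (simp add: m_assoc)
      also have "\<dots> = inv ?x \<otimes> (?x \<otimes> ?y) \<otimes> inv ?x" by (simp only: xy)
      also have "\<dots> = ?y \<otimes> inv ?x" using x y by (simp flip: m_assoc)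
      finally show ?thesis by simp
    qed
    have "?c [^] ?q = ?y [^] ?q \<otimes> inv ?x [^] ?q"
      by (rule pow_mult_distrib[OF xy']) (use x y in auto)
    then have "?c [^] ?q = \<one>" using xq yq x by (simp add: nat_pow_inv)
    moreover have "?c [^] card A = \<one>" using commutator_mem[OF b x] by (rule pow_card)
    moreover have "coprime ?q (card A)" using p by (simp add: prime_imp_coprime)
    ultimately have "?c \<in> {\<one>}"
      using coprime_pow_mem[OF triv_subgroup, of ?c ?q "card A"] x y by simp
    then have "?c \<otimes> ?x = ?x" using x by simp
    then have "?y = ?x" using x y by (simp add: m_assoc)
    then have "?y \<otimes> b = ?x \<otimes> b" by simp
    then show ?thesis using b x by (simp add: m_assoc)
  qed
  then have "g \<otimes> ?x = ?x \<otimes> g"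
    using generate_commute[OF x S(1)] g S(2) by blast
  then show ?thesis by simp
qed

end

lemma coprime_extensionI:
  assumes "group G" "finite (carrier G)" "0 < m" "coprime_cyclic_extension G m"
  shows "\<exists>A. coprime_extension G A m"
proof -
  obtain A where A: "A \<lhd> G" "comm_group (G\<lparr>carrier := A\<rparr>)" "G Mod A \<cong> integer_mod_group m"
    "coprime (card A) m"
    using assms(4) by (auto simp: coprime_cyclic_extension_def)
  have gr: "group (G Mod A)" by (rule normal.factorgroup_is_group) fact
  have "cyclic_group (G Mod A)"
    using isomorphic_group_cyclicity[OF A(3) gr group_integer_mod_group]
      cyclic_integer_mod_group[OF assms(3)] by simp
  moreover have "order (G Mod A) = order (integer_mod_group m)"
    using A(3) iso_same_order by (auto simp: is_iso_def)
  moreover have "order (integer_mod_group m) = m"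
    using assms(3) by (simp add: order_def carrier_integer_mod_group)
  ultimately show ?thesis
    using assms A by (auto simp: coprime_extension_def coprime_extension_axioms_def)
qed

lemma (in coprime_extension) coprime_cyclic_extension: "coprime_cyclic_extension G m"
  unfolding coprime_cyclic_extension_def
  using normal comm coprime group.finite_cyclic_iso[OF Mod_group cyclic fin_Mod] index by auto

text \<open>The image of y generates the quotient by A, whose order therefore divides ord y and
  inherits coprimality with |A|.\<close>

lemma in_class_S_imp_coprime_extension:
  assumes "in_class_S G"
  shows "\<exists>A m. coprime_extension G A m"
proof -
  obtain A y where h: "group G" "finite (carrier G)" "A \<lhd> G" "comm_group (G\<lparr>carrier := A\<rparr>)"
    "y \<in> carrier G" "coprime (group.ord G y) (card A)" "carrier G = generate G (A \<union> {y})"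
    using assms by (auto simp: in_class_S_def)
  interpret group G by fact
  interpret A: normal A G by fact
  interpret h: group_hom G "G Mod A" "(#>\<^bsub>G\<^esub>) A" by (rule hom_rcos) fact
  let ?Q = "G Mod A" and ?h = "(#>\<^bsub>G\<^esub>) A"
  have hy: "?h y \<in> carrier ?Q" using h(5) by simp
  have gen: "generate ?Q {?h y} = carrier ?Q"
    by (rule generate_FactGroup) (use h in auto)
  have "carrier ?Q = range (\<lambda>n::int. ?h y [^]\<^bsub>?Q\<^esub> n)"
    using gen h.H.generate_pow[OF hy] by (simp add: full_SetCompr_eq)
  then have cyc: "cyclic_group ?Q" using h.H.cyclic_group hy by blast
  have "order ?Q = h.H.ord (?h y)" using h.H.generate_pow_card[OF hy] gen by (simp add: order_def)
  also have "\<dots> dvd ord y"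
    using h.H.pow_eq_id[OF hy, of "ord y"] A.FactGroup_pow[OF h(5), of "ord y"] h(5)
      coset_mult_one[OF A.subset] by simp
  finally have "coprime (card A) (order ?Q)"
    using h(6) by (metis coprime_commute coprime_divisors dvd_refl)
  then have "coprime_extension G A (order ?Q)"
    using h cyc by (simp add: coprime_extension_def coprime_extension_axioms_def)
  then show ?thesis by blast
qed

lemma (in group) conj_pow:
  assumes "g \<in> carrier G" "x \<in> carrier G"
  shows "(g \<otimes> x \<otimes> inv g) [^] (n::nat) = g \<otimes> x [^] n \<otimes> inv g"
proof (induction n)
  case (Suc n)
  have "(g \<otimes> x \<otimes> inv g) [^] Suc n = g \<otimes> x [^] n \<otimes> inv g \<otimes> (g \<otimes> x \<otimes> inv g)"
    using Suc by simp
  also have "\<dots> = g \<otimes> x [^] n \<otimes> (inv g \<otimes> g) \<otimes> (x \<otimes> inv g)"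
    using assms by (simp only: m_assoc m_closed inv_closed nat_pow_closed)
  finally show ?case using assms by (simp add: m_assoc)
qed (use assms in simp)

text \<open>Powers of commuting elements multiply and conjugation respects powers. The lemma
  provides the normal subgroups used both for enlarging A and for bounding the exponent of
  G.\<close>

lemma (in group) comm_subgroup_torsion:
  assumes "H \<lhd> G" "\<And>x y. x \<in> H \<Longrightarrow> y \<in> H \<Longrightarrow> x \<otimes> y = y \<otimes> x"
  shows "{x \<in> H. x [^] (k::nat) = \<one>} \<lhd> G"
proof -
  interpret H: normal H G by fact
  have car: "x \<in> carrier G" if "x \<in> H" for x using that H.subset by blast
  have "subgroup {x \<in> H. x [^] k = \<one>} G"
  proof (rule subgroupI)
    have "\<one> \<in> {x \<in> H. x [^] k = \<one>}" by simp
    then show "{x \<in> H. x [^] k = \<one>} \<noteq> {}" by blast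
    show "inv x \<in> {x \<in> H. x [^] k = \<one>}" if "x \<in> {x \<in> H. x [^] k = \<one>}" for x
      using that car[of x] by (simp add: nat_pow_inv)
    show "x \<otimes> y \<in> {x \<in> H. x [^] k = \<one>}"
      if "x \<in> {x \<in> H. x [^] k = \<one>}" "y \<in> {x \<in> H. x [^] k = \<one>}" for x y
      using that car[of x] car[of y] pow_mult_distrib[OF assms(2), of x y k] by simp
  qed (use car in blast)
  then show ?thesis
    unfolding normal_inv_iff using H.inv_op_closed2 car by (simp add: conj_pow)
qed

section \<open>The product of A with the centre, and its torsion subgroup\<close>

context coprime_extension
begin

definition central :: "'a set" where
  "central = {c \<in> carrier G. \<forall>g\<in>carrier G. c \<otimes> g = g \<otimes> c}"

text \<open>The product A Z(G), an abelian normal subgroup. It absorbs those p-parts that A misses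
  although they could belong to an abelian kernel, since these are central.\<close>

definition extended :: "'a set" where
  "extended = {a \<otimes> c | a c. a \<in> A \<and> c \<in> central}"

lemma centralD: "c \<in> central \<Longrightarrow> c \<in> carrier G" "c \<in> central \<Longrightarrow> g \<in> carrier G \<Longrightarrow> c \<otimes> g = g \<otimes> c"
  by (auto simp: central_def)

lemma subgroup_central: "subgroup central G"
proof (rule subgroupI)
  show "central \<noteq> {}" by (auto simp: central_def)
  show "inv c \<in> central" if "c \<in> central" for c
    unfolding central_def
  proof (safe)
    fix g assume g: "g \<in> carrier G"
    have "g \<otimes> inv c = inv c \<otimes> (c \<otimes> g) \<otimes> inv c"
      using g centralD(1)[OF that] by (simp flip: m_assoc)
    also have "\<dots> = inv c \<otimes> (g \<otimes> c) \<otimes> inv c" using centralD(2)[OF that g] by simp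
    also have "\<dots> = inv c \<otimes> g" using g centralD(1)[OF that] by (simp add: m_assoc)
    finally show "inv c \<otimes> g = g \<otimes> inv c" by simp
  qed (use centralD that in auto)
  show "c \<otimes> d \<in> central" if cd: "c \<in> central" "d \<in> central" for c d
    unfolding central_def
  proof (safe)
    fix g assume g: "g \<in> carrier G"
    note car = centralD(1)[OF cd(1)] centralD(1)[OF cd(2)] g
    have "c \<otimes> d \<otimes> g = c \<otimes> (g \<otimes> d)" using car centralD(2)[OF cd(2) g] by (simp add: m_assoc)
    also have "\<dots> = (c \<otimes> g) \<otimes> d" using car by (simp add: m_assoc)
    also have "\<dots> = g \<otimes> (c \<otimes> d)" using car centralD(2)[OF cd(1) g] by (simp add: m_assoc)
    finally show "c \<otimes> d \<otimes> g = g \<otimes> (c \<otimes> d)" .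
  qed (use cd centralD in auto)
qed (use centralD in auto)

lemma A_car: "a \<in> A \<Longrightarrow> a \<in> carrier G"
  using subset by blast

lemma extended_mult:
  assumes "a \<in> A" "c \<in> central" "a' \<in> A" "c' \<in> central"
  shows "(a \<otimes> c) \<otimes> (a' \<otimes> c') = (a \<otimes> a') \<otimes> (c \<otimes> c')"
proof -
  have "(a \<otimes> c) \<otimes> (a' \<otimes> c') = a \<otimes> (c \<otimes> a') \<otimes> c'"
    using assms by (simp add: m_assoc A_car centralD(1))
  also have "\<dots> = a \<otimes> (a' \<otimes> c) \<otimes> c'" using assms centralD(2)[of c a'] A_car by simp
  also have "\<dots> = (a \<otimes> a') \<otimes> (c \<otimes> c')" using assms by (simp add: m_assoc A_car centralD(1))
  finally show ?thesis .
qed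

lemma extended_comm:
  assumes "x \<in> extended" "y \<in> extended"
  shows "x \<otimes> y = y \<otimes> x"
proof -
  obtain a c a' c' where *: "a \<in> A" "c \<in> central" "x = a \<otimes> c" "a' \<in> A" "c' \<in> central" "y = a' \<otimes> c'"
    using assms by (auto simp: extended_def)
  then show ?thesis
    using extended_mult A_comm[of a a'] centralD(2)[of c c'] centralD(1)[of c'] by simp
qed

lemma extended_normal: "extended \<lhd> G"
proof -
  interpret Z: subgroup central G by (rule subgroup_central)
  have ex: "a \<otimes> c \<in> extended" if "a \<in> A" "c \<in> central" for a c
    using that by (auto simp: extended_def)
  have "subgroup extended G"
  proof (rule subgroupI)
    show "extended \<subseteq> carrier G" using A_car centralD by (auto simp: extended_def)
    show "extended \<noteq> {}" using ex one_closed Z.one_closed by blast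
    fix x y assume x: "x \<in> extended"
    then obtain a c where ac: "a \<in> A" "c \<in> central" "x = a \<otimes> c" by (auto simp: extended_def)
    have "inv x = inv a \<otimes> inv c"
      using ac A_car centralD(1)[of c] centralD(2)[OF Z.m_inv_closed[of c], of "inv a"] by (simp add: inv_mult_group)
    then show "inv x \<in> extended" using ac ex by simp
    assume "y \<in> extended"
    then obtain a' c' where ac': "a' \<in> A" "c' \<in> central" "y = a' \<otimes> c'" by (auto simp: extended_def)
    show "x \<otimes> y \<in> extended" using extended_mult[OF ac(1,2) ac'(1,2)] ac ac' ex by simp
  qed
  moreover have "g \<otimes> x \<otimes> inv g \<in> extended" if g: "g \<in> carrier G" and x: "x \<in> extended" for g x
  proof -
    obtain a c where ac: "a \<in> A" "c \<in> central" "x = a \<otimes> c" using x by (auto simp: extended_def)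
    have "g \<otimes> x \<otimes> inv g = g \<otimes> a \<otimes> (c \<otimes> inv g)" using g ac A_car centralD by (simp add: m_assoc)
    also have "\<dots> = g \<otimes> a \<otimes> (inv g \<otimes> c)" using centralD(2)[OF ac(2), of "inv g"] g by simp
    also have "\<dots> = (g \<otimes> a \<otimes> inv g) \<otimes> c" using g ac A_car centralD by (simp add: m_assoc)
    finally show ?thesis using ex[OF inv_op_closed2[OF g ac(1)] ac(2)] by simp
  qed
  ultimately show ?thesis unfolding normal_inv_iff by blast
qed

lemma A_subset_extended: "A \<subseteq> extended"
proof
  fix a assume "a \<in> A"
  then have "a \<otimes> \<one> \<in> extended"
    unfolding extended_def using subgroup.one_closed[OF subgroup_central] by blast
  then show "a \<in> extended" using \<open>a \<in> A\<close> A_car by simp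
qed

lemma central_subset_extended: "central \<subseteq> extended"
proof
  fix c assume "c \<in> central"
  then have "\<one> \<otimes> c \<in> extended" unfolding extended_def using one_closed by blast
  then show "c \<in> extended" using \<open>c \<in> central\<close> centralD(1) by simp
qed

lemma cyclic_generator:
  "\<exists>c\<in>carrier G. \<forall>x\<in>carrier G. \<exists>i::int. x \<otimes> inv (c [^] i) \<in> A"
proof -
  obtain C where C: "C \<in> carrier (G Mod A)" "carrier (G Mod A) = range (\<lambda>i::int. C [^]\<^bsub>G Mod A\<^esub> i)"
    using cyclic group.cyclic_group[OF Mod_group] by blast
  obtain c where c: "c \<in> carrier G" "C = A #> c" using C(1) by (auto simp: carrier_FactGroup)
  have "\<exists>i::int. x \<otimes> inv (c [^] i) \<in> A" if x: "x \<in> carrier G" for x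
  proof -
    have "A #> x \<in> carrier (G Mod A)" using x by (auto simp: carrier_FactGroup)
    then obtain i :: int where "A #> x = C [^]\<^bsub>G Mod A\<^esub> i" using C(2) by auto
    then have "A #> x = A #> (c [^] i)" using FactGroup_int_pow[OF c(1)] c(2) by simp
    then show ?thesis using rcos_eq_iff[OF normal x] c(1) by blast
  qed
  then show ?thesis using c(1) by blast
qed

text \<open>Passing from \<open>A\<close> to this Hall subgroup of \<open>extended\<close> removes the central part of the complement.\<close>

lemma coprime_extension_torsion:
  assumes S: "S \<subseteq> carrier G" "generate G S = carrier G"
    and kl: "0 < k * l" "\<And>x. x \<in> carrier G \<Longrightarrow> x [^] (k * l) = \<one>" "coprime k l"
    and primes: "\<And>p. prime p \<Longrightarrow> p dvd l \<longleftrightarrow> nonnormal G S (k * l) p"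
  defines "B \<equiv> {x \<in> extended. x [^] k = \<one>}"
  shows "coprime_extension G B (order (G Mod B))" "A \<subseteq> B" "\<And>x. x \<in> carrier G \<Longrightarrow> x [^] l \<in> B"
    "order (G Mod B) dvd l"
proof -
  have B: "B \<lhd> G" unfolding B_def by (rule comm_subgroup_torsion[OF extended_normal extended_comm])
  interpret B: normal B G by fact
  interpret hB: group_hom G "G Mod B" "(#>) B" by (rule hom_rcos) fact
  interpret E: normal extended G by (rule extended_normal)
  \<comment> \<open>An element of A is killed by |A|, and no prime of l divides |A|; so the factor l
    may be dropped from the exponent k l.\<close>
  have torsion: "x [^] k = \<one>" if "x \<in> A" for x
  proof -
    have "x [^] k \<in> {\<one>}"
    proof (rule pow_mem_cofactor[OF triv_subgroup])
      fix p :: nat assume "prime p" "p dvd l"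
      then have "\<not> p dvd card A" using nonnormal_not_dvd[OF S(1) kl(1,2)] primes by blast
      then show "\<exists>j. x [^] j \<in> {\<one>} \<and> \<not> p dvd j" using pow_card[OF that] by blast
    qed (use kl that A_car in auto)
    then show ?thesis by simp
  qed
  show AB: "A \<subseteq> B" using torsion A_subset_extended by (auto simp: B_def)
  \<comment> \<open>Checked at each prime p of k. If p divides |A|, it does not divide the index, so
    the p-part of a lies in A. Otherwise the p-part is central by
    \<open>central_cofactor\<close>.\<close>
  have gen_ext: "a [^] l \<in> extended" if a: "a \<in> S" for a
  proof (rule pow_mem_cofactor[OF E.is_subgroup])
    show "a \<in> carrier G" using a S by blast
    then show "a [^] (l * k) \<in> extended" using kl(2)[of a] by (simp add: mult.commute)
    fix p :: nat assume p: "prime p" "p dvd k"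
    have nl: "\<not> p dvd l" using p kl(3) by (metis coprime_common_divisor_nat not_prime_1)
    have pn: "p dvd k * l" "\<not> nonnormal G S (k * l) p" using p nl primes by auto
    have "a [^] cofactor p (k * l) \<in> extended"
    proof (cases "p dvd card A")
      case True
      let ?x = "a [^] cofactor p (k * l)" and ?q = "p ^ multiplicity p (k * l)"
      have "?x [^] ?q = \<one>"
        using \<open>a \<in> carrier G\<close> kl(2)[of a] cofactor(1)[OF p(1) kl(1)] by (simp add: nat_pow_pow)
      moreover have "\<not> p dvd m" using True coprime p by (metis coprime_common_divisor_nat not_prime_1)
      then have "coprime ?q m" using p by (simp add: prime_imp_coprime)
      ultimately have "?x \<in> A"
        using coprime_pow_mem[OF is_subgroup, of ?x ?q m] pow_index \<open>a \<in> carrier G\<close> by simp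
      then show ?thesis using A_subset_extended by blast
    next
      case False
      then have "a [^] cofactor p (k * l) \<in> central"
        using central_cofactor[OF S kl(1,2) p(1) pn False a] \<open>a \<in> carrier G\<close> by (simp add: central_def)
      then show ?thesis using central_subset_extended by blast
    qed
    then show "\<exists>j. a [^] j \<in> extended \<and> \<not> p dvd j" using cofactor(2)[OF p(1) kl(1)] by blast
  qed (use kl in \<open>simp add: mult.commute\<close>)
  have commB: "comm_group (G Mod B)"
    using comm_FactGroup_generate[OF B S] commutator_mem AB S(1) by blast
  show pow_l: "x [^] l \<in> B" if "x \<in> carrier G" for x
  proof (rule pow_mem_generate[OF B commB order_refl B.is_subgroup S _ that])
    fix a assume a: "a \<in> S"
    then have "(a [^] l) [^] k = \<one>" using S(1) kl(2)[of a] by (auto simp: nat_pow_pow mult.commute)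
    then show "a [^] l \<in> B" using gen_ext[OF a] by (simp add: B_def)
  qed
  \<comment> \<open>B contains A, so an element whose coset generates the quotient by A also
    generates the quotient by B.\<close>
  obtain c where c: "c \<in> carrier G" "\<And>x. x \<in> carrier G \<Longrightarrow> \<exists>i::int. x \<otimes> inv (c [^] i) \<in> A"
    using cyclic_generator by blast
  have car: "carrier (G Mod B) = range (\<lambda>i::int. (B #> c) [^]\<^bsub>G Mod B\<^esub> i)"
  proof -
    have "B #> x \<in> range (\<lambda>i::int. (B #> c) [^]\<^bsub>G Mod B\<^esub> i)" if x: "x \<in> carrier G" for x
    proof -
      obtain i :: int where "x \<otimes> inv (c [^] i) \<in> A" using c(2)[OF x] by blast
      then have "B #> x = B #> (c [^] i)" using rcos_eq_iff[OF B x, of "c [^] i"] AB c(1) by blast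
      then show ?thesis using B.FactGroup_int_pow[OF c(1)] by simp
    qed
    then show ?thesis using c(1) by (auto simp: carrier_FactGroup B.FactGroup_int_pow)
  qed
  have cycB: "cyclic_group (G Mod B)"
    using hB.H.cyclic_group car c(1) by (metis hB.hom_closed)
  have hc: "B #> c \<in> carrier (G Mod B)" using c(1) by simp
  have "generate (G Mod B) {B #> c} = carrier (G Mod B)"
    using hB.H.generate_pow[OF hc] car by (simp add: full_SetCompr_eq)
  then have "order (G Mod B) = hB.H.ord (B #> c)"
    using hB.H.generate_pow_card[OF hc] by (simp add: order_def)
  moreover have "(B #> c) [^]\<^bsub>G Mod B\<^esub> l = \<one>\<^bsub>G Mod B\<^esub>"
    using B.FactGroup_pow[OF c(1)] pow_l[OF c(1)] coset_join2[of "c [^] l" B] c(1) B.is_subgroup by simp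
  ultimately show ord: "order (G Mod B) dvd l" using hB.H.pow_eq_id[OF hc] by simp
  have finB: "finite B" using finite_subset[OF B.subset fin] .
  \<comment> \<open>A common prime p would give an element of order p in B, by Sylow with exponent
    1. Every element of B is killed by k, but p divides l and hence not k.\<close>
  have "coprime (card B) (order (G Mod B))"
  proof (rule coprime_if_no_common_prime, rule notI)
    fix p assume p: "prime p" "p dvd order (G Mod B)" "p dvd card B"
    then obtain q where q: "card B = p ^ 1 * q" by auto
    let ?B = "G\<lparr>carrier := B\<rparr>"
    have grB: "group ?B" by (rule B.subgroup_is_group[OF is_group])
    obtain P where P: "subgroup P ?B" "card P = p ^ 1"
      using sylow_thm[OF p(1) grB, of 1 q] q finB by (auto simp: order_def)
    have "1 < card P" using P prime_gt_1_nat[OF p(1)] by simp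
    then have "\<not> P \<subseteq> {\<one>}" using card_mono[of "{\<one>}" P] by auto
    then obtain x where x: "x \<in> P" "x \<noteq> \<one>" by blast
    have xB: "x \<in> B" using x P(1) subgroup.subset[OF P(1)] by auto
    have "x [^]\<^bsub>?B\<lparr>carrier := P\<rparr>\<^esub> p = \<one>\<^bsub>?B\<lparr>carrier := P\<rparr>\<^esub>"
      using group.pow_order_eq_1[OF subgroup.subgroup_is_group[OF P(1) grB], of x] x P(2)
      by (simp add: order_def)
    then have xp: "x [^] p = \<one>" by (simp add: nat_pow_consistent[symmetric])
    have "\<not> p dvd k" using kl(3) p ord by (metis coprime_common_divisor_nat dvd_trans not_prime_1)
    then have "coprime p k" using p by (simp add: prime_imp_coprime)
    then have "x \<in> {\<one>}"
      using coprime_pow_mem[OF triv_subgroup, of x p k] xp xB B.subset by (auto simp: B_def)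
    then show False using x by simp
  qed
  moreover have "comm_group (G\<lparr>carrier := B\<rparr>)"
    using group.group_comm_groupI[OF B.subgroup_is_group[OF is_group]] extended_comm
    by (simp add: B_def)
  ultimately show "coprime_extension G B (order (G Mod B))"
    using fin B cycB is_group by (simp add: coprime_extension_def coprime_extension_axioms_def)
qed

end

section \<open>The exponent of G, the cyclic complement and generators of the kernel\<close>

context coprime_extension
begin

text \<open>The elements of A killed by n' form a normal subgroup that contains all commutators of
  generators. Modulo it G is abelian, so x^n falls into it for every x.\<close>

lemma exponent_multiple:
  assumes S: "S \<subseteq> carrier G" "generate G S = carrier G"
    and "\<And>a. a \<in> S \<Longrightarrow> a [^] (n::nat) = \<one>"
    and "\<And>a b. a \<in> S \<Longrightarrow> b \<in> S \<Longrightarrow> (a \<otimes> b \<otimes> inv a \<otimes> inv b) [^] n' = \<one>"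
    and x: "x \<in> carrier G"
  shows "x [^] (n * n') = \<one>"
proof -
  let ?C = "{x \<in> A. x [^] n' = \<one>}"
  have C: "?C \<lhd> G" by (rule comm_subgroup_torsion[OF normal A_comm])
  have "comm_group (G Mod ?C)"
    by (rule comm_FactGroup_generate[OF C S]) (use assms commutator_mem in blast)
  then have "x [^] n \<in> ?C"
    using pow_mem_generate[OF C _ order_refl normal_imp_subgroup[OF C] S _ x]
      subgroup.one_closed[OF normal_imp_subgroup[OF C]] assms(3) by simp
  then show ?thesis using x by (simp add: nat_pow_pow)
qed

lemma rcos_pow_mult:
  assumes "x \<in> carrier G" "y \<in> carrier G"
  shows "A #> ((x \<otimes> y) [^] (r::nat)) = (A #> (x [^] r)) \<otimes>\<^bsub>G Mod A\<^esub> (A #> (y [^] r))"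
proof -
  interpret h: group_hom G "G Mod A" "(#>) A" by (rule hom_rcos[OF normal])
  interpret Q: comm_group "G Mod A" by (rule Mod_comm)
  show ?thesis
    using assms by (simp add: h.hom_nat_pow Q.nat_pow_distrib del: mult_FactGroup)
qed

text \<open>In the abelian quotient powers distribute over the product, and a factor of p-power
  order is killed by \<open>cofactor q n\<close> for every other prime q. The exponent
  \<open>cofactor p n\<close> thus isolates the one factor that belongs to p.\<close>

lemma leading_prod_rcos:
  assumes n: "0 < n" "\<And>x. x \<in> carrier G \<Longrightarrow> x [^] n = \<one>"
    and "leading_prod G S n P w"
  shows "w \<in> carrier G \<and>
    (\<forall>q. prime q \<longrightarrow> q dvd n \<longrightarrow> q \<notin> P \<longrightarrow> A #> (w [^] cofactor q n) = \<one>\<^bsub>G Mod A\<^esub>) \<and>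
    (\<forall>p\<in>P. \<exists>b. leading G S n p b \<and> A #> (w [^] cofactor p n) = A #> (b [^] cofactor p n))"
  using assms(3)
proof induction
  case empty
  then show ?case by (simp add: coset_mult_one[OF subset])
next
  case (insert P w p b)
  interpret h: group_hom G "G Mod A" "(#>) A" by (rule hom_rcos[OF normal])
  have w: "w \<in> carrier G" and b: "b \<in> carrier G" using insert by (auto simp: leading_def)
  obtain e where e: "ord b = p ^ e" using insert(5) by (auto simp: leading_def)
  have kill: "b [^] cofactor q n = \<one>" if q: "prime q" "q \<noteq> p" for q
  proof -
    have "p ^ e dvd cofactor q n * q ^ multiplicity q n"
      using cofactor(1)[OF q(1) n(1)] pow_eq_id[OF b, of n] n(2)[OF b] e by simp
    moreover have "coprime (p ^ e) (q ^ multiplicity q n)"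
      using q insert(2) by (simp add: primes_coprime)
    ultimately show ?thesis using pow_eq_id[OF b] e by (simp add: coprime_dvd_mult_left_iff)
  qed
  note mult = rcos_pow_mult[OF w b]
  have 1: "A #> ((w \<otimes> b) [^] cofactor q n) = A #> (w [^] cofactor q n)" if "prime q" "q \<noteq> p" for q
    using mult[of "cofactor q n"] kill[OF that] w h.H.r_one[of "A #> (w [^] cofactor q n)"]
    by (simp add: coset_mult_one[OF subset] del: mult_FactGroup)
  have 2: "A #> ((w \<otimes> b) [^] cofactor p n) = A #> (b [^] cofactor p n)"
    using mult[of "cofactor p n"] insert b h.H.l_one[of "A #> (b [^] cofactor p n)"]
    by (simp del: mult_FactGroup one_FactGroup)
  show ?case
  proof (intro conjI allI impI ballI)
    show "w \<otimes> b \<in> carrier G" using w b by simp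
  next
    fix q assume "prime q" "q dvd n" "q \<notin> insert p P"
    then show "A #> ((w \<otimes> b) [^] cofactor q n) = \<one>\<^bsub>G Mod A\<^esub>" using 1[of q] insert by simp
  next
    fix q assume q: "q \<in> insert p P"
    show "\<exists>c. leading G S n q c \<and> A #> ((w \<otimes> b) [^] cofactor q n) = A #> (c [^] cofactor q n)"
    proof (cases "q = p")
      case True
      then show ?thesis using 2 insert by blast
    next
      case False
      then have "q \<in> P" using q by simp
      moreover have "prime q" using insert(1) \<open>q \<in> P\<close> by (induction rule: leading_prod.induct) auto
      ultimately show ?thesis using 1[of q] False insert by auto
    qed
  qed
qed

text \<open>A subgroup containing \<open>A\<close> and the \<open>k\<close>-th power of the product \<open>w\<close> contains the leading
  elements; as \<open>G Mod A\<close> is cyclic, it then contains the \<open>p\<close>-part of every generator.\<close>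

lemma generate_leading_prod:
  assumes S: "S \<subseteq> carrier G" "generate G S = carrier G"
    and kl: "0 < k * l" "\<And>x. x \<in> carrier G \<Longrightarrow> x [^] (k * l) = \<one>" "coprime k l"
    and A: "\<And>x. x \<in> A \<Longrightarrow> x [^] k = \<one>" "\<And>a. a \<in> S \<Longrightarrow> a [^] l \<in> A"
    and w: "leading_prod G S (k * l) {p. prime p \<and> p dvd l} w"
  shows "generate G (A \<union> {w [^] k}) = carrier G"
proof -
  interpret h: group_hom G "G Mod A" "(#>) A" by (rule hom_rcos[OF normal])
  let ?n = "k * l" and ?C = "generate G (A \<union> {w [^] k})"
  have wc: "w \<in> carrier G"
    and lead: "\<And>p. prime p \<Longrightarrow> p dvd l \<Longrightarrow> \<exists>b. leading G S ?n p b \<and>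
      A #> (w [^] cofactor p ?n) = A #> (b [^] cofactor p ?n)"
    using leading_prod_rcos[OF kl(1,2) w] by auto
  have C: "subgroup ?C G" using subset wc by (intro generate_is_subgroup) auto
  then interpret C: subgroup ?C G .
  have AC: "A \<subseteq> ?C" and zC: "w [^] k \<in> ?C" by (auto intro: generate.incl)
  have "S \<subseteq> ?C"
  proof
    fix a assume a: "a \<in> S"
    then have ac: "a \<in> carrier G" using S by blast
    \<comment> \<open>With first factor 1 the cofactor lemma becomes a local criterion: a lies in C
      if for each prime p of l some power of a with exponent prime to p does.\<close>
    have "a [^] (1::nat) \<in> ?C"
    proof (rule pow_mem_cofactor[OF C ac])
      show "0 < 1 * l" using kl(1) by simp
      show "a [^] (1 * l) \<in> ?C" using A(2)[OF a] AC by auto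
      fix p :: nat assume p: "prime p" "p dvd l"
      let ?r = "cofactor p ?n"
      obtain b where b: "leading G S ?n p b" "A #> (w [^] ?r) = A #> (b [^] ?r)"
        using lead[OF p] by blast
      obtain e where e: "ord b = p ^ e" using b(1) by (auto simp: leading_def)
      have bc: "b \<in> carrier G" using b by (simp add: leading_def)
      have pk: "\<not> p dvd k" using kl(3) p by (metis coprime_common_divisor_nat not_prime_1)
      have pr: "\<not> p dvd ?r" using cofactor(2)[OF p(1) kl(1)] .
      \<comment> \<open>Modulo A, which is contained in C, the powers of w and b with exponent r
        agree. Hence b^(r k) lies in C, and r k is prime to p while b has p-power order.\<close>
      have bC: "b \<in> ?C"
      proof (rule coprime_pow_mem[OF C bc])
        have "A #> ((w [^] ?r) [^] k) = A #> ((b [^] ?r) [^] k)"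
          using FactGroup_pow[of "w [^] ?r" k] FactGroup_pow[of "b [^] ?r" k] b(2) wc bc by simp
        then have "(w [^] ?r) [^] k \<otimes> inv ((b [^] ?r) [^] k) \<in> ?C"
          using rcos_eq_iff[OF normal] wc bc AC by auto
        moreover have "(w [^] ?r) [^] k \<in> ?C"
          using subgroup_nat_pow_closed[OF C zC, of ?r] wc by (simp add: nat_pow_pow mult.commute)
        ultimately have "inv ((w [^] ?r) [^] k) \<otimes> ((w [^] ?r) [^] k \<otimes> inv ((b [^] ?r) [^] k)) \<in> ?C"
          by (blast intro: C.m_closed C.m_inv_closed)
        then have "inv ((b [^] ?r) [^] k) \<in> ?C" using wc bc by (simp flip: m_assoc)
        then have "inv (inv ((b [^] ?r) [^] k)) \<in> ?C" by (rule C.m_inv_closed)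
        then show "b [^] (?r * k) \<in> ?C" using bc by (simp add: nat_pow_pow)
        show "b [^] (p ^ e) \<in> ?C" using pow_ord_eq_1[OF bc] e C.one_closed by simp
        show "coprime (?r * k) (p ^ e)"
          using pk pr p by (simp add: prime_imp_coprime coprime_commute[of _ p])
      qed
      let ?u = "A #> (a [^] ?r)" and ?v = "A #> b"
      have uv: "?u \<in> carrier (G Mod A)" "?v \<in> carrier (G Mod A)" using ac bc by auto
      \<comment> \<open>The order of b does not shrink in the quotient: A is killed by k, which is
        prime to p.\<close>
      have dvd_v: "ord b dvd h.H.ord ?v"
      proof -
        have "?v [^]\<^bsub>G Mod A\<^esub> h.H.ord ?v = \<one>\<^bsub>G Mod A\<^esub>" using uv by simp
        then have "A #> (b [^] h.H.ord ?v) = A" using FactGroup_pow[OF bc] by simp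
        then have "b [^] h.H.ord ?v \<in> A" using coset_join1[of A "b [^] h.H.ord ?v"] bc is_subgroup by simp
        then have "b [^] (h.H.ord ?v * k) = \<one>" using A(1) bc by (simp add: nat_pow_pow[symmetric])
        then have "p ^ e dvd h.H.ord ?v * k" using pow_eq_id[OF bc] e by simp
        moreover have "coprime (p ^ e) k" using pk p by (simp add: prime_imp_coprime)
        ultimately show ?thesis using e by (simp add: coprime_dvd_mult_left_iff)
      qed
      have "?u [^]\<^bsub>G Mod A\<^esub> ord b = \<one>\<^bsub>G Mod A\<^esub>"
        using FactGroup_pow[of "a [^] ?r" "ord b"] b(1) a ac
        by (simp add: leading_def coset_mult_one[OF subset])
      then have "h.H.ord ?u dvd ord b" using h.H.pow_eq_id[OF uv(1)] by (simp del: one_FactGroup)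
      then have "h.H.ord ?u dvd h.H.ord ?v" using dvd_v by (rule dvd_trans)
      then have "?u [^]\<^bsub>G Mod A\<^esub> h.H.ord ?v = \<one>\<^bsub>G Mod A\<^esub>"
        using h.H.pow_eq_id[OF uv(1)] by (simp del: one_FactGroup)
      \<comment> \<open>The order of u divides that of v, and in a cyclic group this puts u into the
        subgroup generated by v. Here cyclicity of the quotient is decisive.\<close>
      then obtain i :: nat where "?u = ?v [^]\<^bsub>G Mod A\<^esub> i"
        using group.cyclic_pow_ord[OF Mod_group cyclic fin_Mod uv] by blast
      then have "?u = A #> (b [^] i)" using FactGroup_pow[OF bc] by simp
      then have "a [^] ?r \<otimes> inv (b [^] i) \<in> ?C" using rcos_eq_iff[OF normal] ac bc AC by auto
      then have "a [^] ?r \<otimes> inv (b [^] i) \<otimes> b [^] i \<in> ?C"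
        by (rule C.m_closed[OF _ subgroup_nat_pow_closed[OF C bC]])
      then have "a [^] ?r \<in> ?C" using ac bc by (simp add: m_assoc)
      then show "\<exists>j. a [^] j \<in> ?C \<and> \<not> p dvd j" using pr by blast
    qed
    then show "a \<in> ?C" using ac by simp
  qed
  then have "generate G S \<subseteq> ?C" by (rule generate_subgroup_incl[OF _ C])
  then show ?thesis using S(2) C.subset by auto
qed

text \<open>The power z^m lies in A and so is killed by k; it is also killed by l, so it is trivial.
  Thus z has the same order as its coset, which makes the group generated by z a complement of
  A.\<close>

lemma decomposition_generate:
  assumes z: "z \<in> carrier G" "generate G (A \<union> {z}) = carrier G"
    and kl: "coprime k l" "\<And>x. x \<in> A \<Longrightarrow> x [^] k = \<one>" "z [^] (l::nat) = \<one>"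
  shows "(A, generate G {z}) \<in> decompositions G m" "ord z = m"
    "\<And>x. x \<in> carrier G \<Longrightarrow> \<exists>j::nat. x \<otimes> inv (z [^] j) \<in> A"
proof -
  interpret h: group_hom G "G Mod A" "(#>) A" by (rule hom_rcos[OF normal])
  let ?Q = "G Mod A" and ?z = "A #> z"
  have hz: "?z \<in> carrier ?Q" using z by simp
  have gen: "generate ?Q {?z} = carrier ?Q" by (rule generate_FactGroup[OF normal z])
  have m: "h.H.ord ?z = m" using h.H.generate_pow_card[OF hz] gen index by (simp add: order_def)
  show ord: "ord z = m"
  proof (rule dvd_antisym)
    have "z [^] m \<in> {\<one>}"
    proof (rule coprime_pow_mem[OF triv_subgroup])
      have "(z [^] m) [^] l = (z [^] l) [^] m" using z(1) by (simp add: nat_pow_pow mult.commute)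
      then show "(z [^] m) [^] l \<in> {\<one>}" using kl(3) by simp
      show "coprime l k" using kl(1) by (simp add: coprime_commute)
    qed (use z kl pow_index in auto)
    then show "ord z dvd m" using pow_eq_id[OF z(1)] by simp
    have "?z [^]\<^bsub>?Q\<^esub> ord z = \<one>\<^bsub>?Q\<^esub>"
      using FactGroup_pow[OF z(1), of "ord z"] z(1) by (simp add: coset_mult_one[OF subset])
    then show "m dvd ord z" using h.H.pow_eq_id[OF hz] m by simp
  qed
  show ex: "\<exists>j::nat. x \<otimes> inv (z [^] j) \<in> A" if x: "x \<in> carrier G" for x
  proof -
    have "A #> x \<in> generate ?Q {?z}" using gen x by simp
    moreover have "h.H.ord ?z \<noteq> 0" using m index_pos by simp
    ultimately obtain j :: nat where "A #> x = ?z [^]\<^bsub>?Q\<^esub> j"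
      using h.H.generate_pow_nat[OF hz] by blast
    then have "A #> x = A #> (z [^] j)" using FactGroup_pow[OF z(1)] by simp
    then show ?thesis using rcos_eq_iff[OF normal x] z(1) by blast
  qed
  let ?B = "generate G {z}"
  have B: "subgroup ?B G" using z(1) by (intro generate_is_subgroup) simp
  have "carrier G = A <#> ?B"
  proof
    show "carrier G \<subseteq> A <#> ?B"
    proof
      fix x assume x: "x \<in> carrier G"
      obtain j :: nat where j: "x \<otimes> inv (z [^] j) \<in> A" using ex[OF x] by blast
      have "z [^] j \<in> ?B" using subgroup_nat_pow_closed[OF B] by (simp add: generate.incl)
      moreover have "x = x \<otimes> inv (z [^] j) \<otimes> z [^] j" using x z(1) by (simp add: m_assoc)
      ultimately show "x \<in> A <#> ?B" using j unfolding set_mult_def by blast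
    qed
    show "A <#> ?B \<subseteq> carrier G" using setmult_subset_G subset subgroup.subset[OF B] by blast
  qed
  moreover have "cyclic_group (G\<lparr>carrier := ?B\<rparr>)"
  proof -
    have "carrier (G\<lparr>carrier := ?B\<rparr>) = range (\<lambda>i::int. z [^]\<^bsub>G\<lparr>carrier := ?B\<rparr>\<^esub> i)"
      using generate_pow[OF z(1)] int_pow_consistent[OF B, of z]
      by (simp add: generate.incl full_SetCompr_eq)
    moreover have "z \<in> carrier (G\<lparr>carrier := ?B\<rparr>)" by (simp add: generate.incl)
    ultimately show ?thesis
      using group.cyclic_group[OF subgroup.subgroup_is_group[OF B is_group]] by blast
  qed
  moreover have "card ?B = m" using generate_pow_card[OF z(1)] ord by simp
  ultimately show "(A, ?B) \<in> decompositions G m"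
    using normal comm coprime B by (simp add: decompositions_def)
qed

text \<open>Modulo the subgroup generated by the conjugates of the commutators, \<open>G\<close> is abelian; this is why
  no discrete logarithms are needed for finding generators of \<open>A\<close>.\<close>

lemma generate_powers_commutators:
  assumes S: "S \<subseteq> carrier G" "generate G S = carrier G"
    and kl: "coprime k l" "\<And>x. x \<in> A \<Longrightarrow> x [^] (k::nat) = \<one>" "\<And>a. a \<in> S \<Longrightarrow> a [^] (l::nat) \<in> A"
    and z: "z \<in> carrier G" "\<And>x. x \<in> carrier G \<Longrightarrow> \<exists>j::nat. x \<otimes> inv (z [^] j) \<in> A"
    and M: "M = {a [^] l | a. a \<in> S} \<union>
      {z [^] (j::nat) \<otimes> (a \<otimes> b \<otimes> inv a \<otimes> inv b) \<otimes> inv (z [^] j) | a b j. a \<in> S \<and> b \<in> S}"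
  shows "generate G M = A"
proof -
  define T where "T = {z [^] (j::nat) \<otimes> (a \<otimes> b \<otimes> inv a \<otimes> inv b) \<otimes> inv (z [^] j) | a b j. a \<in> S \<and> b \<in> S}"
  have TA: "T \<subseteq> A"
  proof
    fix x assume "x \<in> T"
    then obtain a b j where x: "a \<in> S" "b \<in> S"
      "x = z [^] (j::nat) \<otimes> (a \<otimes> b \<otimes> inv a \<otimes> inv b) \<otimes> inv (z [^] j)" by (auto simp: T_def)
    have "a \<otimes> b \<otimes> inv a \<otimes> inv b \<in> A" using x S(1) by (intro commutator_mem) auto
    then show "x \<in> A" unfolding x(3) using z(1) by (intro inv_op_closed2) simp_all
  qed
  have MA: "M \<subseteq> A" using TA kl(3) by (auto simp: M T_def)
  have T: "T \<subseteq> carrier G" and Mc: "M \<subseteq> carrier G" using TA MA subset by auto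
  let ?N = "generate G T" and ?K = "generate G M"
  have N: "subgroup ?N G" and K: "subgroup ?K G" using T Mc by (auto intro: generate_is_subgroup)
  interpret N: subgroup ?N G by (rule N)
  interpret K: subgroup ?K G by (rule K)
  have NA: "?N \<subseteq> A" by (rule generate_subgroup_incl[OF TA is_subgroup])
  have NK: "?N \<subseteq> ?K" by (rule mono_generate) (auto simp: M T_def)
  have conj_T: "z [^] i \<otimes> x \<otimes> inv (z [^] i) \<in> T" if xT: "x \<in> T" for x and i :: nat
  proof -
    obtain a b j where x: "a \<in> S" "b \<in> S"
      "x = z [^] (j::nat) \<otimes> (a \<otimes> b \<otimes> inv a \<otimes> inv b) \<otimes> inv (z [^] j)"
      using xT by (auto simp: T_def)
    have ab: "a \<in> carrier G" "b \<in> carrier G" using x S(1) by auto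
    have "z [^] i \<otimes> x \<otimes> inv (z [^] i) =
        z [^] (i + j) \<otimes> (a \<otimes> b \<otimes> inv a \<otimes> inv b) \<otimes> inv (z [^] (i + j))"
      using z(1) ab by (simp add: x(3) nat_pow_mult[symmetric] inv_mult_group m_assoc)
    then show ?thesis using x(1,2) by (auto simp: T_def)
  qed
  have conj_z: "z [^] i \<otimes> x \<otimes> inv (z [^] i) \<in> ?N" if "x \<in> ?N" for x and i :: nat
    using that
  proof induction
    case one
    then show ?case using z(1) N.one_closed by simp
  next
    case (incl x)
    show ?case by (rule generate.incl[OF conj_T[OF incl]])
  next
    case (inv x)
    have x: "x \<in> carrier G" using inv T by auto
    have "inv (z [^] i \<otimes> x \<otimes> inv (z [^] i)) \<in> ?N" using conj_T[OF inv] by (rule generate.inv)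
    then show ?case using x z(1) by (simp add: inv_mult_group m_assoc)
  next
    case (eng x y)
    have xy: "x \<in> carrier G" "y \<in> carrier G" using eng N.subset by auto
    have "z [^] i \<otimes> (x \<otimes> y) \<otimes> inv (z [^] i) =
        z [^] i \<otimes> x \<otimes> (inv (z [^] i) \<otimes> z [^] i) \<otimes> y \<otimes> inv (z [^] i)"
      using xy z(1) by (simp add: m_assoc)
    also have "\<dots> = (z [^] i \<otimes> x \<otimes> inv (z [^] i)) \<otimes> (z [^] i \<otimes> y \<otimes> inv (z [^] i))"
      using xy z(1) by (simp only: m_assoc group.inv_closed monoid.nat_pow_closed is_group monoid_axioms monoid.m_closed)
    finally show ?case using eng by simp
  qed
  \<comment> \<open>Write g as an element of A times z^i. Conjugation by z^i preserves N because T
    is closed under it, and the factor from A acts trivially since N lies in the abelian group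
    A.\<close>
  have "?N \<lhd> G"
    unfolding normal_inv_iff
  proof (intro conjI N ballI)
    fix g x assume g: "g \<in> carrier G" and x: "x \<in> ?N"
    obtain i :: nat where i: "g \<otimes> inv (z [^] i) \<in> A" using z(2)[OF g] by blast
    let ?a = "g \<otimes> inv (z [^] i)" and ?y = "z [^] i \<otimes> x \<otimes> inv (z [^] i)"
    have xc: "x \<in> carrier G" using x N.subset by auto
    have yN: "?y \<in> ?N" using conj_z[OF x] .
    have yc: "?y \<in> carrier G" using xc z(1) by simp
    have ga: "g = ?a \<otimes> z [^] i" using g z(1) by (simp add: m_assoc)
    have cancel: "inv (z [^] i) \<otimes> (z [^] i \<otimes> y) = y" if "y \<in> carrier G" for y
      using that z(1) by (simp flip: m_assoc)
    have "g \<otimes> x \<otimes> inv g = ?a \<otimes> z [^] i \<otimes> x \<otimes> inv (?a \<otimes> z [^] i)" using ga by simp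
    also have "\<dots> = ?a \<otimes> ?y \<otimes> inv ?a"
      using g z(1) xc by (simp add: inv_mult_group m_assoc cancel)
    also have "\<dots> = ?y \<otimes> ?a \<otimes> inv ?a" using A_comm[OF i, of ?y] yN NA by auto
    also have "\<dots> = ?y" using g z(1) yc by (simp add: m_assoc)
    finally show "g \<otimes> x \<otimes> inv g \<in> ?N" using yN by simp
  qed
  moreover have "comm_group (G Mod ?N)"
  proof (rule comm_FactGroup_generate[OF calculation S])
    fix a b assume "a \<in> S" "b \<in> S"
    moreover from this have "a \<otimes> b \<otimes> inv a \<otimes> inv b =
        z [^] (0::nat) \<otimes> (a \<otimes> b \<otimes> inv a \<otimes> inv b) \<otimes> inv (z [^] (0::nat))"
      using S(1) by (auto simp: subset_iff)
    ultimately have "a \<otimes> b \<otimes> inv a \<otimes> inv b \<in> T" unfolding T_def by blast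
    then show "a \<otimes> b \<otimes> inv a \<otimes> inv b \<in> ?N" by (rule generate.incl)
  qed
  ultimately have pow: "x [^] l \<in> ?K" if "x \<in> carrier G" for x
    by (rule pow_mem_generate[OF _ _ NK K S _ that]) (auto simp: M intro!: generate.incl)
  show ?thesis
  proof
    show "?K \<subseteq> A" by (rule generate_subgroup_incl[OF MA is_subgroup])
    show "A \<subseteq> ?K"
    proof
      fix x assume x: "x \<in> A"
      \<comment> \<open>For x in A, x^k is trivial and x^l lies in K, with k and l coprime.\<close>
      show "x \<in> ?K"
        by (rule coprime_pow_mem[OF K A_car[OF x] _ pow[OF A_car[OF x]] kl(1)])
          (use kl(2)[OF x] K.one_closed in simp)
    qed
  qed
qed

text \<open>The conjugates of \<open>c\<close> lie in \<open>A\<close>, and their number is at most \<open>m\<close>.\<close>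

lemma orbit_length:
  assumes "z \<in> carrier G" "z [^] m = \<one>" "c \<in> A"
    and "\<And>i::nat. 0 < i \<Longrightarrow> i < j \<Longrightarrow> z [^] i \<otimes> c \<otimes> inv (z [^] i) \<noteq> c"
  shows "j * j \<le> card (carrier G)"
proof -
  have c: "c \<in> carrier G" using assms(3) A_car by blast
  \<comment> \<open>Conjugation by z^m = 1 fixes c, so c reappears after m steps at the
    latest.\<close>
  have jm: "j \<le> m"
  proof (rule ccontr)
    assume "\<not> j \<le> m"
    then show False using assms(4)[of m] index_pos assms(2) c by simp
  qed
  \<comment> \<open>Two equal conjugates would already bring c back after the difference of their
    exponents.\<close>
  have lt: "False" if "i < i'" "i' < j" "z [^] i \<otimes> c \<otimes> inv (z [^] i) = z [^] i' \<otimes> c \<otimes> inv (z [^] i')" for i i'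
  proof -
    have "z [^] i' = z [^] i \<otimes> z [^] (i' - i)" using that assms(1) by (simp add: nat_pow_mult)
    then have "z [^] i' \<otimes> c \<otimes> inv (z [^] i') =
        z [^] i \<otimes> (z [^] (i' - i) \<otimes> c \<otimes> inv (z [^] (i' - i))) \<otimes> inv (z [^] i)"
      using assms(1) c by (simp add: inv_mult_group m_assoc)
    then have "(z [^] i \<otimes> c) \<otimes> inv (z [^] i) =
        (z [^] i \<otimes> (z [^] (i' - i) \<otimes> c \<otimes> inv (z [^] (i' - i)))) \<otimes> inv (z [^] i)"
      using that(3) by simp
    then have "z [^] i \<otimes> c = z [^] i \<otimes> (z [^] (i' - i) \<otimes> c \<otimes> inv (z [^] (i' - i)))"
      using assms(1) c by (subst (asm) r_cancel) auto
    then have "c = z [^] (i' - i) \<otimes> c \<otimes> inv (z [^] (i' - i))"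
      using assms(1) c by (subst (asm) l_cancel) auto
    then show ?thesis using assms(4)[of "i' - i"] that by (simp add: less_imp_diff_less)
  qed
  have "inj_on (\<lambda>i. z [^] i \<otimes> c \<otimes> inv (z [^] i)) {..<j}"
    by (rule linorder_inj_onI) (use lt in \<open>auto\<close>)
  then have "card {..<j} \<le> card A"
    using assms(1,3) inv_op_closed2 fin_A by (intro card_inj_on_le) auto
  then have "j * j \<le> card A * m" using jm by (intro mult_mono) auto
  then show ?thesis using card_mult_index by simp
qed

end

text \<open>Order of the kernel times index is always |G|, so a kernel that contains all others has
  the least index.\<close>

lemma gamma_eqI:
  assumes "coprime_extension G A m"
    and "\<And>A' m'. coprime_extension G A' m' \<Longrightarrow> A' \<subseteq> A"
  shows "gamma G = m"
  unfolding gamma_def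
proof (rule Least_equality)
  interpret coprime_extension G A m by fact
  show "0 < m \<and> coprime_cyclic_extension G m" using index_pos coprime_cyclic_extension by blast
  fix m' assume "0 < m' \<and> coprime_cyclic_extension G m'"
  then obtain A' where "coprime_extension G A' m'"
    using coprime_extensionI[OF is_group fin] by blast
  then interpret A': coprime_extension G A' m' .
  have "card A' \<le> card A" using assms(2) A'.coprime_extension_axioms fin_A by (intro card_mono) auto
  then have "card A * m \<le> card A * m'"
    using card_mult_index A'.card_mult_index by (metis mult_le_mono1)
  moreover have "0 < card A" using fin_A one_closed card_gt_0_iff by blast
  ultimately show "m \<le> m'" by simp
qed

text \<open>The kernel is the group B obtained by enlarging an arbitrary admissible A0. Since k and
  l do not depend on A0, the same enlargement applied to another admissible A' shows that A' is
  killed by k; together with x^l in B this gives A' inside B. Hence B is the largest kernel and its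
  index is \<open>gamma G\<close>.\<close>

lemma standard_decomposition:
  assumes ext: "coprime_extension G A0 m0"
    and S: "S \<subseteq> carrier G" "generate G S = carrier G"
    and kl: "0 < k * l" "\<And>x. x \<in> carrier G \<Longrightarrow> x [^]\<^bsub>G\<^esub> (k * l) = \<one>\<^bsub>G\<^esub>" "coprime k l"
    and primes: "\<And>p. prime p \<Longrightarrow> p dvd l \<longleftrightarrow> nonnormal G S (k * l) p"
    and w: "leading_prod G S (k * l) {p. prime p \<and> p dvd l} w"
    and z: "z = w [^]\<^bsub>G\<^esub> k"
  shows "\<exists>A m. coprime_extension G A m \<and> z \<in> carrier G \<and> z [^]\<^bsub>G\<^esub> m = \<one>\<^bsub>G\<^esub> \<and>
    (A, generate G {z}) \<in> standard_decompositions G \<and>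
    generate G ({a [^]\<^bsub>G\<^esub> l | a. a \<in> S} \<union>
      {z [^]\<^bsub>G\<^esub> j \<otimes>\<^bsub>G\<^esub> (a \<otimes>\<^bsub>G\<^esub> b \<otimes>\<^bsub>G\<^esub> inv\<^bsub>G\<^esub> a \<otimes>\<^bsub>G\<^esub> inv\<^bsub>G\<^esub> b) \<otimes>\<^bsub>G\<^esub> inv\<^bsub>G\<^esub> (z [^]\<^bsub>G\<^esub> j) |
        a b (j::nat). a \<in> S \<and> b \<in> S}) = A"
proof -
  interpret E: coprime_extension G A0 m0 by fact
  define B where "B = {x \<in> E.extended. x [^]\<^bsub>G\<^esub> k = \<one>\<^bsub>G\<^esub>}"
  define m where "m = order (G Mod B)"
  note tor = E.coprime_extension_torsion[OF S kl primes, folded B_def, folded m_def]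
  interpret B: coprime_extension G B m using tor(1) by simp
  have Bk: "x [^]\<^bsub>G\<^esub> k = \<one>\<^bsub>G\<^esub>" if "x \<in> B" for x using that by (simp add: B_def)
  have Bl: "x [^]\<^bsub>G\<^esub> l \<in> B" if "x \<in> carrier G" for x using tor(3) that by simp
  have wc: "w \<in> carrier G" using B.leading_prod_rcos[OF kl(1,2) w] by simp
  then have zc: "z \<in> carrier G" by (simp add: z)
  have zl: "z [^]\<^bsub>G\<^esub> l = \<one>\<^bsub>G\<^esub>" using kl(2)[OF wc] wc by (simp add: z E.nat_pow_pow)
  have "generate G (B \<union> {z}) = carrier G"
    unfolding z by (rule B.generate_leading_prod[OF S kl Bk _ w]) (use S Bl in auto)
  note dec = B.decomposition_generate[OF zc this kl(3) Bk zl]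
  have "gamma G = m"
  proof (rule gamma_eqI[OF B.coprime_extension_axioms])
    fix A' m' assume "coprime_extension G A' m'"
    then interpret A': coprime_extension G A' m' .
    show "A' \<subseteq> B"
    proof
      fix x assume x: "x \<in> A'"
      then have "x [^]\<^bsub>G\<^esub> k = \<one>\<^bsub>G\<^esub>" using A'.coprime_extension_torsion(2)[OF S kl primes] by auto
      then show "x \<in> B"
        using E.coprime_pow_mem[OF B.is_subgroup A'.A_car[OF x] _ Bl[OF A'.A_car[OF x]] kl(3)] by simp
    qed
  qed
  then have "(B, generate G {z}) \<in> standard_decompositions G"
    using dec(1) by (simp add: standard_decompositions_def)
  moreover have "z [^]\<^bsub>G\<^esub> m = \<one>\<^bsub>G\<^esub>" using E.pow_ord_eq_1[OF zc] dec(2) by simp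
  moreover note B.generate_powers_commutators[OF S kl(3) Bk _ zc dec(3) refl]
  ultimately show ?thesis using B.coprime_extension_axioms zc S(1) Bl by blast
qed

section \<open>The program\<close>

definition for_com :: "vname \<Rightarrow> com \<Rightarrow> com" where
  "for_com x c = x ::= Const 0 ;;
     While (ALess (Num x) (Num ''s'')) (c ;; x ::= Add (Num x) (Const 1))"

lemma num_mod_for [simp]: "num_mod (for_com x c) = insert x (num_mod c)"
  and elt_mod_for [simp]: "elt_mod (for_com x c) = elt_mod c"
  by (auto simp: for_com_def)

text \<open>The invariant \<open>I i\<close> describes the state at the start of round
  \<open>i\<close>, when the counter already has the value \<open>i\<close>; what the body leaves
  alone is supplied by the frame condition.\<close>

lemma wp_for:
  assumes x: "x \<notin> num_mod c" "x \<noteq> ''s''" "''s'' \<notin> num_mod c"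
    and n: "num s ''s'' 0 = n" "n < 2 ^ L"
    and init: "I 0 (num_upd x 0 0 s)"
    and step: "\<And>i s'. i < n \<Longrightarrow> I i s' \<Longrightarrow> frame (for_com x c) s s' \<Longrightarrow> num s' x 0 = i \<Longrightarrow>
      wp G L c s' (\<lambda>m s''. m \<le> k \<and> I (Suc i) (num_upd x 0 (Suc i) s''))"
    and post: "\<And>m s'. m \<le> n * (k + 2) + 2 \<Longrightarrow> I n s' \<Longrightarrow> frame (for_com x c) s s' \<Longrightarrow> Q m s'"
  shows "wp G L (for_com x c) s Q"
proof -
  have fr: "frame (for_com x c) s s'"
    if "frame (c ;; x ::= Add (Num x) (Const 1)) (num_upd x 0 0 s) s'" for s'
    using that by (auto simp: frame_def)
  show ?thesis
    unfolding for_com_def wp_Seq wp_NumAssign aval.simps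
    apply (rule conjI)
    subgoal by simp
    apply (rule wp_While[where F = n and k = "k + 1" and f = "\<lambda>s'. n - num s' x 0" and
      I = "\<lambda>s'. num s' x 0 \<le> n \<and> I (num s' x 0) s'"])
    subgoal using init by simp
    subgoal by simp
    subgoal premises p for s'
    proof -
      have s: "num s' ''s'' 0 = n" using p(2) x n by (auto simp: frame_def)
      then have lt: "num s' x 0 < n" using p(3) by simp
      show ?thesis
        unfolding wp_Seq
      proof (rule wp_mono[OF step[OF lt _ fr refl]])
        show "I (num s' x 0) s'" using p(1) by simp
        show "frame (c ;; x ::= Add (Num x) (Const 1)) (num_upd x 0 0 s) s'" using p(2) by simp
        fix m s'' assume h: "m \<le> k \<and> I (Suc (num s' x 0)) (num_upd x 0 (Suc (num s' x 0)) s'')"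
          and f: "frame c s' s''"
        have "num s'' x = num s' x" using f x by (simp add: frame_def)
        then show "wp G L (x ::= Add (Num x) (Const 1)) s''
            (\<lambda>n' s''. m + n' \<le> k + 1 \<and> (num s'' x 0 \<le> n \<and> I (num s'' x 0) s'') \<and>
              n - num s'' x 0 < n - num s' x 0)"
          using h lt n(2) by (simp add: wp_NumAssign)
      qed
    qed
    subgoal premises p for m s'
    proof -
      have s: "num s' ''s'' 0 = n" using p(2) x n by (auto simp: frame_def)
      then have "num s' x 0 = n" using p(1,3) by simp
      then show ?thesis using p(1,4) by (intro post fr[OF p(2)]) auto
    qed
    done
qed

abbreviation Id_elt :: eexp where
  "Id_elt \<equiv> EMult (Elt ''g'') (EInv (Elt ''g''))"

abbreviation Commutator :: "eexp \<Rightarrow> eexp \<Rightarrow> eexp" where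
  "Commutator a b \<equiv> EMult (EMult (EMult a b) (EInv a)) (EInv b)"

abbreviation Gen :: "vname \<Rightarrow> eexp" where
  "Gen u \<equiv> EltAt ''g'' (Num u)"

section \<open>The phases of the algorithm\<close>

definition comm_mult_com :: com where
  "comm_mult_com = ''ox'' ::~ Commutator (Gen ''u'') (Gen ''v'') ;; order_com ;;
     ''E'' ::= Mul (Num ''E'') (Num ''oe'')"

text \<open>The final square: if \<open>e\<close> kills the generators and their commutators, then \<open>x^e\<close> lies in the
  derived subgroup, which is abelian and killed by \<open>e\<close>.\<close>

definition exponent_com :: com where
  "exponent_com =
     ''E'' ::= Const 1 ;;
     for_com ''u''
       (''ox'' ::~ Gen ''u'' ;; order_com ;;
        NumAssign ''nn'' (Num ''u'') (Num ''oe'') ;; ''E'' ::= Mul (Num ''E'') (Num ''oe'') ;;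
        for_com ''v'' comm_mult_com) ;;
     ''E'' ::= Mul (Num ''E'') (Num ''E'')"

definition part_com :: com where
  "part_com = ''r'' ::= Num ''E'' ;;
     While (ADvd (Num ''p'') (Num ''r'')) (''r'' ::= Div (Num ''r'') (Num ''p''))"

definition gen_part_com :: com where
  "gen_part_com = ''pb'' ::~ Gen ''u'' ;; ''pe'' ::= Num ''r'' ;; pow_com ;; ''x'' ::~ Elt ''pr''"

definition test_com :: com where
  "test_com = ''f'' ::= Const 0 ;;
     for_com ''u'' (gen_part_com ;;
       for_com ''v''
         (''y'' ::~ EMult (EMult (Gen ''v'') (Elt ''x'')) (EInv (Gen ''v'')) ;;
          If (EEq (EMult (Elt ''x'') (Elt ''y'')) (EMult (Elt ''y'') (Elt ''x'')))
            Skip (''f'' ::= Const 1)))"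

text \<open>\<open>D\<close> only ever receives complete prime parts, at constant product
  \<open>K * D\<close>; this is what keeps \<open>K\<close> and \<open>D\<close> coprime.\<close>

definition shift_com :: com where
  "shift_com = While (ADvd (Num ''p'') (Num ''K''))
     (''K'' ::= Div (Num ''K'') (Num ''p'') ;; ''D'' ::= Mul (Num ''D'') (Num ''p''))"

text \<open>Between rounds \<open>t\<close> is the order of the current champion \<open>q\<close>. A
  candidate x replaces it only if x^t is nontrivial, and then \<open>t\<close> is multiplied by p
  until it kills x, which makes it the order of x. Earlier candidates stay killed, because
  \<open>t\<close> only grows by factors.\<close>

definition lead_com :: com where
  "lead_com = ''t'' ::= Const 1 ;; ''q'' ::~ Id_elt ;;
     for_com ''u'' (gen_part_com ;; ''pb'' ::~ Elt ''x'' ;; ''pe'' ::= Num ''t'' ;; pow_com ;;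
       While (BNot (EEq (Elt ''pr'') Id_elt))
         (''t'' ::= Mul (Num ''t'') (Num ''p'') ;; ''q'' ::~ Elt ''x'' ;;
          ''pb'' ::~ Elt ''x'' ;; ''pe'' ::= Num ''t'' ;; pow_com))"

text \<open>The same prime may show up in the order multiples of several generators. Once it has
  been moved to \<open>D\<close> it no longer divides \<open>K\<close>, and the second test skips
  it.\<close>

definition process_com :: com where
  "process_com = part_com ;; test_com ;;
     If (BAnd (ALess (Const 0) (Num ''f'')) (ADvd (Num ''p'') (Num ''K'')))
       (shift_com ;; lead_com ;; ''W'' ::~ EMult (Elt ''W'') (Elt ''q'')) Skip"

definition factor_step_com :: com where
  "factor_step_com = If (ADvd (Num ''p'') (Num ''nf''))
     (''nf'' ::= Div (Num ''nf'') (Num ''p'') ;; process_com) (''p'' ::= Add (Num ''p'') (Const 1))"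

text \<open>As soon as \<open>nf < p * p\<close>, the remaining factor \<open>nf\<close> is prime, and \<open>p\<close> jumps to it.\<close>

definition factor_com :: com where
  "factor_com = ''nf'' ::= NumAt ''nn'' (Num ''a'') ;; ''p'' ::= Const 2 ;;
     While (ALess (Const 1) (Num ''nf''))
       (If (ALess (Num ''nf'') (Mul (Num ''p'') (Num ''p''))) (''p'' ::= Num ''nf'') Skip ;;
        factor_step_com)"

definition split_com :: com where
  "split_com = ''K'' ::= Num ''E'' ;; ''D'' ::= Const 1 ;; ''W'' ::~ Id_elt ;; for_com ''a'' factor_com"

text \<open>Conjugation by z is a permutation, so the orbit of a commutator is a cycle and comparing
  with its starting point suffices to detect the end; no record of visited elements has to be
  searched.\<close>

definition orbit_com :: com where
  "orbit_com =
     ''x'' ::~ Commutator (Gen ''u'') (Gen ''v'') ;;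
     EltAssign ''M'' (Num ''M'') (Elt ''x'') ;; ''M'' ::= Add (Num ''M'') (Const 1) ;;
     ''y'' ::~ EMult (EMult (Elt ''z'') (Elt ''x'')) (EInv (Elt ''z'')) ;;
     While (BNot (EEq (Elt ''y'') (Elt ''x'')))
       (EltAssign ''M'' (Num ''M'') (Elt ''y'') ;; ''M'' ::= Add (Num ''M'') (Const 1) ;;
        ''y'' ::~ EMult (EMult (Elt ''z'') (Elt ''y'')) (EInv (Elt ''z'')))"

definition output_com :: com where
  "output_com =
     ''pb'' ::~ Elt ''W'' ;; ''pe'' ::= Num ''K'' ;; pow_com ;; ''z'' ::~ Elt ''pr'' ;;
     ''M'' ::= Const 0 ;;
     for_com ''u''
       (''pb'' ::~ Gen ''u'' ;; ''pe'' ::= Num ''D'' ;; pow_com ;;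
        EltAssign ''M'' (Num ''M'') (Elt ''pr'') ;; ''M'' ::= Add (Num ''M'') (Const 1) ;;
        for_com ''v'' orbit_com)"

definition main_com :: com where
  "main_com = exponent_com ;; split_com ;; output_com"

lemma floorlog_div_less:
  assumes "2 \<le> p" "0 < (r::nat)"
  shows "floorlog 2 (r div p) < floorlog 2 r"
proof -
  have "floorlog 2 (r div p) \<le> floorlog 2 (r div 2)"
    using assms(1) by (intro floorlog_mono div_le_mono2) auto
  then show ?thesis using compute_floorlog[of 2 r] assms(2) by simp
qed

text \<open>Two prime factors, both at least p, would multiply to at least p^2.\<close>

lemma prime_if_less_square:
  assumes "1 < n" "\<And>q. prime q \<Longrightarrow> q dvd n \<Longrightarrow> p \<le> q" "n < p * (p::nat)"
  shows "prime n"
proof -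
  obtain q where q: "prime q" "q dvd n" using prime_factor_nat[of n] assms(1) by auto
  then obtain m where m: "n = q * m" by blast
  have "m = 1"
  proof (rule ccontr)
    assume "m \<noteq> 1"
    then obtain r where r: "prime r" "r dvd m" using prime_factor_nat by blast
    have "m \<noteq> 0" using m assms(1) by (intro notI) simp
    then have "r \<le> m" using r by (simp add: dvd_imp_le)
    moreover have "p \<le> r" using assms(2) r m by simp
    moreover have "p \<le> q" using assms(2) q by simp
    ultimately have "p * p \<le> q * m" by (intro mult_mono) auto
    then show False using assms(3) m by simp
  qed
  then show ?thesis using m q by simp
qed

lemma prime_if_least_factor:
  assumes "2 \<le> p" "p dvd n" "\<And>q. prime q \<Longrightarrow> q dvd n \<Longrightarrow> p \<le> (q::nat)" "0 < n"
  shows "prime p"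
proof -
  obtain q where q: "prime q" "q dvd p" using prime_factor_nat[of p] assms(1) by auto
  then have "p \<le> q" using assms(2,3) dvd_trans by blast
  moreover have "q \<le> p" using q assms(1) by (intro dvd_imp_le) auto
  ultimately show ?thesis using q by simp
qed

lemma image_upd: "(f(n := x)) ` {..<Suc n} = insert x (f ` {..<n::nat})"
  by (auto simp: lessThan_Suc)

section \<open>Correctness and running time of the program\<close>

text \<open>All numbers of the program stay below \<open>2 ^ L\<close>. The three conditions on
  \<open>L\<close> come from the step widths and order multiples, from the square of a product of
  \<open>length gs * length gs + length gs\<close> order multiples of size at most 4|G|, and from
  the length of the output array. The bound \<open>R\<close>, about twice the square root of |G|,
  limits step widths, trial divisors and orbit lengths alike.\<close>

locale black_box = group G for G :: "bitstring monoid" (structure) +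
  fixes gs :: "bitstring list" and L R :: nat
  assumes fin: "finite (carrier G)" and gs: "gs \<noteq> []" "set gs \<subseteq> carrier G"
    "generate G (set gs) = carrier G"
    and L_card: "16 * card (carrier G) < 2 ^ L"
    and L_exponent: "(4 * card (carrier G)) ^ (2 * (length gs * length gs + length gs)) < 2 ^ L"
    and L_output: "(length gs * length gs + length gs) * (R + 2) < 2 ^ L"
    and R: "\<And>n. n * n \<le> 4 * card (carrier G) \<Longrightarrow> n \<le> R"
begin

definition input :: "state \<Rightarrow> bool" where
  "input s \<longleftrightarrow> num s ''s'' 0 = length gs \<and> (\<forall>i<length gs. elt s ''g'' i = gs ! i)"

lemma inputD:
  assumes "input s"
  shows "num s ''s'' 0 = length gs" "i < length gs \<Longrightarrow> elt s ''g'' i = gs ! i"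
    "elt s ''g'' 0 \<in> carrier G"
  using assms gs nth_mem[of 0 gs] by (auto simp: input_def)

lemma nth_carrier [simp]: "i < length gs \<Longrightarrow> gs ! i \<in> carrier G"
  using gs(2) nth_mem by blast

lemma input_frame:
  assumes "input s" "num s' ''s'' = num s ''s''" "elt s' ''g'' = elt s ''g''"
  shows "input s'"
  using assms by (simp add: input_def)

lemma length_less: "length gs < 2 ^ L" "1 < (2::nat) ^ L"
proof -
  have "length gs * 1 \<le> (length gs * length gs + length gs) * (R + 2)"
    by (intro mult_mono) auto
  then show "length gs < 2 ^ L" using L_output by simp
  have "0 < length gs" using gs(1) by simp
  then have "1 \<le> length gs * length gs + length gs" by linarith
  then have "1 * 2 \<le> (length gs * length gs + length gs) * (R + 2)"
    by (rule mult_mono) auto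
  then show "1 < (2::nat) ^ L" using L_output by simp
qed

abbreviation "N \<equiv> card (carrier G)"

lemma N_pos: "0 < N"
  using fin order_gt_0_iff_finite by (simp add: order_def)

abbreviation "cost_order \<equiv> (L + 1) * (L + 1) * (31 * R + 31)"

section \<open>The multiple of the exponent\<close>

lemma mod_order_com:
  "num_mod order_com = {''n'', ''of'', ''i'', ''oj'', ''l'', ''h'', ''oe'', ''w'', ''o'', ''m'', ''j'', ''e''}"
  "elt_mod order_com = {''oa'', ''oy'', ''ot'', ''b'', ''c''}"
  by (auto simp: order_com_def round_com_def giant_com_def baby_com_def sort_com_def merge_com_def
      find_com_def)

lemma mod_comm_mult_com:
  "num_mod comm_mult_com = insert ''E'' (num_mod order_com)"
  "elt_mod comm_mult_com = insert ''ox'' (elt_mod order_com)"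
  by (auto simp: comm_mult_com_def)

lemma power_less_L:
  assumes "e \<le> (4 * N) ^ i" "i \<le> length gs * length gs + length gs"
  shows "e < 2 ^ L" "e * e < 2 ^ L"
proof -
  have le: "e \<le> (4 * N) ^ (length gs * length gs + length gs)"
    using assms(1) power_increasing[OF assms(2), of "4 * N"] N_pos by linarith
  then have "e * e \<le> (4 * N) ^ (length gs * length gs + length gs) * (4 * N) ^ (length gs * length gs + length gs)"
    by (rule mult_mono) (use le in auto)
  then show "e * e < 2 ^ L" using L_exponent unfolding mult_2 power_add by linarith
  moreover have "e \<le> e * e" by (cases e) auto
  ultimately show "e < 2 ^ L" by linarith
qed

lemma wp_exponent:
  assumes s: "input s"
    and Q: "\<And>m s'. m \<le> (length gs * length gs + length gs) * (cost_order + 8) + 6 \<Longrightarrow>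
      (\<exists>e. num s' ''E'' 0 = e * e \<and> 0 < e \<and>
        (\<forall>a\<in>set gs. a [^] e = \<one>) \<and>
        (\<forall>a\<in>set gs. \<forall>b\<in>set gs. (a \<otimes> b \<otimes> inv a \<otimes> inv b) [^] e = \<one>) \<and>
        (\<forall>i<length gs. 0 < num s' ''nn'' i \<and> num s' ''nn'' i \<le> 4 * N \<and> num s' ''nn'' i dvd e \<and>
          gs ! i [^] num s' ''nn'' i = \<one>)) \<Longrightarrow>
      num s' ''E'' 0 < 2 ^ L \<Longrightarrow> input s' \<Longrightarrow> Q m s'"
  shows "wp G L exponent_com s Q"
proof -
  let ?g = "length gs"
  let ?c = "\<lambda>i j. gs ! i \<otimes> gs ! j \<otimes> inv (gs ! i) \<otimes> inv (gs ! j)"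
  \<comment> \<open>The exponent of \<open>4 * N\<close> counts the factors collected: each finished
    generator has contributed one for itself and one for each of its commutators. In the variant
    \<open>C'\<close> for the inner loop the factor of generator i itself is already included, and
    \<open>j\<close> of its commutators are done.\<close>
  define C where "C i j s' \<longleftrightarrow> 0 < num s' ''E'' 0 \<and> num s' ''E'' 0 \<le> (4 * N) ^ (i * ?g + i + j) \<and>
      (\<forall>i'<i. 0 < num s' ''nn'' i' \<and> num s' ''nn'' i' \<le> 4 * N \<and> num s' ''nn'' i' dvd num s' ''E'' 0 \<and>
        gs ! i' [^] num s' ''nn'' i' = \<one>) \<and>
      (\<forall>i'<i. \<forall>j'<?g. ?c i' j' [^] num s' ''E'' 0 = \<one>)" for i j and s' :: state
  define C' where "C' i j s' \<longleftrightarrow> 0 < num s' ''E'' 0 \<and> num s' ''E'' 0 \<le> (4 * N) ^ (i * ?g + i + 1 + j) \<and>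
      (\<forall>i'<Suc i. 0 < num s' ''nn'' i' \<and> num s' ''nn'' i' \<le> 4 * N \<and> num s' ''nn'' i' dvd num s' ''E'' 0 \<and>
        gs ! i' [^] num s' ''nn'' i' = \<one>) \<and>
      (\<forall>i'<i. \<forall>j'<?g. ?c i' j' [^] num s' ''E'' 0 = \<one>) \<and>
      (\<forall>j'<j. ?c i j' [^] num s' ''E'' 0 = \<one>)" for i j and s' :: state
  have pow_dvd: "x [^] (e * d) = \<one>" if "x [^] e = \<one>" "x \<in> carrier G" for x and e d :: nat
    using that by (simp flip: nat_pow_pow)
  show ?thesis
    unfolding exponent_com_def
    apply (simp only: wp_simps)
    apply (rule conjI)
    subgoal using length_less by simp
    apply (rule wp_for[where n = ?g and k = "?g * (cost_order + 4) + cost_order + 5" and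
      I = "\<lambda>i s'. C i 0 s'"])
    subgoal by (simp add: mod_order_com mod_comm_mult_com)
    subgoal by simp
    subgoal by (simp add: mod_order_com mod_comm_mult_com)
    subgoal using inputD[OF s] by simp
    subgoal by (rule length_less)
    subgoal by (simp add: C_def)
    subgoal premises p for i s1
    proof -
      have in1: "input s1"
        by (rule input_frame[OF s]) (use p(3) in \<open>simp_all add: frame_def mod_order_com mod_comm_mult_com\<close>)
      have u: "elt s1 ''g'' (num s1 ''u'' 0) = gs ! i" using inputD(2)[OF in1 p(1)] p(4) by simp
      show ?thesis
        apply (simp only: wp_simps)
        apply (rule wp_order[OF is_group fin, where R = R])
        subgoal using inputD[OF in1] by simp
        subgoal using u p(1) by simp
        subgoal by (rule L_card)
        subgoal by (rule R)
        subgoal premises q for m2 s2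
        proof -
          have in2: "input s2" by (rule input_frame[OF in1]) (use q(5,6) in simp_all)
          have s2: "num s2 ''u'' 0 = i" "num s2 ''nn'' = num s1 ''nn''" "num s2 ''E'' = num s1 ''E''"
            using q(5) p(4) by simp_all
          have oe: "0 < num s2 ''oe'' 0" "num s2 ''oe'' 0 \<le> 4 * N" "gs ! i [^] num s2 ''oe'' 0 = \<one>"
            using q(2-4) u by simp_all
          have oeL: "num s2 ''oe'' 0 < 2 ^ L" using oe L_card by linarith
          let ?E = "num s1 ''E'' 0" and ?o = "num s2 ''oe'' 0"
          have Eb: "?E * ?o \<le> (4 * N) ^ (i * ?g + i + 1)"
            using mult_mono[of ?E "(4 * N) ^ (i * ?g + i)" ?o "4 * N"] p(2) oe by (simp add: C_def mult.commute)
          have ib: "i * ?g + i + 1 \<le> ?g * ?g + ?g"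
          proof -
            have "i * ?g \<le> ?g * ?g" using p(1) by (intro mult_right_mono) auto
            then show ?thesis using p(1) by linarith
          qed
          have EL: "?E * ?o < 2 ^ L" using power_less_L(1)[OF Eb ib] .
          show ?thesis
            apply (simp only: wp_simps s2)
            apply (intro conjI)
            subgoal using oeL .
            subgoal using EL by simp
            apply (rule wp_for[where n = ?g and k = "cost_order + 2" and I = "\<lambda>j s'. C' i j s'"])
            subgoal by (simp add: mod_order_com mod_comm_mult_com)
            subgoal by simp
            subgoal by (simp add: mod_order_com mod_comm_mult_com)
            subgoal using inputD[OF in2] by simp
            subgoal by (rule length_less)
            subgoal
            proof -
              have "\<forall>i'<Suc i. 0 < ((num s1 ''nn'')(i := ?o)) i' \<and> ((num s1 ''nn'')(i := ?o)) i' \<le> 4 * N \<and>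
                  ((num s1 ''nn'')(i := ?o)) i' dvd ?E * ?o \<and> gs ! i' [^] ((num s1 ''nn'')(i := ?o)) i' = \<one>"
                using p(2) oe by (auto simp: C_def less_Suc_eq)
              then show ?thesis
                using p(1,2) oe Eb s2 by (simp add: C_def C'_def pow_dvd)
            qed
            subgoal premises v for j s3
            proof -
              have in3: "input s3"
                by (rule input_frame[OF in2]) (use v(3) in \<open>simp_all add: frame_def mod_order_com mod_comm_mult_com\<close>)
              have uu: "num s3 ''u'' 0 = i" using v(3) s2 by (simp add: frame_def mod_order_com mod_comm_mult_com)
              have uv: "elt s3 ''g'' (num s3 ''u'' 0) = gs ! i" "elt s3 ''g'' (num s3 ''v'' 0) = gs ! j"
                using inputD(2)[OF in3] p(1) v(1,4) uu by simp_all
              show ?thesis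
                unfolding comm_mult_com_def
                apply (simp only: wp_simps)
                apply (rule wp_order[OF is_group fin, where R = R])
                subgoal using inputD[OF in3] by simp
                subgoal using uv p(1) v(1) by simp
                subgoal by (rule L_card)
                subgoal by (rule R)
                subgoal premises w for m4 s4
                proof -
                  let ?E = "num s3 ''E'' 0" and ?o = "num s4 ''oe'' 0"
                  have s4: "num s4 ''nn'' = num s3 ''nn''" "num s4 ''E'' = num s3 ''E''"
                    using w(5) by simp_all
                  have oe: "0 < ?o" "?o \<le> 4 * N" "?c i j [^] ?o = \<one>"
                    using w(2-4) uv by simp_all
                  have Eb: "?E * ?o \<le> (4 * N) ^ (i * ?g + i + 1 + Suc j)"
                    using mult_mono[of ?E "(4 * N) ^ (i * ?g + i + 1 + j)" ?o "4 * N"] v(2) oe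
                    by (simp add: C'_def mult.commute mult.left_commute)
                  have "Suc i * ?g \<le> ?g * ?g" using p(1) by (intro mult_right_mono) auto
                  then have "i * ?g + i + 1 + Suc j \<le> ?g * ?g + ?g"
                    using v(1) p(1) by simp
                  then have EL: "?E * ?o < 2 ^ L" using power_less_L(1)[OF Eb] by simp
                  have "\<forall>i'<Suc i. num s3 ''nn'' i' dvd ?E * ?o" using v(2) by (auto simp: C'_def)
                  moreover have "\<forall>j'<Suc j. ?c i j' [^] (?E * ?o) = \<one>"
                    using v(1,2) p(1) oe pow_dvd[of "?c i j" ?o ?E]
                    by (auto simp: C'_def less_Suc_eq pow_dvd mult.commute)
                  ultimately show ?thesis
                    using v(2) Eb EL oe w(1) p(1) s4 by (simp add: wp_simps C'_def pow_dvd)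
                qed
                done
            qed
            subgoal premises v for m3 s3
            proof -
              have "m3 \<le> ?g * (cost_order + 4) + 2" using v(1) by simp
              then have "1 + (m2 + (1 + (1 + m3))) \<le> ?g * (cost_order + 4) + cost_order + 5"
                using q(1) by linarith
              moreover have "C (Suc i) 0 (num_upd ''u'' 0 (Suc i) s3)"
                using v(2) by (auto simp: C_def C'_def less_Suc_eq algebra_simps)
              ultimately show ?thesis by simp
            qed
            done
        qed
        done
    qed
    subgoal premises p for m s1
    proof -
      have in1: "input s1"
        by (rule input_frame[OF s]) (use p(3) in \<open>simp_all add: frame_def mod_order_com mod_comm_mult_com\<close>)
      let ?E = "num s1 ''E'' 0"
      have Eb: "?E \<le> (4 * N) ^ (?g * ?g + ?g)" "0 < ?E" using p(2) by (simp_all add: C_def)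
      have EL: "?E * ?E < 2 ^ L" using power_less_L(2)[OF Eb(1)] by simp
      have nn: "\<forall>i<length gs. 0 < num s1 ''nn'' i \<and> num s1 ''nn'' i \<le> 4 * N \<and> num s1 ''nn'' i dvd ?E \<and>
          gs ! i [^] num s1 ''nn'' i = \<one>" using p(2) by (auto simp: C_def)
      have ga: "\<forall>a\<in>set gs. a [^] ?E = \<one>"
      proof
        fix a assume "a \<in> set gs"
        then obtain i where i: "i < ?g" "a = gs ! i" by (auto simp: in_set_conv_nth)
        then obtain d where "?E = num s1 ''nn'' i * d" using nn by blast
        then show "a [^] ?E = \<one>" using nn i pow_dvd[of a] by simp
      qed
      have gc: "\<forall>a\<in>set gs. \<forall>b\<in>set gs. (a \<otimes> b \<otimes> inv a \<otimes> inv b) [^] ?E = \<one>"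
        using p(2) by (auto simp: C_def in_set_conv_nth)
      have cost: "1 + (m + 1) \<le> (?g * ?g + ?g) * (cost_order + 8) + 6"
      proof -
        have "m \<le> ?g * (?g * (cost_order + 4) + cost_order + 7) + 2" using p(1) by simp
        then show ?thesis by (simp add: algebra_simps)
      qed
      have "Q (1 + (m + 1)) (num_upd ''E'' 0 (?E * ?E) s1)"
      proof (rule Q[OF cost])
        show "\<exists>e. num (num_upd ''E'' 0 (?E * ?E) s1) ''E'' 0 = e * e \<and> 0 < e \<and>
        (\<forall>a\<in>set gs. a [^] e = \<one>) \<and>
        (\<forall>a\<in>set gs. \<forall>b\<in>set gs. (a \<otimes> b \<otimes> inv a \<otimes> inv b) [^] e = \<one>) \<and>
        (\<forall>i<length gs. 0 < num (num_upd ''E'' 0 (?E * ?E) s1) ''nn'' i \<and>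
          num (num_upd ''E'' 0 (?E * ?E) s1) ''nn'' i \<le> 4 * N \<and>
          num (num_upd ''E'' 0 (?E * ?E) s1) ''nn'' i dvd e \<and>
          gs ! i [^] num (num_upd ''E'' 0 (?E * ?E) s1) ''nn'' i = \<one>)"
          using Eb nn ga gc by (intro exI[of _ ?E]) simp
        show "num (num_upd ''E'' 0 (?E * ?E) s1) ''E'' 0 < 2 ^ L" using EL by simp
        show "input (num_upd ''E'' 0 (?E * ?E) s1)" by (rule input_frame[OF in1]) simp_all
      qed
      then show ?thesis using EL by simp
    qed
    done
qed

section \<open>Processing one prime\<close>

lemma wp_part:
  assumes s: "num s ''p'' 0 = p" "num s ''E'' 0 = n" "prime p" "0 < n" "n < 2 ^ L"
    and Q: "\<And>m s'. m \<le> 2 * L + 2 \<Longrightarrow> num s' ''r'' 0 = cofactor p n \<Longrightarrow>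
      \<forall>x. x \<notin> {''r''} \<longrightarrow> num s' x = num s x \<Longrightarrow> elt s' = elt s \<Longrightarrow> Q m s'"
  shows "wp G L part_com s Q"
proof -
  have p2: "2 \<le> p" using s(3) by (simp add: prime_ge_2_nat)
  show ?thesis
    unfolding part_com_def
    apply (simp only: wp_simps)
    apply (rule conjI)
    subgoal using s by simp
    apply (rule wp_While[where F = L and k = 1 and f = "\<lambda>s'. floorlog 2 (num s' ''r'' 0)" and
      I = "\<lambda>s'. \<exists>e. n = num s' ''r'' 0 * p ^ e"])
    subgoal using s by (auto intro: exI[of _ 0])
    subgoal using s by (simp add: floorlog_leI)
    subgoal premises h for s'
    proof -
      have p: "num s' ''p'' 0 = p" using h(2) s by (simp add: frame_def)
      obtain e where e: "n = num s' ''r'' 0 * p ^ e" using h(1) by blast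
      have r: "p dvd num s' ''r'' 0" using h(3) p by simp
      then have "n = num s' ''r'' 0 div p * p ^ Suc e" using e by (metis dvd_div_mult_self mult.assoc power_Suc)
      then have ex: "\<exists>e. n = num s' ''r'' 0 div p * p ^ e" by blast
      have "0 < num s' ''r'' 0" using e s(4) by (cases "num s' ''r'' 0") auto
      moreover have "num s' ''r'' 0 < 2 ^ L"
        using e s by (metis dvd_imp_le dvd_triv_left le_less_trans)
      then have "num s' ''r'' 0 div p < 2 ^ L" by (meson div_le_dividend le_less_trans)
      ultimately show ?thesis using ex p floorlog_div_less[OF p2] by (simp add: wp_simps)
    qed
    subgoal premises h for m s'
    proof -
      have p: "num s' ''p'' 0 = p" using h(2) s by (simp add: frame_def)
      obtain e where e: "n = num s' ''r'' 0 * p ^ e" using h(1) by blast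
      have "\<not> p dvd num s' ''r'' 0" using h(3) p by simp
      then have r: "num s' ''r'' 0 = cofactor p n" using cofactor_eqI[OF s(3), of "num s' ''r'' 0" e] e by simp
      show ?thesis
        by (rule Q) (use h(2,4) r in \<open>simp_all add: frame_def fun_eq_iff\<close>)
    qed
    done
qed

lemma mod_pow_com: "num_mod pow_com = {''pe''}" "elt_mod pow_com = {''pr'', ''pb''}"
  by (auto simp: pow_com_def)

lemma wp_gen_part:
  assumes s: "input s" "num s ''u'' 0 = i" "i < length gs" "num s ''r'' 0 = r" "r < 2 ^ L"
    and Q: "\<And>m s'. m \<le> 5 * L + 5 \<Longrightarrow> elt s' ''x'' 0 = gs ! i [^] r \<Longrightarrow>
      \<forall>x. x \<notin> {''pe''} \<longrightarrow> num s' x = num s x \<Longrightarrow>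
      \<forall>x. x \<notin> {''pr'', ''pb'', ''x''} \<longrightarrow> elt s' x = elt s x \<Longrightarrow> Q m s'"
  shows "wp G L gen_part_com s Q"
  unfolding gen_part_com_def
  apply (simp only: wp_simps)
  apply (rule conjI)
  subgoal using s by simp
  apply (rule wp_pow[OF is_group])
  subgoal using inputD[OF s(1)] by simp
  subgoal using inputD(2)[OF s(1,3)] s by simp
  subgoal using s by simp
  subgoal premises p for m s'
    by (rule Q) (use p inputD(2)[OF s(1,3)] s in simp_all)
  done

lemma mod_gen_part_com:
  "num_mod gen_part_com = {''pe''}" "elt_mod gen_part_com = {''pr'', ''pb'', ''x''}"
  by (auto simp: gen_part_com_def mod_pow_com)

lemma wp_test:
  assumes s: "input s" "num s ''r'' 0 = cofactor p n" "prime p" "p dvd n" "0 < n" "n < 2 ^ L"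
    and Q: "\<And>m s'. m \<le> length gs * (5 * L + 5 * length gs + 9) + 3 \<Longrightarrow>
      0 < num s' ''f'' 0 \<longleftrightarrow> nonnormal G (set gs) n p \<Longrightarrow>
      \<forall>x. x \<notin> {''pe'', ''f'', ''u'', ''v''} \<longrightarrow> num s' x = num s x \<Longrightarrow>
      \<forall>x. x \<notin> {''pr'', ''pb'', ''x'', ''y''} \<longrightarrow> elt s' x = elt s x \<Longrightarrow> Q m s'"
  shows "wp G L test_com s Q"
proof -
  let ?g = "length gs" and ?r = "cofactor p n"
  define bad where "bad i j \<longleftrightarrow> (let x = gs ! i [^] ?r; y = gs ! j \<otimes> x \<otimes> inv (gs ! j) in x \<otimes> y \<noteq> y \<otimes> x)" for i j
  have rL: "?r < 2 ^ L" using s(6) by (metis cofactor(1) dvd_imp_le dvd_triv_left le_less_trans s(3,5))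
  have nonnormal: "nonnormal G (set gs) n p \<longleftrightarrow> (\<exists>i<?g. \<exists>j<?g. bad i j)"
    using s(3,4) by (auto simp: nonnormal_def bad_def in_set_conv_nth) (metis nth_mem)+
  show ?thesis
    unfolding test_com_def
    apply (simp only: wp_simps)
    apply (rule conjI)
    subgoal by simp
    apply (rule wp_for[where n = ?g and k = "5 * L + 5 * ?g + 7" and
      I = "\<lambda>i s'. 0 < num s' ''f'' 0 \<longleftrightarrow> (\<exists>i'<i. \<exists>j<?g. bad i' j)"])
    subgoal by (simp add: mod_gen_part_com)
    subgoal by simp
    subgoal by (simp add: mod_gen_part_com)
    subgoal using inputD[OF s(1)] by simp
    subgoal by (rule length_less)
    subgoal by simp
    subgoal premises h for i s1
    proof -
      have in1: "input s1"
        by (rule input_frame[OF s(1)]) (use h(3) in \<open>simp_all add: frame_def mod_gen_part_com\<close>)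
      have r1: "num s1 ''r'' 0 = ?r" using h(3) s by (simp add: frame_def mod_gen_part_com)
      show ?thesis
        apply (simp only: wp_simps)
        apply (rule wp_gen_part[OF in1 h(4,1) r1 rL])
        subgoal premises q for m2 s2
        proof -
          have in2: "input s2" by (rule input_frame[OF in1]) (use q(3,4) in simp_all)
          show ?thesis
            apply (rule wp_for[where n = ?g and k = 3 and
              I = "\<lambda>j s'. 0 < num s' ''f'' 0 \<longleftrightarrow> (\<exists>i'<i. \<exists>j<?g. bad i' j) \<or> (\<exists>j'<j. bad i j')"])
            subgoal by simp
            subgoal by simp
            subgoal by simp
            subgoal using inputD[OF in2] by simp
            subgoal by (rule length_less)
            subgoal using h(2) q(3) by simp
            subgoal premises v for j s3
            proof -
              have in3: "input s3" by (rule input_frame[OF in2]) (use v(3) in \<open>simp_all add: frame_def\<close>)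
              have gj: "elt s3 ''g'' j = gs ! j" using inputD(2)[OF in3 v(1)] .
              have x: "elt s3 ''x'' 0 = gs ! i [^] ?r" using v(3) q(2) by (simp add: frame_def)
              show ?thesis
              proof (cases "bad i j")
                case True
                then have "\<exists>j'<Suc j. bad i j'" by blast
                then show ?thesis using True v(4) gj x length_less(2)
                  by (simp add: wp_simps bad_def Let_def)
              next
                case False
                then have "(\<exists>j'<Suc j. bad i j') \<longleftrightarrow> (\<exists>j'<j. bad i j')" by (metis less_Suc_eq)
                then show ?thesis using False v(2,4) gj x
                  by (simp add: wp_simps bad_def Let_def)
              qed
            qed
            subgoal premises v for m3 s3
            proof -
              have "(\<exists>i'<Suc i. \<exists>j<?g. bad i' j) \<longleftrightarrow> (\<exists>i'<i. \<exists>j<?g. bad i' j) \<or> (\<exists>j'<?g. bad i j')"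
                by (metis less_Suc_eq)
              then show ?thesis using v(1,2) q(1) by simp
            qed
            done
        qed
        done
    qed
    subgoal premises h for m s1
      by (rule Q) (use h nonnormal in \<open>simp_all add: frame_def mod_gen_part_com algebra_simps\<close>)
    done
qed

lemma wp_shift:
  assumes s: "num s ''p'' 0 = p" "num s ''K'' 0 = k" "num s ''D'' 0 = d" "prime p" "0 < k * d" "k * d < 2 ^ L"
    and Q: "\<And>m s' e. m \<le> 3 * L + 1 \<Longrightarrow> k = num s' ''K'' 0 * p ^ e \<Longrightarrow> \<not> p dvd num s' ''K'' 0 \<Longrightarrow>
      num s' ''D'' 0 = d * p ^ e \<Longrightarrow>
      \<forall>x. x \<notin> {''K'', ''D''} \<longrightarrow> num s' x = num s x \<Longrightarrow> elt s' = elt s \<Longrightarrow> Q m s'"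
  shows "wp G L shift_com s Q"
proof -
  have p2: "2 \<le> p" using s(4) by (simp add: prime_ge_2_nat)
  have "k * 1 \<le> k * d" using s(5) by (intro mult_left_mono) auto
  then have kL: "k < 2 ^ L" using s(6) by linarith
  show ?thesis
    unfolding shift_com_def
    apply (rule wp_While[where F = L and k = 2 and f = "\<lambda>s'. floorlog 2 (num s' ''K'' 0)" and
      I = "\<lambda>s'. \<exists>e. k = num s' ''K'' 0 * p ^ e \<and> num s' ''D'' 0 = d * p ^ e"])
    subgoal using s by (auto intro: exI[of _ 0])
    subgoal using s kL by (simp add: floorlog_leI)
    subgoal premises h for s'
    proof -
      have p: "num s' ''p'' 0 = p" using h(2) s by (simp add: frame_def)
      obtain e where e: "k = num s' ''K'' 0 * p ^ e" "num s' ''D'' 0 = d * p ^ e" using h(1) by blast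
      have r: "p dvd num s' ''K'' 0" using h(3) p by simp
      then have k': "k = num s' ''K'' 0 div p * p ^ Suc e"
        using e by (metis dvd_div_mult_self mult.assoc power_Suc)
      have K0: "0 < num s' ''K'' 0" using e s(5) by (cases "num s' ''K'' 0") auto
      then have K1: "0 < num s' ''K'' 0 div p" using k' s(5) by (cases "num s' ''K'' 0 div p") auto
      have "num s' ''K'' 0 \<le> k" using e s(5) p2 by simp
      then have KL: "num s' ''K'' 0 div p < 2 ^ L" using kL by (meson div_le_dividend le_less_trans)
      have "d * p ^ Suc e * 1 \<le> d * p ^ Suc e * (num s' ''K'' 0 div p)"
        using K1 by (intro mult_left_mono) auto
      also have "\<dots> = k * d" using k' by (simp add: mult.commute mult.left_commute)
      finally have DL: "d * p ^ Suc e < 2 ^ L" using s(6) by linarith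
      have ex: "\<exists>e. k = num s' ''K'' 0 div p * p ^ e \<and> num s' ''D'' 0 * p = d * p ^ e"
        using k' e(2) by (intro exI[of _ "Suc e"]) simp
      have DL': "num s' ''D'' 0 * p < 2 ^ L" using DL e(2) by (simp add: mult.commute mult.left_commute)
      show ?thesis using ex p KL DL' floorlog_div_less[OF p2 K0] by (simp add: wp_simps)
    qed
    subgoal premises h for m s'
    proof -
      have p: "num s' ''p'' 0 = p" using h(2) s by (simp add: frame_def)
      obtain e where e: "k = num s' ''K'' 0 * p ^ e" "num s' ''D'' 0 = d * p ^ e" using h(1) by blast
      show ?thesis
        by (rule Q[OF _ e(1) _ e(2)]) (use h p in \<open>simp_all add: frame_def fun_eq_iff\<close>)
    qed
    done
qed

lemma wp_lead:
  assumes s: "input s" "num s ''p'' 0 = p" "num s ''r'' 0 = cofactor p n" "prime p" "0 < n" "n < 2 ^ L"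
    and exponent: "\<And>x. x \<in> carrier G \<Longrightarrow> x [^] n = \<one>"
    and Q: "\<And>m s'. m \<le> length gs * (5 * L * L + 17 * L + 15) + 4 \<Longrightarrow>
      leading G (set gs) n p (elt s' ''q'' 0) \<Longrightarrow>
      \<forall>x. x \<notin> {''pe'', ''t'', ''u''} \<longrightarrow> num s' x = num s x \<Longrightarrow>
      \<forall>x. x \<notin> {''pr'', ''pb'', ''x'', ''q''} \<longrightarrow> elt s' x = elt s x \<Longrightarrow> Q m s'"
  shows "wp G L lead_com s Q"
proof -
  let ?g = "length gs" and ?r = "cofactor p n" and ?v = "multiplicity p n"
  have p2: "2 \<le> p" using s(4) by (simp add: prime_ge_2_nat)
  have n: "n = ?r * p ^ ?v" using cofactor(1)[OF s(4,5)] .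
  have rL: "?r < 2 ^ L" using s(6) n by (metis dvd_imp_le dvd_triv_left le_less_trans s(5))
  have pvn: "p ^ ?v \<le> n" using s(5) by (intro dvd_imp_le multiplicity_dvd) auto
  then have pvL: "p ^ ?v < 2 ^ L" using s(6) by linarith
  have "2 ^ ?v \<le> p ^ ?v" using p2 by (rule power_mono) simp
  then have "(2::nat) ^ ?v < 2 ^ L" using pvL by linarith
  then have vL: "?v < L" by simp
  have xv: "(gs ! i [^] ?r) [^] (p ^ ?v) = \<one>" if "i < ?g" for i
    using exponent[of "gs ! i"] that n by (simp add: nat_pow_pow)
  show ?thesis
    unfolding lead_com_def
    apply (simp only: wp_simps)
    apply (rule conjI)
    subgoal using length_less by simp
    apply (rule wp_for[where n = ?g and k = "5 * L * L + 17 * L + 13" and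
      I = "\<lambda>i s'. elt s' ''q'' 0 \<in> carrier G \<and> (\<exists>e\<le>?v. num s' ''t'' 0 = p ^ e) \<and>
        ord (elt s' ''q'' 0) = num s' ''t'' 0 \<and>
        (\<forall>i'<i. (gs ! i' [^] ?r) [^] num s' ''t'' 0 = \<one>)"])
    subgoal by (simp add: mod_gen_part_com mod_pow_com)
    subgoal by simp
    subgoal by (simp add: mod_gen_part_com mod_pow_com)
    subgoal using inputD[OF s(1)] by simp
    subgoal by (rule length_less)
    subgoal using inputD(3)[OF s(1)] by (auto intro: exI[of _ 0])
    subgoal premises h for i s1
    proof -
      let ?x = "gs ! i [^] ?r"
      have xc: "?x \<in> carrier G" using h(1) by simp
      have in1: "input s1"
        by (rule input_frame[OF s(1)]) (use h(3) in \<open>simp_all add: frame_def mod_gen_part_com mod_pow_com\<close>)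
      have r1: "num s1 ''r'' 0 = ?r" and p1: "num s1 ''p'' 0 = p"
        using h(3) s by (simp_all add: frame_def mod_gen_part_com mod_pow_com)
      obtain e1 where e1: "e1 \<le> ?v" "num s1 ''t'' 0 = p ^ e1" using h(2) by blast
      have teL: "p ^ e < 2 ^ L" if "e \<le> ?v" for e
      proof -
        have "p ^ e \<le> p ^ ?v" using p2 that by (intro power_increasing) auto
        then show ?thesis using pvL by linarith
      qed
      show ?thesis
        apply (simp only: wp_simps)
        apply (rule wp_gen_part[OF in1 h(4,1) r1 rL])
        subgoal premises q for m2 s2
        proof -
          have in2: "input s2" by (rule input_frame[OF in1]) (use q(3,4) in simp_all)
          have t2: "num s2 ''t'' 0 = p ^ e1" using q(3) e1 by simp
          show ?thesis
            apply (rule conjI)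
            subgoal using t2 teL[OF e1(1)] by simp
            apply (rule wp_pow[OF is_group])
            subgoal using inputD[OF in2] by simp
            subgoal using q(2) xc by simp
            subgoal using t2 teL[OF e1(1)] by simp
            subgoal premises w for m3 s3
            \<comment> \<open>After \<open>q\<close> has been replaced by x, its order may still
              exceed \<open>t\<close>. The invariant then records that p^(e - 1) does not kill x, so
              that on exit, when p^e does, the order is exactly p^e.\<close>
            proof (rule wp_While[where F = L and k = "5 * L + 6" and
              f = "\<lambda>s'. ?v - multiplicity p (num s' ''t'' 0)" and
              I = "\<lambda>s'. elt s' ''pr'' 0 = ?x [^] num s' ''t'' 0 \<and> elt s' ''q'' 0 \<in> carrier G \<and>
                (\<exists>e\<le>?v. num s' ''t'' 0 = p ^ e \<and>
                  (ord (elt s' ''q'' 0) = p ^ e \<or> elt s' ''q'' 0 = ?x \<and> 0 < e \<and> ?x [^] (p ^ (e - 1)) \<noteq> \<one>)) \<and>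
                (\<forall>i'<i. (gs ! i' [^] ?r) [^] num s' ''t'' 0 = \<one>)"], goal_cases)
              case 1
              have "elt s3 ''q'' = elt s1 ''q''" "num s3 ''t'' = num s1 ''t''"
                using w(3,4) q(3,4) by simp_all
              then show ?case using w(2) q(2) t2 e1 h(2) by auto
            next
              case 2
              then show ?case using vL by simp
            next
              case (3 s')
              have in3: "input s'"
                by (rule input_frame[OF in2]) (use 3(2) w(3,4) in \<open>simp_all add: frame_def mod_pow_com\<close>)
              have fr: "num s' ''p'' 0 = p" "elt s' ''x'' 0 = ?x"
                using 3(2) w(3,4) q(2,3) p1 by (simp_all add: frame_def mod_pow_com)
              obtain e where e: "e \<le> ?v" "num s' ''t'' 0 = p ^ e" using 3(1) by blast
              have ne: "?x [^] (p ^ e) \<noteq> \<one>" using 3(1,3) e inputD(3)[OF in3] by auto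
              then have "e \<noteq> ?v" using xv[OF h(1)] by metis
              then have ev: "Suc e \<le> ?v" using e by simp
              have prev: "\<forall>i'<i. (gs ! i' [^] ?r) [^] (p ^ e * p) = \<one>"
                using 3(1) e(2) h(1) by (simp flip: nat_pow_pow)
              show ?case
                apply (simp only: wp_simps)
                apply (intro conjI)
                subgoal using teL[OF ev] e fr by (simp add: mult.commute)
                apply (rule wp_pow[OF is_group])
                subgoal using inputD[OF in3] by simp
                subgoal using fr xc by simp
                subgoal using teL[OF ev] e fr by (simp add: mult.commute)
                subgoal premises y for m4 s4
                proof -
                  have t4: "num s4 ''t'' 0 = p ^ Suc e" using y(3) e fr by (simp add: mult.commute)
                  have q4: "elt s4 ''q'' 0 = ?x" using y(4) fr by simp
                  have r4: "elt s4 ''pr'' 0 = ?x [^] (p ^ Suc e)" using y(2) e fr by (simp add: mult.commute)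
                  have "multiplicity p (p ^ Suc e) = Suc e" "multiplicity p (p ^ e) = e"
                    using p2 s(4) by (simp_all add: multiplicity_same_power prime_gt_0_nat del: power_Suc)
                  then have "?v - multiplicity p (num s4 ''t'' 0) < ?v - multiplicity p (num s' ''t'' 0)"
                    using t4 e(2) ev by simp
                  moreover have "\<exists>e\<le>?v. num s4 ''t'' 0 = p ^ e \<and>
                    (ord (elt s4 ''q'' 0) = p ^ e \<or> elt s4 ''q'' 0 = ?x \<and> 0 < e \<and> ?x [^] (p ^ (e - 1)) \<noteq> \<one>)"
                    using ev t4 q4 ne by (intro exI[of _ "Suc e"]) simp
                  moreover have "\<forall>i'<i. (gs ! i' [^] ?r) [^] num s4 ''t'' 0 = \<one>"
                    using prev t4 by (simp add: mult.commute)
                  ultimately show ?thesis using y(1) r4 t4 q4 xc by simp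
                qed
                done
            next
              case (4 m' s')
              have in3: "input s'"
                by (rule input_frame[OF in2]) (use 4(2) w(3,4) in \<open>simp_all add: frame_def mod_pow_com\<close>)
              obtain e where e: "e \<le> ?v" "num s' ''t'' 0 = p ^ e"
                "ord (elt s' ''q'' 0) = p ^ e \<or> elt s' ''q'' 0 = ?x \<and> 0 < e \<and> ?x [^] (p ^ (e - 1)) \<noteq> \<one>"
                using 4(1) by blast
              have one: "?x [^] (p ^ e) = \<one>" using 4(1,3) e inputD(3)[OF in3] by auto
              have ord: "ord (elt s' ''q'' 0) = p ^ e"
              proof (cases "ord (elt s' ''q'' 0) = p ^ e")
                case False
                then have *: "elt s' ''q'' 0 = ?x" "0 < e" "?x [^] (p ^ (e - 1)) \<noteq> \<one>" using e by auto
                have "ord ?x dvd p ^ e" using one pow_eq_id[OF xc] by simp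
                then obtain i where i: "i \<le> e" "ord ?x = p ^ i"
                  using divides_primepow_nat[OF s(4)] by blast
                have "i = e"
                proof (rule ccontr)
                  assume "i \<noteq> e"
                  then have "p ^ i dvd p ^ (e - 1)" using i by (intro le_imp_power_dvd) auto
                  then show False using * pow_eq_id[OF xc] i by simp
                qed
                then show ?thesis using i * by simp
              qed
              have "m2 + (1 + (1 + (m3 + m'))) \<le> 5 * L * L + 17 * L + 13"
                using q(1) w(1) 4(4) by (simp add: algebra_simps)
              moreover have "\<forall>i'<Suc i. (gs ! i' [^] ?r) [^] (p ^ e) = \<one>"
                using 4(1) e(2) one by (auto simp: less_Suc_eq)
              ultimately show ?case using 4(1) e ord by auto
            qed
            done
        qed
        done
    qed
    subgoal premises h for m s1
    proof (rule Q)
      have "(a [^] ?r) [^] num s1 ''t'' 0 = \<one>" if "a \<in> set gs" for a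
        using h(2) that by (auto simp: in_set_conv_nth)
      then show "leading G (set gs) n p (elt s1 ''q'' 0)"
        using h(2) by (auto simp: leading_def)
    qed (use h in \<open>simp_all add: frame_def mod_gen_part_com mod_pow_com algebra_simps\<close>)
    done
qed

definition split_inv :: "nat \<Rightarrow> state \<Rightarrow> bool" where
  "split_inv n s \<longleftrightarrow> num s ''E'' 0 = n \<and> num s ''K'' 0 * num s ''D'' 0 = n \<and>
     (\<forall>q. prime q \<longrightarrow> q dvd num s ''D'' 0 \<longrightarrow> nonnormal G (set gs) n q \<and> \<not> q dvd num s ''K'' 0) \<and>
     leading_prod G (set gs) n {q. prime q \<and> q dvd num s ''D'' 0} (elt s ''W'' 0)"

lemma wp_process:
  assumes s: "input s" "num s ''p'' 0 = p" "prime p" "p dvd n" "0 < n" "n < 2 ^ L" "split_inv n s"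
    and exponent: "\<And>x. x \<in> carrier G \<Longrightarrow> x [^] n = \<one>"
    and Q: "\<And>m s'. m \<le> length gs * (5 * L * L + 22 * L + 5 * length gs + 24) + 5 * L + 12 \<Longrightarrow>
      split_inv n s' \<Longrightarrow> num s ''D'' 0 dvd num s' ''D'' 0 \<Longrightarrow>
      (nonnormal G (set gs) n p \<longrightarrow> p dvd num s' ''D'' 0) \<Longrightarrow>
      \<forall>x. x \<notin> {''r'', ''f'', ''u'', ''v'', ''K'', ''D'', ''t'', ''pe''} \<longrightarrow> num s' x = num s x \<Longrightarrow>
      \<forall>x. x \<notin> {''pr'', ''pb'', ''x'', ''y'', ''q'', ''W''} \<longrightarrow> elt s' x = elt s x \<Longrightarrow> Q m s'"
  shows "wp G L process_com s Q"
proof -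
  have E: "num s ''E'' 0 = n" using s(7) by (simp add: split_inv_def)
  show ?thesis
    unfolding process_com_def
    apply (simp only: wp_Seq)
    apply (rule wp_part[OF s(2) E s(3,5,6)])
    subgoal premises p1 for m1 s1
    proof -
      have in1: "input s1" by (rule input_frame[OF s(1)]) (use p1(3,4) in simp_all)
      show ?thesis
        apply (rule wp_test[OF in1 p1(2) s(3-6)])
        subgoal premises p2 for m2 s2
        proof -
          have in2: "input s2" by (rule input_frame[OF in1]) (use p2(3,4) in simp_all)
          have fr: "num s2 ''p'' 0 = p" "num s2 ''K'' = num s ''K''" "num s2 ''D'' = num s ''D''"
            "num s2 ''E'' = num s ''E''" "elt s2 ''W'' = elt s ''W''" "num s2 ''r'' 0 = cofactor p n"
            using p2(3,4) p1(2-4) s(2) by simp_all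
          let ?k = "num s ''K'' 0" and ?d = "num s ''D'' 0"
          show ?thesis
          proof (cases "0 < num s2 ''f'' 0 \<and> p dvd ?k")
            case True
            have kd: "?k * ?d = n" using s(7) by (simp add: split_inv_def)
            have pd: "\<not> p dvd ?d" using True s(3,7) by (auto simp: split_inv_def)
            have nn: "nonnormal G (set gs) n p" using True p2(2) by simp
            have "wp G L (shift_com ;; lead_com ;; ''W'' ::~ EMult (Elt ''W'') (Elt ''q'')) s2
                (\<lambda>n'. (\<lambda>n''. Q (m1 + (m2 + n''))) (n' + 1))"
              apply (simp only: wp_simps)
              apply (rule wp_shift[where k = ?k and d = ?d and p = p])
              subgoal using fr by simp
              subgoal using fr by simp
              subgoal using fr by simp
              subgoal by (rule s(3))
              subgoal using kd s(5) by simp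
              subgoal using kd s(6) by simp
              subgoal premises p3 for m3 s3 e
              proof -
                have in3: "input s3" by (rule input_frame[OF in2]) (use p3(5,6) in simp_all)
                show ?thesis
                  apply (rule wp_lead[OF in3 _ _ s(3,5,6) exponent])
                  subgoal using p3(5) fr by simp
                  subgoal using p3(5) fr by simp
                  subgoal by assumption
                  subgoal premises p4 for m4 s4
                  proof -
                    let ?s = "elt_upd ''W'' 0 (elt s4 ''W'' 0 \<otimes> elt s4 ''q'' 0) s4"
                    have f4: "num s4 ''K'' = num s3 ''K''" "num s4 ''D'' = num s3 ''D''"
                      "num s4 ''E'' 0 = n" "elt s4 ''W'' = elt s ''W''"
                      using p4(3,4) p3(5,6) fr E by simp_all
                    have e0: "0 < e" using True p3(2,3) by (cases e) auto
                    have set_eq: "{q. prime q \<and> q dvd ?d * p ^ e} = insert p {q. prime q \<and> q dvd ?d}"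
                      using e0 s(3) by (auto simp: prime_dvd_mult_iff prime_dvd_power_iff primes_dvd_imp_eq)
                    have lp: "leading_prod G (set gs) n (insert p {q. prime q \<and> q dvd ?d})
                        (elt s ''W'' 0 \<otimes> elt s4 ''q'' 0)"
                      using s(3,4,7) pd p4(2) by (intro leading_prod.insert) (auto simp: split_inv_def)
                    have dv: "num s3 ''K'' 0 dvd ?k" using p3(2) by (metis dvd_triv_left)
                    have inv: "split_inv n ?s"
                      unfolding split_inv_def
                    proof (intro conjI allI impI)
                      show "num ?s ''K'' 0 * num ?s ''D'' 0 = n"
                        using f4 p3(2,4) kd by (simp add: mult.commute mult.left_commute)
                      fix q assume q: "prime q" "q dvd num ?s ''D'' 0"
                      then have "q = p \<or> q dvd ?d" using set_eq f4 p3(4) by auto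
                      then show "nonnormal G (set gs) n q" "\<not> q dvd num ?s ''K'' 0"
                        using nn p3(3) f4 q(1) s(7) dv by (auto simp: split_inv_def intro: dvd_trans)
                    qed (use f4 lp set_eq p3(4) in simp_all)
                    show ?thesis
                    proof (rule Q)
                      show "m1 + (m2 + (m3 + (m4 + 1) + 1)) \<le>
                          length gs * (5 * L * L + 22 * L + 5 * length gs + 24) + 5 * L + 12"
                        using p1(1) p2(1) p3(1) p4(1) by (simp add: algebra_simps)
                      show "split_inv n ?s" by (rule inv)
                      show "?d dvd num ?s ''D'' 0" using f4 p3(4) by simp
                      show "nonnormal G (set gs) n p \<longrightarrow> p dvd num ?s ''D'' 0"
                        using f4 p3(4) e0 by simp
                    qed (use p1(3,4) p2(3,4) p3(5,6) p4(3,4) in simp_all)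
                  qed
                  done
              qed
              done
            then show ?thesis using True fr by (simp add: wp_If)
          next
            case False
            have "nonnormal G (set gs) n p \<longrightarrow> p dvd ?d"
            proof
              assume "nonnormal G (set gs) n p"
              then have "\<not> p dvd ?k" using False p2(2) by simp
              moreover have "?k * ?d = n" using s(7) by (simp add: split_inv_def)
              then have "p dvd ?k * ?d" using s(4) by simp
              ultimately show "p dvd ?d" using prime_dvd_mult_iff[OF s(3)] by blast
            qed
            moreover have "split_inv n s2" using s(7) fr by (simp add: split_inv_def)
            moreover have "m1 + (m2 + (1 + 1)) \<le> length gs * (5 * L * L + 22 * L + 5 * length gs + 24) + 5 * L + 12"
              using p1(1) p2(1) by (simp add: algebra_simps)
            ultimately have "Q (m1 + (m2 + (1 + 1))) s2"
              using fr p1(3,4) p2(3,4) by (intro Q) simp_all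
            moreover have "\<not> bval G s2 (BAnd (ALess (Const 0) (Num ''f'')) (ADvd (Num ''p'') (Num ''K'')))"
              using False fr by simp
            ultimately show ?thesis by (simp only: wp_If wp_Skip if_False)
          qed
        qed
        done
    qed
    done
qed

abbreviation "cost_process \<equiv>
  length gs * (5 * L * L + 22 * L + 5 * length gs + 24) + 5 * L + 12"

lemma mod_process_com:
  "num_mod process_com = {''r'', ''f'', ''u'', ''v'', ''K'', ''D'', ''t'', ''pe''}"
  "elt_mod process_com = {''pr'', ''pb'', ''x'', ''y'', ''q'', ''W''}"
  by (auto simp: process_com_def part_com_def test_com_def shift_com_def lead_com_def
      mod_gen_part_com mod_pow_com)

section \<open>Trial division of the order multiples\<close>

lemma mod_factor_step_com:
  "num_mod factor_step_com = {''r'', ''f'', ''u'', ''v'', ''K'', ''D'', ''t'', ''pe'', ''nf'', ''p''}"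
  "elt_mod factor_step_com = {''pr'', ''pb'', ''x'', ''y'', ''q'', ''W''}"
  by (auto simp: factor_step_com_def mod_process_com)

lemma mod_factor_com:
  "num_mod factor_com = {''r'', ''f'', ''u'', ''v'', ''K'', ''D'', ''t'', ''pe'', ''nf'', ''p''}"
  "elt_mod factor_com = {''pr'', ''pb'', ''x'', ''y'', ''q'', ''W''}"
  by (auto simp: factor_com_def mod_factor_step_com)

text \<open>\<open>n0\<close> is the number being factored, and \<open>d\<close> the value of
  \<open>D\<close> on entry, kept so that primes found for earlier generators survive. The last
  clause says that no relevant prime of \<open>n0\<close> gets lost.\<close>

definition factor_inv :: "nat \<Rightarrow> nat \<Rightarrow> nat \<Rightarrow> state \<Rightarrow> bool" where
  "factor_inv n n0 d s \<longleftrightarrow> 0 < num s ''nf'' 0 \<and> num s ''nf'' 0 \<le> 4 * N \<and> num s ''nf'' 0 dvd n \<and>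
     2 \<le> num s ''p'' 0 \<and> (\<forall>q. prime q \<longrightarrow> q dvd num s ''nf'' 0 \<longrightarrow> num s ''p'' 0 \<le> q) \<and>
     split_inv n s \<and> d dvd num s ''D'' 0 \<and>
     (\<forall>q. prime q \<longrightarrow> q dvd n0 \<longrightarrow> nonnormal G (set gs) n q \<longrightarrow> q dvd num s ''nf'' 0 \<or> q dvd num s ''D'' 0)"

text \<open>Either a division takes at least one bit off \<open>nf\<close> with p unchanged, or p
  advances by one; in the second case p^2 is at most \<open>nf\<close>, hence at most 4|G|, and p is
  at most \<open>R\<close>. This makes the sum a decreasing measure. After the jump to the last
  prime factor, the truncated difference may be 0, but then the division applies.\<close>

lemma wp_factor_step:
  assumes s: "input s" "factor_inv n n0 d s" "1 < num s ''nf'' 0" "0 < n" "n < 2 ^ L"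
    and p: "num s ''p'' 0 = num s ''nf'' 0 \<or> num s ''p'' 0 * num s ''p'' 0 \<le> num s ''nf'' 0"
    and exponent: "\<And>x. x \<in> carrier G \<Longrightarrow> x [^] n = \<one>"
    and Q: "\<And>m s'. m \<le> cost_process + 2 \<Longrightarrow> factor_inv n n0 d s' \<Longrightarrow>
      R + 2 - num s' ''p'' 0 + floorlog 2 (num s' ''nf'' 0) <
        R + 2 - num s ''p'' 0 + floorlog 2 (num s ''nf'' 0) \<Longrightarrow> Q m s'"
  shows "wp G L factor_step_com s Q"
proof (cases "num s ''p'' 0 dvd num s ''nf'' 0")
  case True
  let ?p = "num s ''p'' 0" and ?f = "num s ''nf'' 0"
  let ?s = "num_upd ''nf'' 0 (?f div ?p) s"
  have inv: "0 < ?f" "?f \<le> 4 * N" "?f dvd n" "2 \<le> ?p" "\<And>q. prime q \<Longrightarrow> q dvd ?f \<Longrightarrow> ?p \<le> q"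
    "split_inv n s" "d dvd num s ''D'' 0" and covered: "\<And>q. prime q \<Longrightarrow> q dvd n0 \<Longrightarrow>
      nonnormal G (set gs) n q \<Longrightarrow> q dvd ?f \<or> q dvd num s ''D'' 0"
    using s(2) by (auto simp: factor_inv_def)
  have pr: "prime ?p" using prime_if_least_factor[OF inv(4) True inv(5) inv(1)] .
  have pn: "?p dvd n" using True inv(3) by (rule dvd_trans)
  have fe: "?f = ?p * (?f div ?p)" using True by simp
  have f0: "0 < ?f div ?p" using fe inv(1) by (cases "?f div ?p") auto
  have fdvd: "?f div ?p dvd ?f" using fe by (metis dvd_triv_right)
  have fle: "?f div ?p \<le> ?f" by simp
  then have fL: "?f div ?p < 2 ^ L" using inv(2) L_card by linarith
  have in1: "input ?s" by (rule input_frame[OF s(1)]) simp_all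
  have sp: "split_inv n ?s" using inv(6) by (simp add: split_inv_def)
  have "wp G L process_com ?s (\<lambda>n'. Q (1 + n' + 1))"
  proof (rule wp_process[OF in1 _ pr pn s(4,5) sp exponent], goal_cases)
    case (3 m s')
    have fr: "num s' ''p'' 0 = ?p" "num s' ''nf'' 0 = ?f div ?p" using 3(5) by simp_all
    have D: "num s ''D'' 0 dvd num s' ''D'' 0" using 3(3) by simp
    show ?case
    proof (rule Q)
      show "1 + m + 1 \<le> cost_process + 2" using 3(1) by simp
      show "factor_inv n n0 d s'"
        unfolding factor_inv_def fr
      proof (intro conjI allI impI)
        show "?f div ?p \<le> 4 * N" using fle inv(2) by linarith
        show "?f div ?p dvd n" using fdvd inv(3) by (rule dvd_trans)
        show "?p \<le> q" if "prime q" "q dvd ?f div ?p" for q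
          using inv(5) that fdvd dvd_trans by blast
        show "d dvd num s' ''D'' 0" using inv(7) D by (rule dvd_trans)
        fix q assume q: "prime q" "q dvd n0" "nonnormal G (set gs) n q"
        from covered[OF this] show "q dvd ?f div ?p \<or> q dvd num s' ''D'' 0"
        proof
          assume "q dvd ?f"
          then have "q dvd ?p \<or> q dvd ?f div ?p" using fe prime_dvd_mult_iff[OF q(1)] by metis
          then show ?thesis
          proof
            assume "q dvd ?p"
            then have "q = ?p" using q(1) pr primes_dvd_imp_eq by blast
            then show ?thesis using 3(4) q(3) by simp
          qed simp
        next
          assume "q dvd num s ''D'' 0"
          then show ?thesis using D dvd_trans by blast
        qed
      qed (use f0 inv(4) 3(2) in auto)
      show "R + 2 - num s' ''p'' 0 + floorlog 2 (num s' ''nf'' 0) <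
          R + 2 - ?p + floorlog 2 ?f"
        unfolding fr using floorlog_div_less[OF inv(4,1)] by simp
    qed
  qed simp_all
  then show ?thesis unfolding factor_step_com_def using True fL
    by (simp add: wp_If wp_Seq wp_NumAssign)
next
  case False
  let ?p = "num s ''p'' 0" and ?f = "num s ''nf'' 0"
  have pp: "?p * ?p \<le> ?f" using p False by auto
  then have pR: "?p \<le> R" using s(2) R[of ?p] by (simp add: factor_inv_def)
  have "?p \<le> ?p * ?p" by (cases ?p) auto
  moreover have "?f \<le> 4 * N" using s(2) by (simp add: factor_inv_def)
  ultimately have "?p \<le> 4 * N" using pp by linarith
  then have pL: "?p + 1 < 2 ^ L" using L_card N_pos by linarith
  have "factor_inv n n0 d (num_upd ''p'' 0 (?p + 1) s)"
  proof -
    have "?p + 1 \<le> q" if "prime q" "q dvd ?f" for q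
    proof -
      have "?p \<le> q" using s(2) that by (simp add: factor_inv_def)
      moreover have "?p \<noteq> q" using False that by blast
      ultimately show ?thesis by simp
    qed
    then show ?thesis using s(2) by (simp add: factor_inv_def split_inv_def)
  qed
  then have "Q (1 + 1) (num_upd ''p'' 0 (?p + 1) s)" by (intro Q) (use pR in simp_all)
  then show ?thesis unfolding factor_step_com_def using False pL
    by (simp add: wp_If wp_NumAssign)
qed

lemma wp_factor:
  assumes s: "input s" "num s ''a'' 0 = i" "num s ''nn'' i = n0" "0 < n0" "n0 \<le> 4 * N" "n0 dvd n"
    "0 < n" "n < 2 ^ L" "split_inv n s" "num s ''D'' 0 = d"
    and exponent: "\<And>x. x \<in> carrier G \<Longrightarrow> x [^] n = \<one>"
    and Q: "\<And>m s'. m \<le> (R + L) * (cost_process + 5) + 3 \<Longrightarrow>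
      split_inv n s' \<Longrightarrow> d dvd num s' ''D'' 0 \<Longrightarrow>
      (\<And>q. prime q \<Longrightarrow> q dvd n0 \<Longrightarrow> nonnormal G (set gs) n q \<Longrightarrow> q dvd num s' ''D'' 0) \<Longrightarrow> Q m s'"
  shows "wp G L factor_com s Q"
proof -
  have n0L: "n0 < 2 ^ L" using s(5) L_card by linarith
  show ?thesis
    unfolding factor_com_def
    apply (simp only: wp_simps)
    apply (intro conjI)
    subgoal using n0L s by simp
    subgoal using L_card N_pos by simp
    subgoal
    \<comment> \<open>Trial division starts at p = 2, which leaves \<open>R\<close> for the
      divisors, and \<open>n0\<close> has at most \<open>L\<close> bits.\<close>
    proof (rule wp_While[where F = "R + L" and k = "cost_process + 4" and
        f = "\<lambda>s'. R + 2 - num s' ''p'' 0 + floorlog 2 (num s' ''nf'' 0)" and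
        I = "factor_inv n n0 d"], goal_cases)
      case 1
      have "2 \<le> q" if "prime q" for q :: nat using that by (rule prime_ge_2_nat)
      then show ?case using s by (simp add: factor_inv_def split_inv_def)
    next
      case 2
      then show ?case using s n0L by (simp add: floorlog_leI)
    next
      case (3 s')
      have in1: "input s'"
        by (rule input_frame[OF s(1)]) (use 3(2) in \<open>simp_all add: frame_def mod_factor_step_com\<close>)
      let ?p = "num s' ''p'' 0" and ?f = "num s' ''nf'' 0"
      have f1: "1 < ?f" using 3(3) by simp
      have least: "\<And>q. prime q \<Longrightarrow> q dvd ?f \<Longrightarrow> ?p \<le> q" using 3(1) by (simp add: factor_inv_def)
      show ?case
      proof (cases "?f < ?p * ?p")
        case True
        let ?s = "num_upd ''p'' 0 ?f s'"
        have pr: "prime ?f" using prime_if_less_square[OF f1 least True] .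
        then have pf: "?p \<le> ?f" using least by simp
        have "\<And>q. prime q \<Longrightarrow> q dvd ?f \<Longrightarrow> ?f \<le> q" using pr primes_dvd_imp_eq by blast
        then have inv: "factor_inv n n0 d ?s"
          using 3(1) f1 by (simp add: factor_inv_def split_inv_def)
        have fL: "?f < 2 ^ L" using 3(1) L_card by (simp add: factor_inv_def)
        have "input ?s" by (rule input_frame[OF in1]) simp_all
        then have "wp G L factor_step_com ?s (\<lambda>n' s''. 1 + 1 + n' \<le> cost_process + 4 \<and>
            factor_inv n n0 d s'' \<and> R + 2 - num s'' ''p'' 0 + floorlog 2 (num s'' ''nf'' 0) <
            R + 2 - ?p + floorlog 2 ?f)"
          by (rule wp_factor_step[OF _ inv _ s(7,8) _ exponent]) (use f1 pf in auto)
        then show ?thesis using True fL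
          by (simp only: wp_Seq wp_If bval.simps aval.simps if_True wp_NumAssign)
      next
        case False
        have "wp G L factor_step_com s' (\<lambda>n' s''. 1 + 1 + n' \<le> cost_process + 4 \<and>
            factor_inv n n0 d s'' \<and> R + 2 - num s'' ''p'' 0 + floorlog 2 (num s'' ''nf'' 0) <
            R + 2 - ?p + floorlog 2 ?f)"
          by (rule wp_factor_step[OF in1 3(1) f1 s(7,8) _ exponent]) (use False in auto)
        then show ?thesis using False
          by (simp only: wp_Seq wp_If bval.simps aval.simps if_False wp_Skip)
      qed
    next
      case (4 m s')
      have "num s' ''nf'' 0 = 1" using 4(1,3) by (simp add: factor_inv_def)
      then have *: "split_inv n s'" "d dvd num s' ''D'' 0"
        "\<And>q. prime q \<Longrightarrow> q dvd n0 \<Longrightarrow> nonnormal G (set gs) n q \<Longrightarrow> q dvd num s' ''D'' 0"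
        using 4(1) by (auto simp: factor_inv_def)
      show ?case by (rule Q[OF _ *]) (use 4(4) in \<open>simp_all add: algebra_simps\<close>)
    qed
    done
qed

text \<open>Were p prime to the multiple found for the generator a in question, the p-element x
  obtained from a would be killed by two coprime numbers; then x is trivial and commutes with
  everything. So it suffices to factor the multiples found for the generators.\<close>

lemma nonnormal_dvd:
  assumes "nonnormal G (set gs) n p" "0 < n" "\<And>x. x \<in> carrier G \<Longrightarrow> x [^] n = \<one>"
    and "\<And>i. i < length gs \<Longrightarrow> gs ! i [^] (f i :: nat) = \<one>"
  shows "\<exists>i<length gs. p dvd f i"
proof -
  let ?r = "cofactor p n"
  obtain a b where ab: "a \<in> set gs" "b \<in> set gs" and p: "prime p"
    and ne: "(a [^] ?r) \<otimes> (b \<otimes> (a [^] ?r) \<otimes> inv b) \<noteq> (b \<otimes> (a [^] ?r) \<otimes> inv b) \<otimes> (a [^] ?r)"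
    using assms(1) by (auto simp: nonnormal_def Let_def)
  have car: "a \<in> carrier G" "b \<in> carrier G" using ab gs(2) by auto
  obtain i where i: "i < length gs" "a = gs ! i" using ab(1) by (auto simp: in_set_conv_nth)
  have "p dvd f i"
  proof (rule ccontr)
    assume "\<not> p dvd f i"
    then have "coprime (p ^ multiplicity p n) (f i)" using p by (simp add: prime_imp_coprime)
    moreover have "(a [^] ?r) [^] (p ^ multiplicity p n) = \<one>"
      using car assms(3)[of a] cofactor(1)[OF p assms(2)] by (simp add: nat_pow_pow)
    moreover have "(a [^] ?r) [^] f i = \<one>"
    proof -
      have "(a [^] ?r) [^] f i = (a [^] f i) [^] ?r" using car by (simp add: nat_pow_pow mult.commute)
      then show ?thesis using assms(4)[OF i(1)] i(2) by simp
    qed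
    ultimately have "a [^] ?r \<in> {\<one>}" using coprime_pow_mem[OF triv_subgroup] car by simp
    then show False using ne car by simp
  qed
  then show ?thesis using i by blast
qed

lemma wp_split:
  assumes s: "input s" "num s ''E'' 0 = n" "0 < n" "n < 2 ^ L"
    and nn: "\<And>i. i < length gs \<Longrightarrow> 0 < num s ''nn'' i \<and> num s ''nn'' i \<le> 4 * N \<and>
      num s ''nn'' i dvd n \<and> gs ! i [^] num s ''nn'' i = \<one>"
    and exponent: "\<And>x. x \<in> carrier G \<Longrightarrow> x [^] n = \<one>"
    and Q: "\<And>m s'. m \<le> length gs * ((R + L) * (cost_process + 5) + 5) + 5 \<Longrightarrow> input s' \<Longrightarrow>
      split_inv n s' \<Longrightarrow> (\<And>q. nonnormal G (set gs) n q \<Longrightarrow> q dvd num s' ''D'' 0) \<Longrightarrow> Q m s'"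
  shows "wp G L split_com s Q"
  unfolding split_com_def
  apply (simp only: wp_simps)
  apply (intro conjI)
  subgoal using s by simp
  subgoal using length_less by simp
  apply (rule wp_for[where n = "length gs" and k = "(R + L) * (cost_process + 5) + 3" and
    I = "\<lambda>i s'. split_inv n s' \<and> (\<forall>i'<i. \<forall>q. prime q \<longrightarrow> q dvd num s ''nn'' i' \<longrightarrow>
      nonnormal G (set gs) n q \<longrightarrow> q dvd num s' ''D'' 0)"])
  subgoal by (simp add: mod_factor_com)
  subgoal by simp
  subgoal by (simp add: mod_factor_com)
  subgoal using inputD[OF s(1)] by simp
  subgoal by (rule length_less)
  subgoal
  proof -
    have e: "{q::nat. prime q \<and> q dvd 1} = {}" by auto
    have "leading_prod G (set gs) n {q::nat. prime q \<and> q dvd 1} \<one>"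
      unfolding e by (rule leading_prod.empty)
    then show ?thesis using s inputD(3)[OF s(1)] by (auto simp: split_inv_def)
  qed
  subgoal premises h for i s1
  proof -
    have in1: "input s1"
      by (rule input_frame[OF s(1)]) (use h(3) in \<open>simp_all add: frame_def mod_factor_com\<close>)
    have n1: "num s1 ''nn'' i = num s ''nn'' i" using h(3) by (simp add: frame_def mod_factor_com)
    show ?thesis
    proof (rule wp_factor[OF in1 h(4) n1 _ _ _ s(3,4) _ refl exponent], goal_cases)
      case (6 m s')
      have "q dvd num s' ''D'' 0" if "i' < Suc i" "prime q" "q dvd num s ''nn'' i'" "nonnormal G (set gs) n q" for i' q
      proof (cases "i' = i")
        case True
        then show ?thesis using 6(4) that by simp
      next
        case False
        then have "i' < i" using that by simp
        then have "q dvd num s1 ''D'' 0" using h(2) that by blast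
        then show ?thesis using 6(3) dvd_trans by blast
      qed
      moreover have "split_inv n (num_upd ''a'' 0 (Suc i) s')" using 6(2) by (simp add: split_inv_def)
      ultimately show ?case using 6(1) by simp
    qed (use nn[OF h(1)] h(2) in auto)
  qed
  subgoal premises h for m s1
  proof (rule Q)
    show "1 + (1 + (1 + m)) \<le> length gs * ((R + L) * (cost_process + 5) + 5) + 5"
      using h(1) by (simp add: algebra_simps)
    show "input s1"
      by (rule input_frame[OF s(1)]) (use h(3) in \<open>simp_all add: frame_def mod_factor_com\<close>)
    show "split_inv n s1" using h(2) by blast
    fix q assume q: "nonnormal G (set gs) n q"
    then obtain i where "i < length gs" "q dvd num s ''nn'' i"
      using nonnormal_dvd[OF q s(3) exponent, of "num s ''nn''"] nn by blast
    moreover have "prime q" using q by (simp add: nonnormal_def)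
    ultimately show "q dvd num s1 ''D'' 0" using h(2) q by blast
  qed
  done

section \<open>Listing the conjugates of the commutators\<close>

abbreviation conj_pow :: "bitstring \<Rightarrow> nat \<Rightarrow> bitstring \<Rightarrow> bitstring" where
  "conj_pow z t c \<equiv> z [^] t \<otimes> c \<otimes> inv (z [^] t)"

abbreviation commutator :: "nat \<Rightarrow> nat \<Rightarrow> bitstring" where
  "commutator i j \<equiv> gs ! i \<otimes> gs ! j \<otimes> inv (gs ! i) \<otimes> inv (gs ! j)"

lemma conj_pow_Suc:
  assumes "z \<in> carrier G" "c \<in> carrier G"
  shows "z \<otimes> conj_pow z t c \<otimes> inv z = conj_pow z (Suc t) c"
  using assms nat_pow_Suc2[of z t] by (simp add: m_assoc inv_mult_group del: nat_pow_Suc)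

text \<open>After the first return to c the sequence of conjugates repeats, so the finite list
  written by the loop is the orbit under all powers of z.\<close>

lemma conj_pow_periodic:
  assumes z: "z \<in> carrier G" "c \<in> carrier G" and t: "0 < t" "conj_pow z t c = c"
  shows "conj_pow z j c \<in> (\<lambda>i. conj_pow z i c) ` {..<t}"
proof (induction j)
  case 0
  then show ?case using t(1) by blast
next
  case (Suc j)
  then obtain i where i: "i < t" "conj_pow z j c = conj_pow z i c" by auto
  then have "conj_pow z (Suc j) c = conj_pow z (Suc i) c"
    using conj_pow_Suc[OF z, of j] conj_pow_Suc[OF z, of i] by simp
  also have "\<dots> \<in> (\<lambda>i. conj_pow z i c) ` {..<t}"
  proof (cases "Suc i = t")
    case True
    then have "conj_pow z (Suc i) c = conj_pow z 0 c" using t z by simp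
    then show ?thesis using t(1) by blast
  next
    case False
    then have "Suc i < t" using i by simp
    then show ?thesis by blast
  qed
  finally show ?case .
qed

text \<open>The hypothesis on orbits bounds by \<open>R\<close> any number of steps without a return
  to the commutator. It thereby serves three times: for termination, for the running time and for
  the space in the output array.\<close>

lemma wp_orbit:
  assumes s: "input s" "num s ''u'' 0 = i" "num s ''v'' 0 = j" "i < length gs" "j < length gs"
      "elt s ''z'' 0 = z" "z \<in> carrier G" "num s ''M'' 0 + R < 2 ^ L"
    and orbit: "\<And>t. (\<And>t'. 0 < t' \<Longrightarrow> t' < t \<Longrightarrow> conj_pow z t' (commutator i j) \<noteq> commutator i j) \<Longrightarrow> t \<le> R"
    and Q: "\<And>m s'. m \<le> 4 * R + 5 \<Longrightarrow> num s' ''M'' 0 \<le> num s ''M'' 0 + R \<Longrightarrow>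
      elt s' ''M'' ` {..<num s' ''M'' 0} = elt s ''M'' ` {..<num s ''M'' 0} \<union>
        range (\<lambda>t. conj_pow z t (commutator i j)) \<Longrightarrow>
      \<forall>x. x \<notin> {''M''} \<longrightarrow> num s' x = num s x \<Longrightarrow>
      \<forall>x. x \<notin> {''M'', ''x'', ''y''} \<longrightarrow> elt s' x = elt s x \<Longrightarrow> Q m s'"
  shows "wp G L orbit_com s Q"
proof -
  let ?c = "commutator i j" and ?M = "num s ''M'' 0"
  have cc: "?c \<in> carrier G" using s by simp
  have gij: "elt s ''g'' i = gs ! i" "elt s ''g'' j = gs ! j" using inputD(2)[OF s(1)] s by auto
  \<comment> \<open>For \<open>t = 1\<close> there is no exponent strictly between 0 and
    \<open>t\<close>, so the premise of the orbit bound is vacuous.\<close>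
  have R1: "1 \<le> R" using orbit[of 1] by simp
  show ?thesis
    unfolding orbit_com_def
    apply (simp only: wp_simps s(2,3) gij)
    apply (intro conjI)
    subgoal using s(8) R1 by simp
    subgoal
    proof (rule wp_While[where F = R and k = 3 and f = "\<lambda>s'. ?M + R - num s' ''M'' 0" and
      I = "\<lambda>s'. \<exists>t. 0 < t \<and> num s' ''M'' 0 = ?M + t \<and> elt s' ''y'' 0 = conj_pow z t ?c \<and>
        (\<forall>t'. 0 < t' \<longrightarrow> t' < t \<longrightarrow> conj_pow z t' ?c \<noteq> ?c) \<and>
        elt s' ''M'' ` {..<num s' ''M'' 0} = elt s ''M'' ` {..<?M} \<union> (\<lambda>t. conj_pow z t ?c) ` {..<t}"],
      goal_cases)
      case 1
      have "conj_pow z 0 ?c = ?c" using s(4,5) by simp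
      then have "(\<lambda>t. conj_pow z t ?c) ` {..<1} = {?c}" by (auto simp: lessThan_Suc)
      then show ?case using s(6,7)
        by (intro exI[of _ 1]) (simp add: image_upd fun_upd_same del: fun_upd_apply)
    next
      case 2
      then show ?case by simp
    next
      case (3 s')
      obtain t where t: "0 < t" "num s' ''M'' 0 = ?M + t" "elt s' ''y'' 0 = conj_pow z t ?c"
        "\<And>t'. 0 < t' \<Longrightarrow> t' < t \<Longrightarrow> conj_pow z t' ?c \<noteq> ?c"
        "elt s' ''M'' ` {..<num s' ''M'' 0} = elt s ''M'' ` {..<?M} \<union> (\<lambda>t. conj_pow z t ?c) ` {..<t}"
        using 3(1) by blast
      have fr: "elt s' ''z'' 0 = z" "elt s' ''x'' 0 = ?c" using 3(2) s by (simp_all add: frame_def)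
      have ne: "conj_pow z t ?c \<noteq> ?c" using 3(3) fr t(3) by simp
      have new: "conj_pow z t' ?c \<noteq> ?c" if "0 < t'" "t' < Suc t" for t'
        using t(4)[of t'] ne that by (cases "t' = t") auto
      have tR: "Suc t \<le> R" by (rule orbit) (rule new)
      have y: "z \<otimes> conj_pow z t ?c \<otimes> inv z = conj_pow z (Suc t) ?c"
        by (rule conj_pow_Suc[OF s(7) cc])
      have im: "((elt s' ''M'')(?M + t := conj_pow z t ?c)) ` {..<Suc (?M + t)} =
          elt s ''M'' ` {..<?M} \<union> (\<lambda>t. conj_pow z t ?c) ` {..<Suc t}"
        unfolding image_upd using t(2,5) by (simp add: lessThan_Suc)
      have L1: "?M + t + 1 < 2 ^ L" using s(8) tR by linarith
      show ?case
        apply (simp only: wp_simps t(2,3) fr y)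
        apply (intro conjI)
        subgoal by (rule L1)
        subgoal by simp
        subgoal
          apply (rule exI[of _ "Suc t"])
          using new im by (simp add: fun_upd_same del: fun_upd_apply nat_pow_Suc)
        subgoal using tR by simp
        done
    next
      case (4 m s')
      obtain t where t: "0 < t" "num s' ''M'' 0 = ?M + t" "elt s' ''y'' 0 = conj_pow z t ?c"
        "\<And>t'. 0 < t' \<Longrightarrow> t' < t \<Longrightarrow> conj_pow z t' ?c \<noteq> ?c"
        "elt s' ''M'' ` {..<num s' ''M'' 0} = elt s ''M'' ` {..<?M} \<union> (\<lambda>t. conj_pow z t ?c) ` {..<t}"
        using 4(1) by blast
      have fr: "elt s' ''x'' 0 = ?c" using 4(2) s by (simp add: frame_def)
      have per: "conj_pow z t ?c = ?c" using 4(3) fr t(3) by simp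
      have rng: "(\<lambda>t. conj_pow z t ?c) ` {..<t} = range (\<lambda>t. conj_pow z t ?c)"
        using conj_pow_periodic[OF s(7) cc t(1) per] by auto
      have tR: "t \<le> R" by (rule orbit) (rule t(4))
      show ?case
      proof (rule Q)
        show "elt s' ''M'' ` {..<num s' ''M'' 0} =
            elt s ''M'' ` {..<?M} \<union> range (\<lambda>t. conj_pow z t ?c)"
          using t(5) rng by simp
      qed (use 4(2,4) t(2) tR in \<open>simp_all add: frame_def\<close>)
    qed
    done
qed

lemma mod_orbit_com: "num_mod orbit_com = {''M''}" "elt_mod orbit_com = {''M'', ''x'', ''y''}"
  by (auto simp: orbit_com_def)

lemma output_index_less:
  assumes "i < length gs" "M \<le> i * (1 + length gs * R) + 1 + j * R" "j < length gs"
  shows "M + R < 2 ^ L"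
proof -
  let ?g = "length gs"
  have "(j + 1) * R \<le> ?g * R" using assms(3) by (intro mult_right_mono) auto
  then have "M + R \<le> (i + 1) * (1 + ?g * R)" using assms(2) by (simp add: algebra_simps)
  also have "\<dots> \<le> ?g * (1 + ?g * R)" using assms(1) by (intro mult_right_mono) auto
  also have "\<dots> \<le> (?g * ?g + ?g) * (R + 2)" by (simp add: algebra_simps)
  finally show ?thesis using L_output by linarith
qed

lemma wp_output:
  assumes s: "input s" "elt s ''W'' 0 = w" "num s ''K'' 0 = k" "num s ''D'' 0 = d" "k < 2 ^ L" "d < 2 ^ L"
      "w \<in> carrier G"
    and orbit: "\<And>i j t. i < length gs \<Longrightarrow> j < length gs \<Longrightarrow>
      (\<And>t'. 0 < t' \<Longrightarrow> t' < t \<Longrightarrow> conj_pow (w [^] k) t' (commutator i j) \<noteq> commutator i j) \<Longrightarrow> t \<le> R"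
    and Q: "\<And>m s'. m \<le> length gs * (5 * L + length gs * (4 * R + 7) + 10) + 5 * L + 8 \<Longrightarrow>
      elt s' ''z'' 0 = w [^] k \<Longrightarrow>
      elt s' ''M'' ` {..<num s' ''M'' 0} = {gs ! i [^] d | i. i < length gs} \<union>
        {conj_pow (w [^] k) t (commutator i j) | i j t. i < length gs \<and> j < length gs} \<Longrightarrow> Q m s'"
  shows "wp G L output_com s Q"
proof -
  let ?g = "length gs" and ?z = "w [^] k"
  have z: "?z \<in> carrier G" using s by simp
  \<comment> \<open>The elements written after all rounds below \<open>i\<close> of the outer loop
    and \<open>j\<close> rounds of the inner one. The power of generator i itself is not included;
    the inner invariant inserts it separately.\<close>
  define T where "T i j = {gs ! i' [^] d | i'. i' < i} \<union>
    {conj_pow ?z t (commutator i' j') | i' j' t. i' < i \<and> j' < ?g} \<union>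
    {conj_pow ?z t (commutator i j') | j' t. j' < j}" for i j
  have T_Suc: "T i (Suc j) = T i j \<union> range (\<lambda>t. conj_pow ?z t (commutator i j))" for i j
    unfolding T_def by (auto simp: less_Suc_eq)
  have T_next: "T (Suc i) 0 = insert (gs ! i [^] d) (T i ?g)" for i
    unfolding T_def by (auto simp: less_Suc_eq)
  show ?thesis
    unfolding output_com_def
    apply (simp only: wp_simps s(3))
    apply (rule conjI)
    subgoal by (rule s(5))
    apply (rule wp_pow[OF is_group])
    subgoal using inputD[OF s(1)] by simp
    subgoal using s by simp
    subgoal using s by simp
    subgoal premises p for m1 s1
    proof -
      have in1: "input s1" by (rule input_frame[OF s(1)]) (use p(3,4) in simp_all)
      have z1: "elt s1 ''pr'' 0 = ?z" using p(2) s by simp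
      have d1: "num s1 ''D'' 0 = d" using p(3) s by simp
      show ?thesis
        apply (rule conjI)
        subgoal by simp
        apply (rule wp_for[where n = ?g and k = "5 * L + ?g * (4 * R + 7) + 8" and
          I = "\<lambda>i s'. num s' ''M'' 0 \<le> i * (1 + ?g * R) \<and> elt s' ''z'' 0 = ?z \<and>
            elt s' ''M'' ` {..<num s' ''M'' 0} = T i 0"])
        subgoal by (simp add: mod_pow_com mod_orbit_com)
        subgoal by simp
        subgoal by (simp add: mod_pow_com mod_orbit_com)
        subgoal using inputD[OF in1] by simp
        subgoal by (rule length_less)
        subgoal using z1 by (simp add: T_def)
        subgoal premises h for i s2
        proof -
          have in2: "input s2"
            by (rule input_frame[OF in1]) (use h(3) in \<open>simp_all add: frame_def mod_pow_com mod_orbit_com\<close>)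
          have d2: "num s2 ''D'' 0 = d" using h(3) d1 by (simp add: frame_def mod_pow_com mod_orbit_com)
          have gi: "elt s2 ''g'' i = gs ! i" using inputD(2)[OF in2 h(1)] .
          show ?thesis
            apply (simp only: wp_simps d2)
            apply (rule conjI)
            subgoal by (rule s(6))
            apply (rule wp_pow[OF is_group])
            subgoal using inputD[OF in2] by simp
            subgoal using gi h by simp
            subgoal using s by simp
            subgoal premises q for m3 s3
            proof -
              have in3: "input s3" by (rule input_frame[OF in2]) (use q(3,4) in simp_all)
              have pr: "elt s3 ''pr'' 0 = gs ! i [^] d" using q(2) gi h(4) d2 by simp
              have M3: "num s3 ''M'' 0 = num s2 ''M'' 0" "elt s3 ''M'' = elt s2 ''M''"
                "elt s3 ''z'' 0 = ?z" "num s3 ''u'' 0 = i"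
                using q(3,4) h(2,4) by simp_all
              have Mb: "num s2 ''M'' 0 + 1 + R < 2 ^ L"
                using h(1,2) by (intro output_index_less[of i _ 0]) auto
              show ?thesis
                apply (rule conjI)
                subgoal using Mb M3 by simp
                apply (rule wp_for[where n = ?g and k = "4 * R + 5" and
                  I = "\<lambda>j s'. num s' ''M'' 0 \<le> i * (1 + ?g * R) + 1 + j * R \<and> elt s' ''z'' 0 = ?z \<and>
                    elt s' ''M'' ` {..<num s' ''M'' 0} = insert (gs ! i [^] d) (T i j)"])
                subgoal by (simp add: mod_orbit_com)
                subgoal by simp
                subgoal by (simp add: mod_orbit_com)
                subgoal using inputD[OF in3] by simp
                subgoal by (rule length_less)
                subgoal using h(2) M3 pr by (simp add: image_upd fun_upd_same del: fun_upd_apply)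
                subgoal premises v for j s4
                proof -
                  have in4: "input s4"
                    by (rule input_frame[OF in3]) (use v(3) in \<open>simp_all add: frame_def mod_orbit_com\<close>)
                  have u4: "num s4 ''u'' 0 = i" using v(3) M3 by (simp add: frame_def mod_orbit_com)
                  have z4: "elt s4 ''z'' 0 = ?z" using v(2) by blast
                  have M4: "num s4 ''M'' 0 + R < 2 ^ L"
                    using output_index_less[OF h(1) _ v(1)] v(2) by blast
                  show ?thesis
                  proof (rule wp_orbit[OF in4 u4 v(4) h(1) v(1) z4 z M4 orbit[OF h(1) v(1)]], goal_cases)
                    case (2 m s')
                    then show ?case using v(2) by (simp add: T_Suc)
                  qed
                qed
                subgoal premises v for m4 s4
                  using v(1,2) q(1) by (simp add: T_next algebra_simps)
                done
            qed
            done
        qed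
        subgoal premises h for m2 s2
        proof (rule Q)
          show "elt s2 ''z'' 0 = ?z" using h(2) by blast
          show "elt s2 ''M'' ` {..<num s2 ''M'' 0} = {gs ! i [^] d | i. i < ?g} \<union>
              {conj_pow ?z t (commutator i j) | i j t. i < ?g \<and> j < ?g}"
            using h(2) by (simp add: T_def)
          show "1 + (1 + (m1 + (1 + (1 + m2)))) \<le> ?g * (5 * L + ?g * (4 * R + 7) + 10) + 5 * L + 8"
            using h(1) p(1) by (simp add: algebra_simps)
        qed
        done
    qed
    done
qed

text \<open>The three summands are the costs of \<open>exponent_com\<close>,
  \<open>split_com\<close> and \<open>output_com\<close>. Since \<open>U\<close> dominates 1,
  \<open>L\<close> and \<open>g\<close>, each is at most a constant times
  \<open>(R + 1) * U ^ 5\<close>; the constants 45, 88 and 35 add up to less than 200.\<close>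

lemma cost_bound:
  fixes g :: nat
  defines "U \<equiv> L + g + 1"
  shows "(g * g + g) * ((L + 1) * (L + 1) * (31 * R + 31) + 8) + 6 +
    (g * ((R + L) * (g * (5 * L * L + 22 * L + 5 * g + 24) + 5 * L + 12 + 5) + 5) + 5) +
    (g * (5 * L + g * (4 * R + 7) + 10) + 5 * L + 8) \<le> 200 * (R + 1) * U ^ 5"
proof -
  define r where "r = R + 1"
  have U: "1 \<le> U" "g \<le> U" "L \<le> U" "L + 1 \<le> U" "1 \<le> r" by (simp_all add: U_def r_def)
  have p: "U ^ i \<le> U ^ j" if "i \<le> j" for i j using that U(1) by (rule power_increasing)
  have m: "a * b \<le> U ^ i * U ^ j" if "a \<le> U ^ i" "b \<le> U ^ j" for a b i j
    using that by (rule mult_mono) auto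
  have gg: "g * g + g \<le> U ^ 2"
  proof -
    have "g * (g + 1) \<le> U * U" unfolding U_def by (intro mult_mono) auto
    then show ?thesis by (simp add: power2_eq_square)
  qed
  have LL: "(L + 1) * (L + 1) \<le> U ^ 2" using m[of "L + 1" 1 "L + 1" 1] U by (simp add: power2_eq_square)
  have first: "(g * g + g) * ((L + 1) * (L + 1) * (31 * R + 31) + 8) + 6 \<le> 45 * r * U ^ 5"
  proof -
    have "(L + 1) * (L + 1) * (31 * R + 31) \<le> U ^ 2 * (31 * r)"
      using LL by (rule mult_mono) (auto simp: r_def)
    moreover have "1 \<le> U ^ 2 * r" using U by simp
    ultimately have "(L + 1) * (L + 1) * (31 * R + 31) + 8 \<le> 39 * (U ^ 2 * r)" by linarith
    then have "(g * g + g) * ((L + 1) * (L + 1) * (31 * R + 31) + 8) \<le> U ^ 2 * (39 * (U ^ 2 * r))"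
      using gg by (intro mult_mono) auto
    also have "\<dots> = 39 * r * U ^ 4" by (simp add: algebra_simps flip: power_add)
    also have "\<dots> \<le> 39 * r * U ^ 5" by (intro mult_left_mono p) auto
    finally have "(g * g + g) * ((L + 1) * (L + 1) * (31 * R + 31) + 8) \<le> 39 * r * U ^ 5" .
    moreover have "1 \<le> r * U ^ 5" using mult_mono[of 1 r 1 "U ^ 5"] U by simp
    ultimately show ?thesis by linarith
  qed
  have second: "g * ((R + L) * (g * (5 * L * L + 22 * L + 5 * g + 24) + 5 * L + 12 + 5) + 5) + 5 \<le> 88 * r * U ^ 5"
  proof -
    have "5 * L * L + 22 * L + 5 * g + 24 \<le> 56 * U ^ 2"
    proof -
      have "L * L \<le> U ^ 2" using U by (simp add: power2_eq_square mult_mono)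
      moreover have "L \<le> U ^ 2" "g \<le> U ^ 2" using p[of 1 2] U by auto
      moreover have "1 \<le> U ^ 2" using U by simp
      ultimately show ?thesis by (simp add: mult.assoc)
    qed
    then have "g * (5 * L * L + 22 * L + 5 * g + 24) \<le> U * (56 * U ^ 2)"
      using U by (intro mult_mono) auto
    then have "g * (5 * L * L + 22 * L + 5 * g + 24) \<le> 56 * U ^ 3"
      by (simp add: power3_eq_cube power2_eq_square)
    moreover have "L \<le> U ^ 3" "1 \<le> U ^ 3" using p[of 1 3] U by auto
    ultimately have "g * (5 * L * L + 22 * L + 5 * g + 24) + 5 * L + 12 + 5 \<le> 78 * U ^ 3" by linarith
    moreover have "R + L \<le> r * U"
    proof -
      have "(R + 1) * (L + 1) \<le> r * U" using U by (intro mult_mono) (auto simp: r_def)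
      then show ?thesis by simp
    qed
    ultimately have "(R + L) * (g * (5 * L * L + 22 * L + 5 * g + 24) + 5 * L + 12 + 5) \<le> (r * U) * (78 * U ^ 3)"
      by (intro mult_mono) auto
    also have "\<dots> = 78 * r * U ^ 4" by (simp add: power_numeral_reduce)
    finally have "(R + L) * (g * (5 * L * L + 22 * L + 5 * g + 24) + 5 * L + 12 + 5) \<le> 78 * r * U ^ 4" .
    moreover have "1 \<le> r * U ^ 4" using mult_mono[of 1 r 1 "U ^ 4"] U by simp
    ultimately have "(R + L) * (g * (5 * L * L + 22 * L + 5 * g + 24) + 5 * L + 12 + 5) + 5 \<le> 83 * r * U ^ 4"
      by linarith
    then have "g * ((R + L) * (g * (5 * L * L + 22 * L + 5 * g + 24) + 5 * L + 12 + 5) + 5) \<le> U * (83 * r * U ^ 4)"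
      using U by (intro mult_mono) auto
    also have "\<dots> = 83 * r * U ^ 5" by (simp add: power_numeral_reduce)
    finally have "g * ((R + L) * (g * (5 * L * L + 22 * L + 5 * g + 24) + 5 * L + 12 + 5) + 5) \<le> 83 * r * U ^ 5" .
    moreover have "1 \<le> r * U ^ 5" using mult_mono[of 1 r 1 "U ^ 5"] U by simp
    ultimately show ?thesis by linarith
  qed
  have third: "g * (5 * L + g * (4 * R + 7) + 10) + 5 * L + 8 \<le> 35 * r * U ^ 5"
  proof -
    have ru: "1 \<le> r * U" "L \<le> r * U" using U mult_mono[of 1 r 1 U] mult_mono[of 1 r L U] by auto
    have "g * (4 * R + 7) \<le> U * (7 * r)" using U by (intro mult_mono) (auto simp: r_def)
    then have "g * (4 * R + 7) \<le> 7 * (r * U)" by (simp add: mult.commute mult.left_commute)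
    then have "5 * L + g * (4 * R + 7) + 10 \<le> 22 * (r * U)" using ru by linarith
    then have "g * (5 * L + g * (4 * R + 7) + 10) \<le> U * (22 * (r * U))"
      using U by (intro mult_mono) auto
    also have "\<dots> = 22 * r * U ^ 2" by (simp add: power2_eq_square)
    also have "\<dots> \<le> 22 * r * U ^ 5" by (intro mult_left_mono p) auto
    finally have a: "g * (5 * L + g * (4 * R + 7) + 10) \<le> 22 * r * U ^ 5" .
    have "r * U ^ 1 \<le> r * U ^ 5" by (intro mult_left_mono p) auto
    then have "L \<le> r * U ^ 5" "1 \<le> r * U ^ 5" using ru unfolding power_one_right by linarith+
    then show ?thesis using a by linarith
  qed
  have "45 * r * U ^ 5 + 88 * r * U ^ 5 + 35 * r * U ^ 5 \<le> 200 * r * U ^ 5" by simp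
  then show ?thesis using first second third unfolding r_def by linarith
qed

section \<open>The whole program\<close>

lemma num_bounded_initial: "num_bounded L (initial_state gs)"
  using length_less by (auto simp: num_bounded_def initial_state_def)

lemma input_initial: "input (initial_state gs)"
  by (simp add: input_def initial_state_def)

lemma wp_main:
  assumes "in_class_S G"
  shows "wp G L main_com (initial_state gs) (\<lambda>m s.
    m \<le> 200 * (R + 1) * (L + length gs + 1) ^ 5 \<and>
    output_z s \<in> carrier G \<and> output_M s \<subseteq> carrier G \<and>
    (generate G (output_M s), generate G {output_z s}) \<in> standard_decompositions G)"
proof -
  obtain A0 m0 where ext: "coprime_extension G A0 m0"
    using in_class_S_imp_coprime_extension[OF assms] by blast
  show ?thesis
    unfolding main_com_def
    apply (simp only: wp_Seq)
    apply (rule wp_exponent[OF input_initial])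
    subgoal premises p1 for m1 s1
    proof -
      obtain e where e: "num s1 ''E'' 0 = e * e" "0 < e" "\<forall>a\<in>set gs. a [^] e = \<one>"
        "\<forall>a\<in>set gs. \<forall>b\<in>set gs. (a \<otimes> b \<otimes> inv a \<otimes> inv b) [^] e = \<one>"
        and nn: "\<And>i. i < length gs \<Longrightarrow> 0 < num s1 ''nn'' i \<and> num s1 ''nn'' i \<le> 4 * N \<and>
          num s1 ''nn'' i dvd e \<and> gs ! i [^] num s1 ''nn'' i = \<one>"
        using p1(2) by blast
      let ?n = "e * e"
      have exponent: "x [^] ?n = \<one>" if "x \<in> carrier G" for x
        using coprime_extension.exponent_multiple[OF ext gs(2,3) _ _ that] e(3,4) by blast
      have n: "0 < ?n" "?n < 2 ^ L" using e p1(3) by auto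
      show ?thesis
      proof (rule wp_split[OF p1(4) e(1) n _ exponent], goal_cases)
        case (1 i)
        then show ?case using nn[OF 1] by simp
      next
        case (3 m2 s2)
        let ?k = "num s2 ''K'' 0" and ?d = "num s2 ''D'' 0" and ?w = "elt s2 ''W'' 0"
        have kd: "?k * ?d = ?n" using 3(3) by (simp add: split_inv_def)
        have primes: "q dvd ?d \<longleftrightarrow> nonnormal G (set gs) (?k * ?d) q" if "prime q" for q
          using 3(3,4) that unfolding kd split_inv_def by blast
        have cop: "coprime ?k ?d"
          by (rule coprime_if_no_common_prime) (use 3(3) in \<open>auto simp: split_inv_def\<close>)
        have lp: "leading_prod G (set gs) (?k * ?d) {q. prime q \<and> q dvd ?d} ?w"
          using 3(3) unfolding kd by (simp add: split_inv_def)
        have kd0: "0 < ?k * ?d" "\<And>x. x \<in> carrier G \<Longrightarrow> x [^] (?k * ?d) = \<one>"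
          unfolding kd using n exponent by auto
        obtain A m where A: "coprime_extension G A m" "?w [^] ?k \<in> carrier G"
          "(?w [^] ?k) [^] m = \<one>" "(A, generate G {?w [^] ?k}) \<in> standard_decompositions G"
          and gen: "generate G ({a [^] ?d | a. a \<in> set gs} \<union>
            {conj_pow (?w [^] ?k) j (a \<otimes> b \<otimes> inv a \<otimes> inv b) | a b j. a \<in> set gs \<and> b \<in> set gs}) = A"
          using standard_decomposition[OF ext gs(2,3) kd0 cop primes lp refl] by blast
        interpret A: coprime_extension G A m by fact
        have wc: "?w \<in> carrier G"
          using coprime_extension.leading_prod_rcos[OF ext kd0 lp] by blast
        have k0: "0 < ?k" "0 < ?d" using kd0(1) by auto
        have "?k \<le> ?k * ?d" "?d \<le> ?k * ?d" using k0 by auto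
        then have kL: "?k < 2 ^ L" "?d < 2 ^ L" using n(2) kd by linarith+
        have orbit: "t \<le> R" if "i < length gs" "j < length gs"
          "\<And>t'. 0 < t' \<Longrightarrow> t' < t \<Longrightarrow> conj_pow (?w [^] ?k) t' (commutator i j) \<noteq> commutator i j" for i j t
        proof -
          have "t * t \<le> N"
            by (rule A.orbit_length[OF A(2,3) A.commutator_mem that(3)]) (use that in auto)
          then show ?thesis using R[of t] by simp
        qed
        show ?case
        proof (rule wp_output[OF 3(2) refl refl refl kL wc orbit], goal_cases)
          case (4 m3 s3)
          have z: "output_z s3 = ?w [^] ?k" using 4(2) by (simp add: output_z_def)
          have M: "output_M s3 = {a [^] ?d | a. a \<in> set gs} \<union>
            {conj_pow (?w [^] ?k) j (a \<otimes> b \<otimes> inv a \<otimes> inv b) | a b j. a \<in> set gs \<and> b \<in> set gs}"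
            unfolding output_M_def 4(3) by (force simp: in_set_conv_nth)
          have Mc: "output_M s3 \<subseteq> carrier G" unfolding M using gs(2) A(2) by (auto simp: subset_iff)
          have "m1 + (m2 + m3) \<le> 200 * (R + 1) * (L + length gs + 1) ^ 5"
            using cost_bound[of "length gs"] p1(1) 3(1) 4(1) by linarith
          then show ?case using z M Mc A(2,4) gen by simp
        qed
      qed
    qed
    done
qed

text \<open>Passing from counted steps to logarithmic cost multiplies the bound by
  \<open>cweight main_com * L\<close>, which raises the fifth power to a sixth.\<close>

lemma exec_main:
  assumes "in_class_S G"
  shows "\<exists>t s. exec G main_com (initial_state gs) t s \<and>
    t \<le> 200 * cweight main_com * (R + 1) * (L + length gs + 1) ^ 6 \<and>
    output_z s \<in> carrier G \<and> output_M s \<subseteq> carrier G \<and>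
    (generate G (output_M s), generate G {output_z s}) \<in> standard_decompositions G"
proof -
  obtain m s where run: "run G L main_com (initial_state gs) m s"
    and m: "m \<le> 200 * (R + 1) * (L + length gs + 1) ^ 5"
    and out: "output_z s \<in> carrier G" "output_M s \<subseteq> carrier G"
      "(generate G (output_M s), generate G {output_z s}) \<in> standard_decompositions G"
    using wp_main[OF assms] unfolding wp_def by blast
  have "1 \<le> L" using length_less(2) by (cases L) auto
  then obtain t where t: "exec G main_com (initial_state gs) t s" "t \<le> m * (cweight main_com * L)"
    using run_imp_exec[OF run num_bounded_initial] by blast
  note t(2)
  also have "m * (cweight main_com * L) \<le>
      200 * (R + 1) * (L + length gs + 1) ^ 5 * (cweight main_com * (L + length gs + 1))"
    using m by (intro mult_mono) auto
  also have "\<dots> = 200 * cweight main_com * (R + 1) * (L + length gs + 1) ^ Suc 5"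
    unfolding power_Suc2 by (simp only: mult.assoc mult.commute mult.left_commute)
  finally show ?thesis using t(1) out by auto
qed

end

section \<open>Asymptotics\<close>

text \<open>Chosen to meet the three demands on \<open>L\<close> at once. With \<open>b\<close> the
  bit length of |G| and \<open>X = g * g + g\<close>, it exceeds \<open>b + 4\<close>,
  \<open>(b + 2) * (2 * X)\<close> and \<open>X + b + 2\<close>.\<close>

definition bit_bound :: "nat \<Rightarrow> nat \<Rightarrow> nat" where
  "bit_bound n g = 4 * (floorlog 2 n + 3) * (g * g + g + 1)"

definition time_bound :: "nat \<Rightarrow> nat \<Rightarrow> nat" where
  "time_bound n g = 200 * cweight main_com * (nat \<lfloor>2 * sqrt (real n)\<rfloor> + 1) *
     (bit_bound n g + g + 1) ^ 6"

lemma black_boxI: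
  assumes "black_box_input G gs"
  shows "black_box G gs (bit_bound (card (carrier G)) (length gs))
    (nat \<lfloor>2 * sqrt (real (card (carrier G)))\<rfloor>)"
proof -
  let ?N = "card (carrier G)" and ?g = "length gs"
  let ?R = "nat \<lfloor>2 * sqrt (real ?N)\<rfloor>" and ?b = "floorlog 2 ?N" and ?L = "bit_bound ?N ?g"
  let ?X = "?g * ?g + ?g"
  have G: "group G" "finite (carrier G)" "gs \<noteq> []" "set gs \<subseteq> carrier G" "generate G (set gs) = carrier G"
    using assms by (auto simp: black_box_input_def)
  have "0 < ?N"
    using monoid.one_closed[OF group.is_monoid[OF G(1)]] G(2) card_gt_0_iff by blast
  then have N: "?N < 2 ^ ?b" using floorlog_bounds[of ?N 2] by simp
  have pw: "2 ^ i \<le> (2::nat) ^ ?L" if "i \<le> ?L" for i using that by (rule power_increasing) simp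
  show ?thesis
  proof (intro black_box.intro black_box_axioms.intro G)
    have "16 * ?N < 2 ^ (?b + 4)" using N by (simp add: power_add)
    also have "\<dots> \<le> 2 ^ ?L" by (rule pw) (simp add: bit_bound_def)
    finally show "16 * ?N < 2 ^ ?L" .
    have "4 * ?N \<le> 2 ^ (?b + 2)" using N by (simp add: power_add)
    then have "(4 * ?N) ^ (2 * ?X) \<le> (2 ^ (?b + 2)) ^ (2 * ?X)" by (rule power_mono) simp
    also have "\<dots> = 2 ^ ((?b + 2) * (2 * ?X))" by (rule power_mult[symmetric])
    also have "\<dots> < 2 ^ ?L"
      by (rule power_strict_increasing) (simp_all add: bit_bound_def algebra_simps)
    finally show "(4 * ?N) ^ (2 * ?X) < 2 ^ ?L" .
    have R: "real ?R \<le> 2 * sqrt (real ?N)" by simp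
    have "sqrt (real ?N) \<le> real ?N"
      using \<open>0 < ?N\<close> by (intro real_le_lsqrt) (auto simp: power2_eq_square)
    then have "real ?R \<le> real (2 * ?N)" using R unfolding of_nat_mult of_nat_numeral by linarith
    then have "?R \<le> 2 * ?N" by (simp only: of_nat_le_iff)
    then have "?R + 2 \<le> 2 ^ (?b + 2)" using N \<open>0 < ?N\<close> by (simp add: power_add)
    moreover have "?X < 2 ^ ?X" by (rule less_exp)
    ultimately have "?X * (?R + 2) < 2 ^ ?X * 2 ^ (?b + 2)"
      by (intro mult_less_le_imp_less) auto
    also have "\<dots> = 2 ^ (?X + (?b + 2))" by (simp only: power_add)
    also have "\<dots> \<le> 2 ^ ?L" by (rule pw) (simp add: bit_bound_def algebra_simps)
    finally show "?X * (?R + 2) < 2 ^ ?L" .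
    fix n assume "n * n \<le> 4 * ?N"
    then have "real n * real n \<le> 4 * real ?N" by (metis of_nat_le_iff of_nat_mult of_nat_numeral)
    then have "real n \<le> sqrt (4 * real ?N)" by (intro real_le_rsqrt) (simp add: power2_eq_square)
    then have "real n \<le> 2 * sqrt (real ?N)" by (simp add: real_sqrt_mult)
    then show "n \<le> ?R" by (simp add: le_nat_floor)
  qed
qed

text \<open>The bit bound is a logarithm of |G| times the square of the number of generators, hence
  of cubic order in the logarithm; its sixth power gives the exponent 18.\<close>

lemma time_bound_bigo:
  assumes "(\<lambda>n. real (g n)) \<in> O(\<lambda>n. ln (real n))"
  shows "(\<lambda>n. real (time_bound n (g n))) \<in> O(\<lambda>n. sqrt (real n) * ln (real n) ^ 18)"
proof -
  let ?l = "\<lambda>n. ln (real n)"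
  have const: "(\<lambda>n. c) \<in> O(?l)" for c :: real by real_asymp
  have l1: "?l \<in> O(\<lambda>n. ?l n ^ 3)" by real_asymp
  have l2: "?l \<in> O(\<lambda>n. ?l n ^ 2)" by real_asymp
  have c2: "(\<lambda>n. c) \<in> O(\<lambda>n. ?l n ^ 2)" for c :: real by real_asymp
  have c3: "(\<lambda>n. c) \<in> O(\<lambda>n. ?l n ^ 3)" for c :: real by real_asymp
  have "(\<lambda>n. real (floorlog 2 n)) \<in> O(\<lambda>n. log 2 (real n) + 1)"
  proof (rule bigoI[of _ 1], rule eventually_at_top_linorderI[of 1])
    fix n :: nat assume "1 \<le> n"
    then have "0 \<le> log 2 (real n)" "floorlog 2 n = nat \<lfloor>log 2 (real n)\<rfloor> + 1" by (simp_all add: floorlog_def)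
    then show "norm (real (floorlog 2 n)) \<le> 1 * norm (log 2 (real n) + 1)" by simp
  qed
  also have "(\<lambda>n. log 2 (real n) + 1) \<in> O(?l)" by real_asymp
  finally have "(\<lambda>n. 4 * (real (floorlog 2 n) + 3)) \<in> O(?l)"
    by (intro landau_o.big.cmult_in_iff[THEN iffD2] sum_in_bigo const) auto
  moreover have "(\<lambda>n. real (g n) * real (g n) + real (g n) + 1) \<in> O(\<lambda>n. ?l n ^ 2)"
  proof (intro sum_in_bigo c2)
    show "(\<lambda>n. real (g n) * real (g n)) \<in> O(\<lambda>n. ?l n ^ 2)"
      unfolding power2_eq_square by (intro landau_o.big.mult assms)
    show "(\<lambda>n. real (g n)) \<in> O(\<lambda>n. ?l n ^ 2)" using assms l2 by (rule landau_o.big_trans)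
  qed
  ultimately have "(\<lambda>n. 4 * (real (floorlog 2 n) + 3) * (real (g n) * real (g n) + real (g n) + 1)) \<in>
      O(\<lambda>n. ?l n * ?l n ^ 2)" by (rule landau_o.big.mult)
  moreover have "real (bit_bound n (g n)) =
      4 * (real (floorlog 2 n) + 3) * (real (g n) * real (g n) + real (g n) + 1)" for n
    unfolding bit_bound_def by (simp only: of_nat_mult of_nat_add of_nat_numeral of_nat_1)
  ultimately have "(\<lambda>n. real (bit_bound n (g n))) \<in> O(\<lambda>n. ?l n ^ 3)"
    by (simp only: power3_eq_cube power2_eq_square mult.assoc)
  then have "(\<lambda>n. real (bit_bound n (g n)) + real (g n) + 1) \<in> O(\<lambda>n. ?l n ^ 3)"
    using landau_o.big_trans[OF assms l1] by (intro sum_in_bigo c3)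
  then have U: "(\<lambda>n. (real (bit_bound n (g n)) + real (g n) + 1) ^ 6) \<in> O(\<lambda>n. (?l n ^ 3) ^ 6)"
    by (rule landau_o.big_power)
  have R: "(\<lambda>n. real (nat \<lfloor>2 * sqrt (real n)\<rfloor>) + 1) \<in> O(\<lambda>n. sqrt (real n))"
  proof (rule sum_in_bigo)
    show "(\<lambda>n. real (nat \<lfloor>2 * sqrt (real n)\<rfloor>)) \<in> O(\<lambda>n. sqrt (real n))"
      by (rule bigoI[of _ 2], rule always_eventually) simp
    show "(\<lambda>n. 1) \<in> O(\<lambda>n. sqrt (real n))" by real_asymp
  qed
  have "(\<lambda>n. 200 * real (cweight main_com)) \<in> O(\<lambda>n::nat. 1 :: real)" by simp
  then have "(\<lambda>n. 200 * real (cweight main_com) * (real (nat \<lfloor>2 * sqrt (real n)\<rfloor>) + 1) *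
      (real (bit_bound n (g n)) + real (g n) + 1) ^ 6) \<in> O(\<lambda>n. 1 * sqrt (real n) * (?l n ^ 3) ^ 6)"
    by (intro landau_o.big.mult U R)
  moreover have "real (time_bound n (g n)) = 200 * real (cweight main_com) *
      (real (nat \<lfloor>2 * sqrt (real n)\<rfloor>) + 1) * (real (bit_bound n (g n)) + real (g n) + 1) ^ 6" for n
    unfolding time_bound_def by (simp only: of_nat_mult of_nat_add of_nat_power of_nat_numeral of_nat_1)
  moreover have "1 * sqrt (real n) * (?l n ^ 3) ^ 6 = sqrt (real n) * ?l n ^ 18" for n
    by (simp flip: power_mult)
  ultimately show ?thesis by (simp only:)
qed

theorem theorem3p1:
  shows "\<exists>P :: com. \<forall>S :: nat \<Rightarrow> real. S \<in> O(\<lambda>n. ln (real n)) \<longrightarrow>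
    (\<exists>(T :: nat \<Rightarrow> real) (\<epsilon> :: nat \<Rightarrow> real).
       \<epsilon> \<longlonglongrightarrow> 0 \<and>
       T \<in> O(\<lambda>n. real n powr (1 / 2 + \<epsilon> n)) \<and>
       (\<forall>(G :: bitstring monoid) gs.
          in_class_S G \<longrightarrow> black_box_input G gs \<longrightarrow> real (length gs) \<le> S (card (carrier G)) \<longrightarrow>
          (\<exists>t s. exec G P (initial_state gs) t s \<and>
                 real t \<le> T (card (carrier G)) \<and>
                 output_z s \<in> carrier G \<and> output_M s \<subseteq> carrier G \<and>
                 (generate G (output_M s), generate G {output_z s}) \<in> standard_decompositions G)))"
\<comment> \<open>The program is fixed before \<open>S\<close>: it reads the number of generators
  from its input, and \<open>S\<close> enters the time bound only.\<close>
proof (intro exI[of _ main_com] allI impI)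
  fix S :: "nat \<Rightarrow> real" assume S: "S \<in> O(\<lambda>n. ln (real n))"
  \<comment> \<open>Rounding down keeps every admissible number of generators below
    \<open>g\<close>, and negative values of \<open>S\<close> become 0.\<close>
  define g where "g n = nat \<lfloor>S n\<rfloor>" for n
  define T where "T n = real (time_bound n (g n))" for n
  \<comment> \<open>Chosen so that n^\<epsilon> equals (ln n)^18 for all large n.\<close>
  define \<epsilon> where "\<epsilon> n = 18 * ln (ln (real n)) / ln (real n)" for n :: nat
  have "(\<lambda>n. real (g n)) \<in> O(S)"
  proof (rule bigoI[of _ 1], rule always_eventually, rule allI)
    show "norm (real (g n)) \<le> 1 * norm (S n)" for n
      unfolding g_def by (cases "0 \<le> \<lfloor>S n\<rfloor>") simp_all
  qed
  then have "(\<lambda>n. real (g n)) \<in> O(\<lambda>n. ln (real n))" using S by (rule landau_o.big_trans)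
  then have "T \<in> O(\<lambda>n. sqrt (real n) * ln (real n) ^ 18)"
    unfolding T_def by (rule time_bound_bigo)
  also have "(\<lambda>n. sqrt (real n) * ln (real n) ^ 18) \<in> O(\<lambda>n. real n powr (1 / 2 + \<epsilon> n))"
  \<comment> \<open>From 4 on n exceeds e, so ln n is above 1 and the iterated logarithm is taken of
    a positive number.\<close>
  proof (rule landau_o.bigI[of 1], simp, rule eventually_at_top_linorderI[of 4])
    fix n :: nat assume n: "4 \<le> n"
    have l: "1 < ln (real n)"
    proof -
      have "exp 1 < real n" using exp_le n by linarith
      then have "ln (exp 1) < ln (real n)" using n by (subst ln_less_cancel_iff) auto
      then show ?thesis by simp
    qed
    have "real n powr \<epsilon> n = exp (18 * ln (ln (real n)))"
      using n l by (simp add: powr_def \<epsilon>_def)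
    also have "\<dots> = ln (real n) ^ 18" using l exp_of_nat_mult[of 18 "ln (ln (real n))"] by simp
    finally have "real n powr (1 / 2 + \<epsilon> n) = sqrt (real n) * ln (real n) ^ 18"
      by (simp add: powr_add powr_half_sqrt)
    then show "norm (sqrt (real n) * ln (real n) ^ 18) \<le> 1 * norm (real n powr (1 / 2 + \<epsilon> n))" by simp
  qed
  finally have T: "T \<in> O(\<lambda>n. real n powr (1 / 2 + \<epsilon> n))" .
  have \<epsilon>: "\<epsilon> \<longlonglongrightarrow> 0" unfolding \<epsilon>_def by real_asymp
  have "\<exists>t s. exec G main_com (initial_state gs) t s \<and>
      real t \<le> T (card (carrier G)) \<and> output_z s \<in> carrier G \<and> output_M s \<subseteq> carrier G \<and>
      (generate G (output_M s), generate G {output_z s}) \<in> standard_decompositions G"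
    if h: "in_class_S G" "black_box_input G gs" "real (length gs) \<le> S (card (carrier G))" for G gs
  proof -
    let ?N = "card (carrier G)"
    have g: "length gs \<le> g ?N" using h(3) by (simp add: g_def le_nat_floor)
    have "bit_bound ?N (length gs) \<le> bit_bound ?N (g ?N)"
      unfolding bit_bound_def using g by (intro mult_mono add_mono) auto
    then have mono: "time_bound ?N (length gs) \<le> time_bound ?N (g ?N)"
      unfolding time_bound_def using g by (intro mult_mono power_mono add_mono) auto
    obtain t s where ts: "exec G main_com (initial_state gs) t s" "t \<le> time_bound ?N (length gs)"
      "output_z s \<in> carrier G" "output_M s \<subseteq> carrier G"
      "(generate G (output_M s), generate G {output_z s}) \<in> standard_decompositions G"
      using black_box.exec_main[OF black_boxI[OF h(2)] h(1)] unfolding time_bound_def by blast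
    have "real t \<le> T ?N" using ts(2) mono by (simp add: T_def)
    then show ?thesis using ts by blast
  qed
  then show "\<exists>T \<epsilon>. \<epsilon> \<longlonglongrightarrow> 0 \<and> T \<in> O(\<lambda>n. real n powr (1 / 2 + \<epsilon> n)) \<and>
    (\<forall>(G :: bitstring monoid) gs. in_class_S G \<longrightarrow> black_box_input G gs \<longrightarrow>
      real (length gs) \<le> S (card (carrier G)) \<longrightarrow>
      (\<exists>t s. exec G main_com (initial_state gs) t s \<and> real t \<le> T (card (carrier G)) \<and>
        output_z s \<in> carrier G \<and> output_M s \<subseteq> carrier G \<and>
        (generate G (output_M s), generate G {output_z s}) \<in> standard_decompositions G))"
    using T \<epsilon> by blast
qed

end
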